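(* Let $d\in\mathbb{N}^{+}\cup\{\infty\}$, $\eta>0$, $h>0$, $r\in(0,1]$, $\alpha\in\mathrm{DC}^{d}$, and suppose that $v(x)=\sum_{\mathbf{k}\in\Gamma_{r}}\widehat{v}_{\mathbf{k}}\,\mathrm{e}^{\mathrm{i}\langle\mathbf{k},x\rangle}\in C^{\omega}(\mathbb{T}^{d}_{h},\mathbb{C})$. Then there exists $\lambda_{0}=\lambda_{0}(\eta,h,r,\alpha,\|v\|_{h})>0$ such that for every $\lambda\in\mathbb{R}$ with $|\lambda|<\lambda_{0}$ the Lyapunov exponent of the Schrödinger cocycle $(\alpha,S_{E,\lambda v})$ satisfies $$L(E)=\log\Big|\frac E2+\frac{\sqrt{E^2-4}}2\Big|\qquad\text{for all }E\in\mathbb{C}.$$ In particular, $L(E)=0$ for all $E\in\Sigma_{\lambda v,\alpha}$.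
   Context: Torus: $\mathbb{T}=\mathbb{R}/2\pi\mathbb{Z}$, $\mathbb{T}^d=(\mathbb{R}/2\pi\mathbb{Z})^d$, $d\in\mathbb{N}^+\cup\{\infty\}$; coordinates are indexed by integers $1\le j\le d$ (all $j\ge1$ if $d=\infty$), and $\langle j\rangle=\max\{1,j\}$. For an integer vector $\mathbf{k}$ and fixed $\eta>0$, $|\mathbf{k}|_\eta=\sum_j\langle j\rangle^\eta|\mathbf{k}_j|$, and $\mathbb{Z}^d_*=\{\mathbf{k}\in\mathbb{Z}^d:0<|\mathbf{k}|_\eta<\infty\}$. $\mathbb{T}^d_h=\{x\in\mathbb{C}^d:\mathrm{Re}\,x_j\in\mathbb{T},\ |\mathrm{Im}\,x_j|<h\langle j\rangle^\eta\}$; $C^\omega(\mathbb{T}^d_h,\mathbb{C})$ is the space of functions $v(x)=\sum_{\mathbf{k}\in\mathbb{Z}^d_*\cup\{0\}}\widehat v_{\mathbf{k}}\mathrm{e}^{\mathrm{i}\langle\mathbf{k},x\rangle}$ with $\|v\|_h=\sum_{\mathbf{k}}|\widehat v_{\mathbf{k}}|\mathrm{e}^{h|\mathbf{k}|_\eta}<\infty$. Cone: fix weights $w_j>0$ with $\sum_jw_j=1$; $\Gamma_r=\{\mathbf{k}\in\mathbb{Z}^d_*:\sum_j\langle j\rangle^\eta\mathbf{k}_jw_j\ge r|\mathbf{k}|_\eta\}$. For $\gamma\in(0,1)$ and fixed $\tau>1$, $\mathrm{DC}^d_{\gamma,\tau}$ is the set of $\alpha\in[1,2]^d$ with $\inf_{n\in\mathbb{Z}}|\langle\mathbf{k},\alpha\rangle-2\pi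 n|\ge\gamma\prod_j\frac1{1+\langle j\rangle^\tau|\mathbf{k}_j|^\tau}$ for all $\mathbf{k}\in\mathbb{Z}^d_*$; $\mathrm{DC}^d=\bigcup_{\gamma>0}\mathrm{DC}^d_{\gamma,\tau}$. $\Sigma_{\lambda v,\alpha}$ is the ($x$-independent) spectrum of $(H_{\lambda v,\alpha,x}\psi)_n=\psi_{n+1}+\psi_{n-1}+\lambda v(x+n\alpha)\psi_n$ on $\ell^2(\mathbb{Z})$. Cocycle: $S_{E,\lambda v}(x)=\begin{pmatrix}E-\lambda v(x)&-1\\1&0\end{pmatrix}$, $S_n(x)=S_{E,\lambda v}(x+(n-1)\alpha)\cdots S_{E,\lambda v}(x)$ for $n\ge1$, and $L(E)=\lim_{n\to\infty}\frac1n\int_{\mathbb{T}^d}\log\|S_n(x)\|\,\mathrm{d}x$ with $\mathrm{d}x$ the Haar probability measure. The branch of $\sqrt{E^2-4}$ is chosen so that $\big|\frac E2+\frac{\sqrt{E^2-4}}2\big|\ge1$. *)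

theory Defs
  imports "HOL-Probability.Probability"
begin

section \<open>The torus and its dual\<close>

text \<open>
  The dimension is an extended natural number, so that finite and infinite dimension are treated
  alike. Points of \<open>\<real>\<^sup>d\<close> and \<open>\<complex>\<^sup>d\<close> are functions on \<open>nat\<close>
  whose values outside \<open>coords d\<close> are never used. Points of the torus are represented by real
  lifts; all functions on the torus below are \<open>2 * pi\<close>-periodic in each coordinate.
\<close>

definition coords :: "enat \<Rightarrow> nat set" where
  "coords d = {j. 1 \<le> j \<and> enat j \<le> d}"

definition bracket :: "nat \<Rightarrow> real" where
  "bracket j = real (max 1 j)"

definition eta_norm :: "enat \<Rightarrow> real \<Rightarrow> (nat \<Rightarrow> int) \<Rightarrow> real" where
  "eta_norm d \<eta> k = (\<Sum>\<^sub>\<infinity>j\<in>coords d. bracket j powr \<eta> * \<bar>of_int (k j)\<bar>)"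

text \<open>
  The condition \<open>\<bar>k\<bar>\<^sub>\<eta> < \<infinity>\<close> is summability, since \<open>infsum\<close> is \<open>0\<close> for divergent sums.
  Vectors vanish outside \<open>coords d\<close>, so that each integer vector has exactly one representative.
\<close>

definition lattice_fin :: "enat \<Rightarrow> real \<Rightarrow> (nat \<Rightarrow> int) set" where
  "lattice_fin d \<eta> = {k. (\<forall>j. j \<notin> coords d \<longrightarrow> k j = 0) \<and>
     (\<lambda>j. bracket j powr \<eta> * \<bar>of_int (k j)\<bar> :: real) summable_on coords d}"

definition lattice_star :: "enat \<Rightarrow> real \<Rightarrow> (nat \<Rightarrow> int) set" where
  "lattice_star d \<eta> = {k \<in> lattice_fin d \<eta>. 0 < eta_norm d \<eta> k}"

text \<open>
  For \<open>\<eta> > 0\<close> the vectors in \<open>lattice_star d \<eta>\<close> have finite support, so the pairing below is a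
  finite sum, and so is the product in \<open>DC_const\<close>.
\<close>

definition pairing :: "enat \<Rightarrow> (nat \<Rightarrow> int) \<Rightarrow> (nat \<Rightarrow> 'a::real_normed_field) \<Rightarrow> 'a" where
  "pairing d k x = (\<Sum>\<^sub>\<infinity>j\<in>coords d. of_int (k j) * x j)"

definition spectral_cone :: "enat \<Rightarrow> real \<Rightarrow> (nat \<Rightarrow> real) \<Rightarrow> real \<Rightarrow> (nat \<Rightarrow> int) set" where
  "spectral_cone d \<eta> w r = {k \<in> lattice_star d \<eta>.
     (\<Sum>\<^sub>\<infinity>j\<in>coords d. bracket j powr \<eta> * of_int (k j) * w j) \<ge> r * eta_norm d \<eta> k}"

text \<open>
  In infinite dimension the product over all coordinates is the product over the support of \<open>k\<close>,
  as the remaining factors are equal to \<open>1\<close>.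
\<close>

definition DC_const :: "enat \<Rightarrow> real \<Rightarrow> real \<Rightarrow> real \<Rightarrow> (nat \<Rightarrow> real) set" where
  "DC_const d \<eta> \<gamma> \<tau> = {\<alpha>. (\<forall>j\<in>coords d. 1 \<le> \<alpha> j \<and> \<alpha> j \<le> 2) \<and>
     (\<forall>k\<in>lattice_star d \<eta>.
        (INF n::int. \<bar>pairing d k \<alpha> - 2 * pi * of_int n\<bar>) \<ge>
        \<gamma> * (\<Prod>j | j \<in> coords d \<and> k j \<noteq> 0.
               1 / (1 + bracket j powr \<tau> * \<bar>of_int (k j)\<bar> powr \<tau>)))}"

definition DC :: "enat \<Rightarrow> real \<Rightarrow> real \<Rightarrow> (nat \<Rightarrow> real) set" where
  "DC d \<eta> \<tau> = (\<Union>\<gamma>\<in>{0<..<1}. DC_const d \<eta> \<gamma> \<tau>)"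

text \<open>Haar probability measure, transported to the fundamental domain \<open>[0, 2 * pi)\<close> in each coordinate.\<close>

definition torus_haar :: "enat \<Rightarrow> (nat \<Rightarrow> real) measure" where
  "torus_haar d = PiM (coords d) (\<lambda>_. uniform_measure lborel {0..<2 * pi})"


section \<open>Analytic functions on the complex strip\<close>

definition strip :: "enat \<Rightarrow> real \<Rightarrow> real \<Rightarrow> (nat \<Rightarrow> complex) set" where
  "strip d \<eta> h = {x. \<forall>j\<in>coords d. \<bar>Im (x j)\<bar> < h * bracket j powr \<eta>}"

text \<open>
  \<open>analytic_series d \<eta> h c v\<close>: \<open>v\<close> belongs to \<open>C\<^sup>\<omega>(\<T>\<^sup>d\<^sub>h, \<complex>)\<close> and has Fourier coefficients \<open>c\<close>.
  Here \<open>lattice_fin d \<eta>\<close> is \<open>lattice_star d \<eta>\<close> together with \<open>0\<close>.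
\<close>

definition analytic_series ::
    "enat \<Rightarrow> real \<Rightarrow> real \<Rightarrow> ((nat \<Rightarrow> int) \<Rightarrow> complex) \<Rightarrow> ((nat \<Rightarrow> complex) \<Rightarrow> complex) \<Rightarrow> bool" where
  "analytic_series d \<eta> h c v \<longleftrightarrow>
     (\<lambda>k. cmod (c k) * exp (h * eta_norm d \<eta> k)) summable_on lattice_fin d \<eta> \<and>
     (\<forall>x\<in>strip d \<eta> h. v x = (\<Sum>\<^sub>\<infinity>k\<in>lattice_fin d \<eta>. c k * exp (\<i> * pairing d k x)))"

definition series_norm :: "enat \<Rightarrow> real \<Rightarrow> real \<Rightarrow> ((nat \<Rightarrow> int) \<Rightarrow> complex) \<Rightarrow> real" where
  "series_norm d \<eta> h c = (\<Sum>\<^sub>\<infinity>k\<in>lattice_fin d \<eta>. cmod (c k) * exp (h * eta_norm d \<eta> k))"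

definition on_torus :: "((nat \<Rightarrow> complex) \<Rightarrow> complex) \<Rightarrow> (nat \<Rightarrow> real) \<Rightarrow> complex" where
  "on_torus v x = v (\<lambda>j. complex_of_real (x j))"


section \<open>Schroedinger cocycles\<close>

text \<open>In this and the next section \<open>V\<close> is the full potential, coupling constant included.\<close>

definition schrodinger_matrix ::
    "((nat \<Rightarrow> real) \<Rightarrow> complex) \<Rightarrow> complex \<Rightarrow> (nat \<Rightarrow> real) \<Rightarrow> complex^2^2" where
  "schrodinger_matrix V E x = vector [vector [E - V x, - 1], vector [1, 0]]"

primrec transfer_matrix ::
    "(nat \<Rightarrow> real) \<Rightarrow> ((nat \<Rightarrow> real) \<Rightarrow> complex) \<Rightarrow> complex \<Rightarrow> nat \<Rightarrow> (nat \<Rightarrow> real) \<Rightarrow> complex^2^2" where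
  "transfer_matrix \<alpha> V E 0 x = mat 1"
| "transfer_matrix \<alpha> V E (Suc n) x =
     schrodinger_matrix V E (\<lambda>j. x j + of_nat n * \<alpha> j) ** transfer_matrix \<alpha> V E n x"

text \<open>The limit is part of the definition: the Lyapunov exponent exists and is equal to \<open>L\<close>.\<close>

definition has_lyapunov_exponent ::
    "enat \<Rightarrow> (nat \<Rightarrow> real) \<Rightarrow> ((nat \<Rightarrow> real) \<Rightarrow> complex) \<Rightarrow> complex \<Rightarrow> real \<Rightarrow> bool" where
  "has_lyapunov_exponent d \<alpha> V E L \<longleftrightarrow>
     (\<lambda>n. 1 / real n * (LINT x|torus_haar d. ln (onorm (\<lambda>u. transfer_matrix \<alpha> V E n x *v u))))
       \<longlonglongrightarrow> L"

text \<open>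
  The root of \<open>E\<^sup>2 - 4\<close> with \<open>\<bar>E / 2 + root / 2\<bar> \<ge> 1\<close>; the principal root need not satisfy this.
\<close>

definition sqrt_branch :: "complex \<Rightarrow> complex" where
  "sqrt_branch E = (let s = csqrt (E\<^sup>2 - 4) in if cmod (E / 2 + s / 2) \<ge> 1 then s else - s)"

lemma sqrt_branch_power2: "(sqrt_branch E)\<^sup>2 = E\<^sup>2 - 4"
  by (simp add: sqrt_branch_def Let_def)

lemma sqrt_branch_ge_1: "cmod (E / 2 + sqrt_branch E / 2) \<ge> 1"
proof -
  define s where "s = csqrt (E\<^sup>2 - 4)"
  have "s\<^sup>2 = E\<^sup>2 - 4"
    by (simp add: s_def)
  then have "(E / 2 + s / 2) * (E / 2 + - s / 2) = 1"
    by (simp add: field_simps power2_eq_square)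
  then have "cmod (E / 2 + s / 2) * cmod (E / 2 + - s / 2) = 1"
    by (metis norm_mult norm_one)
  then have "cmod (E / 2 + s / 2) \<ge> 1 \<or> cmod (E / 2 + - s / 2) \<ge> 1"
    using mult_strict_mono'[of "cmod (E / 2 + s / 2)" 1 "cmod (E / 2 + - s / 2)" 1] by fastforce
  then show ?thesis
    unfolding sqrt_branch_def Let_def s_def[symmetric] by auto
qed


section \<open>Schroedinger operators on \<open>\<ell>\<^sup>2(\<int>)\<close> and their spectrum\<close>

definition ell2 :: "(int \<Rightarrow> complex) set" where
  "ell2 = {\<psi>. (\<lambda>n. (cmod (\<psi> n))\<^sup>2) summable_on UNIV}"

definition ell2_norm :: "(int \<Rightarrow> complex) \<Rightarrow> real" where
  "ell2_norm \<psi> = sqrt (\<Sum>\<^sub>\<infinity>n. (cmod (\<psi> n))\<^sup>2)"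

definition bounded_operator :: "((int \<Rightarrow> complex) \<Rightarrow> (int \<Rightarrow> complex)) \<Rightarrow> bool" where
  "bounded_operator T \<longleftrightarrow>
     (\<forall>\<psi>\<in>ell2. T \<psi> \<in> ell2) \<and>
     (\<forall>\<psi>\<in>ell2. \<forall>\<phi>\<in>ell2. T (\<lambda>n. \<psi> n + \<phi> n) = (\<lambda>n. T \<psi> n + T \<phi> n)) \<and>
     (\<forall>\<psi>\<in>ell2. \<forall>a. T (\<lambda>n. a * \<psi> n) = (\<lambda>n. a * T \<psi> n)) \<and>
     (\<exists>C. \<forall>\<psi>\<in>ell2. ell2_norm (T \<psi>) \<le> C * ell2_norm \<psi>)"

definition operator_spectrum :: "((int \<Rightarrow> complex) \<Rightarrow> (int \<Rightarrow> complex)) \<Rightarrow> complex set" where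
  "operator_spectrum T = {E. \<not> (\<exists>R. bounded_operator R \<and>
     (\<forall>\<psi>\<in>ell2. R (\<lambda>n. T \<psi> n - E * \<psi> n) = \<psi> \<and> (\<lambda>n. T (R \<psi>) n - E * R \<psi> n) = \<psi>))}"

definition schrodinger_operator ::
    "(nat \<Rightarrow> real) \<Rightarrow> ((nat \<Rightarrow> real) \<Rightarrow> complex) \<Rightarrow> (nat \<Rightarrow> real) \<Rightarrow>
     (int \<Rightarrow> complex) \<Rightarrow> (int \<Rightarrow> complex)" where
  "schrodinger_operator \<alpha> V x \<psi> =
     (\<lambda>n. \<psi> (n + 1) + \<psi> (n - 1) + V (\<lambda>j. x j + of_int n * \<alpha> j) * \<psi> n)"

end

theory Submission
  imports Defs "HOL-Complex_Analysis.Complex_Analysis" "HOL-Real_Asymp.Real_Asymp"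
begin

text \<open>
  Write \<open>E = \<mu> + 1 / \<mu>\<close> with \<open>\<bar>\<mu>\<bar> \<ge> 1\<close>. For \<open>\<bar>\<mu>\<bar> > 1\<close>, that is, for \<open>E\<close> outside \<open>[-2, 2]\<close>, one looks
  for Floquet solutions \<open>\<mu>\<^sup>\<plusminus>\<^sup>n p(x + n\<alpha>)\<close> with \<open>p\<close> a Fourier series supported on the semigroup
  generated by the cone. The equation for \<open>p\<close> is linear and raises the position in the cone, so
  iterating it expresses \<open>p\<close> as a sum over chains \<open>k\<^sub>1, \<dots>, k\<^sub>n\<close> in the cone, weighted by the reciprocals
  of the small divisors at the partial sums of the chain. If two of these divisors are small then so
  is the distance of \<open>\<langle>k, \<alpha>\<rangle>\<close> from \<open>2\<pi>\<int>\<close>, where \<open>k \<noteq> 0\<close> is the difference of the two partial sums. By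
  the Diophantine condition the reciprocals of all divisors but the smallest therefore contribute at most
  \<open>exp (\<epsilon> \<Sum>\<bar>k\<^sub>i\<bar>\<^sub>\<eta> + C n)\<close>, uniformly in the energy, and the smallest one costs a factor of order
  \<open>1 / (1 - \<bar>\<mu>\<bar>\<^sup>-\<^sup>2)\<close>. Hence the series converges for small coupling, with a threshold that does not
  depend on \<open>E\<close>.

  The Wronskian of the two Floquet solutions is constant along orbits, hence equal to its zeroth
  Fourier coefficient \<open>\<mu> - 1 / \<mu>\<close>. The transfer matrices thus grow exactly like \<open>\<bar>\<mu>\<bar>\<^sup>n\<close>, and the Green
  function built from the two solutions shows that \<open>E\<close> is not in the spectrum. For \<open>E\<close> in
  \<open>[-2, 2]\<close> the upper bound follows by the maximum principle on circles of radius \<open>1 / n\<close> about \<open>E\<close>,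
  because the bounds degenerate only polynomially at the real axis; the lower bound is trivial since
  the determinant is \<open>1\<close>.
\<close>

no_notation Infinite_Set_Sum.abs_summable_on (infix \<open>abs'_summable'_on\<close> 50)


section \<open>Products of small divisors\<close>

text \<open>Pigeonhole: \<open>n + 1\<close> points are distributed over \<open>n\<close> cells of
  length \<open>T / n\<close>, so two of them share a cell.\<close>

lemma close_pair_in_interval:
  fixes t :: "'a \<Rightarrow> real"
  assumes "finite J" "card J = Suc n" "n \<ge> 1" "\<And>j. j \<in> J \<Longrightarrow> 0 \<le> t j \<and> t j \<le> T"
  shows "\<exists>i\<in>J. \<exists>j\<in>J. i \<noteq> j \<and> \<bar>t i - t j\<bar> \<le> T / real n"
proof (cases "T > 0")
  case False
  obtain i j where ij: "i \<in> J" "j \<in> J" "i \<noteq> j"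
    using assms(1-3) card_le_Suc0_iff_eq[of J] by force
  have "T = 0" using assms(4)[OF ij(1)] False by auto
  then show ?thesis using ij assms(4)[OF ij(1)] assms(4)[OF ij(2)] by force
next
  case True
  \<comment> \<open>The cap at \<open>n - 1\<close> puts the right end point \<open>T\<close> into
    the last cell instead of a cell of its own.\<close>
  define f where "f j = min (n - 1) (nat \<lfloor>t j * real n / T\<rfloor>)" for j
  have "\<not> inj_on f J"
  proof
    assume "inj_on f J"
    then have "card J = card (f ` J)" by (simp add: card_image)
    also have "\<dots> \<le> card {..<n}"
      by (rule card_mono) (use assms(3) in \<open>auto simp: f_def\<close>)
    finally show False using assms(2) by simp
  qed
  then obtain i j where ij: "i \<in> J" "j \<in> J" "i \<noteq> j" "f i = f j"
    by (auto simp: inj_on_def)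
  have bd: "real (f k) \<le> t k * real n / T \<and> t k * real n / T \<le> real (f k) + 1" if "k \<in> J" for k
  proof -
    have 0: "t k * real n / T \<ge> 0" "t k * real n / T \<le> real n"
      using assms(4)[OF that] True mult_left_mono[of "t k" T "real n"] by (auto simp: field_simps)
    have 1: "real (nat \<lfloor>t k * real n / T\<rfloor>) = of_int \<lfloor>t k * real n / T\<rfloor>"
      using 0 by simp
    show ?thesis
    proof (cases "nat \<lfloor>t k * real n / T\<rfloor> \<le> n - 1")
      case True
      then have "f k = nat \<lfloor>t k * real n / T\<rfloor>" by (simp add: f_def)
      then show ?thesis using 1 by linarith
    next
      case False
      then have "f k = n - 1" by (simp add: f_def)
      then have "real (f k) = real n - 1" using assms(3) by simp
      moreover have "real n \<le> of_int \<lfloor>t k * real n / T\<rfloor>"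
        using False 1 assms(3) by linarith
      ultimately show ?thesis using 0 by linarith
    qed
  qed
  have "t i * real n \<le> real (f i) * T + T" "t j * real n \<le> real (f j) * T + T"
    "real (f i) * T \<le> t i * real n" "real (f j) * T \<le> t j * real n"
    using bd[OF ij(1)] bd[OF ij(2)] True by (auto simp: field_simps)
  then have "\<bar>t i * real n - t j * real n\<bar> \<le> T"
    using ij(4) by (simp add: abs_le_iff)
  then have "\<bar>t i - t j\<bar> \<le> T / real n"
    using assms(3) by (simp add: field_simps abs_le_iff)
  then show ?thesis using ij by blast
qed

text \<open>Of two points of a closest pair the one with the larger divisor is removed first; iterating
  this leaves a single point, whose divisor is not controlled.\<close>

lemma prod_small_divisors_ge:
  fixes t \<delta> :: "'a \<Rightarrow> real" and \<Omega> :: "real \<Rightarrow> real"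
  assumes "finite J" "card J = Suc n"
    and "\<And>j. j \<in> J \<Longrightarrow> 0 \<le> t j \<and> t j \<le> T" and "\<And>j. j \<in> J \<Longrightarrow> \<delta> j \<ge> 0"
    and "\<And>a b. 0 \<le> a \<Longrightarrow> a \<le> b \<Longrightarrow> \<Omega> a \<le> \<Omega> b"
    and "\<And>i j. i \<in> J \<Longrightarrow> j \<in> J \<Longrightarrow> i \<noteq> j \<Longrightarrow> max (\<delta> i) (\<delta> j) \<ge> exp (- \<Omega> \<bar>t i - t j\<bar>)"
  shows "\<exists>j\<in>J. (\<Prod>i\<in>J - {j}. \<delta> i) \<ge> exp (- (\<Sum>m=1..n. \<Omega> (T / real m)))"
  using assms
proof (induction n arbitrary: J)
  case 0
  then obtain j where "J = {j}" by (auto simp: card_Suc_eq)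
  then show ?case by auto
next
  case (Suc n)
  \<comment> \<open>With \<open>n + 2\<close> points left there is a pair at distance at most
    \<open>T / (n + 1)\<close>; this produces the term \<open>m = n + 1\<close> of the sum.\<close>
  obtain i j where ij: "i \<in> J" "j \<in> J" "i \<noteq> j" "\<bar>t i - t j\<bar> \<le> T / real (Suc n)"
    using close_pair_in_interval[OF Suc.prems(1,2), of t T] Suc.prems(3) by auto
  obtain a where a: "a \<in> J" "\<delta> a \<ge> exp (- \<Omega> (T / real (Suc n)))"
  proof -
    have "exp (- \<Omega> (T / real (Suc n))) \<le> exp (- \<Omega> \<bar>t i - t j\<bar>)"
      using Suc.prems(5)[of "\<bar>t i - t j\<bar>"] ij(4) by simp
    also have "\<dots> \<le> max (\<delta> i) (\<delta> j)" using Suc.prems(6) ij by blast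
    finally show ?thesis using that ij by (metis max_def)
  qed
  have "\<exists>j\<in>J - {a}. (\<Prod>i\<in>J - {a} - {j}. \<delta> i) \<ge> exp (- (\<Sum>m=1..n. \<Omega> (T / real m)))"
    by (rule Suc.IH) (use Suc.prems a in auto)
  then obtain b where b: "b \<in> J" "b \<noteq> a"
    "(\<Prod>i\<in>J - {a} - {b}. \<delta> i) \<ge> exp (- (\<Sum>m=1..n. \<Omega> (T / real m)))" by auto
  have "J - {b} = insert a (J - {a} - {b})" using a b by auto
  then have "(\<Prod>i\<in>J - {b}. \<delta> i) = \<delta> a * (\<Prod>i\<in>J - {a} - {b}. \<delta> i)"
    using Suc.prems(1) by simp
  also have "\<dots> \<ge> exp (- \<Omega> (T / real (Suc n))) * exp (- (\<Sum>m=1..n. \<Omega> (T / real m)))"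
    using a b Suc.prems(4) by (intro mult_mono) auto
  finally have "(\<Prod>i\<in>J - {b}. \<delta> i) \<ge> exp (- (\<Sum>m=1..Suc n. \<Omega> (T / real m)))"
    by (simp add: exp_add[symmetric] algebra_simps)
  then show ?case using b by auto
qed

text \<open>The usual comparison with an integral, done by telescoping: each term is at most an
  increment of \<open>n powr (1 - \<sigma>)\<close>.\<close>

lemma sum_powr_minus_le:
  fixes \<sigma> :: real
  assumes "0 \<le> \<sigma>" "\<sigma> < 1"
  shows "(1 - \<sigma>) * (\<Sum>m=1..n. real m powr (- \<sigma>)) \<le> real n powr (1 - \<sigma>)"
proof (induction n)
  case (Suc n)
  have step: "(1 - \<sigma>) * real (Suc n) powr (- \<sigma>) \<le> real (Suc n) powr (1 - \<sigma>) - real n powr (1 - \<sigma>)"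
  proof -
    define y where "y = real (Suc n)"
    have y: "y \<ge> 1" "real n = y - 1" by (auto simp: y_def)
    \<comment> \<open>Weighted arithmetic-geometric mean inequality for \<open>1 - 1 / y\<close> and
      \<open>1\<close>; it yields Bernoulli's inequality below. For \<open>y = 1\<close> the base
      vanishes and the claim is checked directly.\<close>
    have "(1 - 1 / y) powr (1 - \<sigma>) \<le> (1 - \<sigma>) * (1 - 1 / y) + \<sigma>"
    proof (cases "y = 1")
      case False
      then show ?thesis using Youngs_inequality_0[of "1 - \<sigma>" \<sigma> "1 - 1/y" 1] assms y by simp
    qed (use assms in simp)
    then have "(1 - 1 / y) powr (1 - \<sigma>) \<le> 1 - (1 - \<sigma>) / y"
      using y by (simp add: algebra_simps diff_divide_distrib)
    then have "y powr (1 - \<sigma>) * (1 - 1 / y) powr (1 - \<sigma>) \<le> y powr (1 - \<sigma>) * (1 - (1 - \<sigma>) / y)"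
      by (intro mult_left_mono) auto
    moreover have "y powr (1 - \<sigma>) * (1 - 1 / y) powr (1 - \<sigma>) = real n powr (1 - \<sigma>)"
      using y by (subst powr_mult[symmetric]) (auto simp: algebra_simps)
    moreover have "y powr (1 - \<sigma>) / y = y powr (- \<sigma>)"
      using y by (simp add: powr_diff powr_minus field_simps)
    moreover have "y powr (1 - \<sigma>) * (1 - (1 - \<sigma>) / y) = y powr (1 - \<sigma>) - (1 - \<sigma>) * (y powr (1 - \<sigma>) / y)"
      by (simp add: algebra_simps)
    ultimately show ?thesis
      unfolding y_def[symmetric] by simp
  qed
  then show ?case using Suc by (simp add: algebra_simps)
qed simp

lemma powr_le_eps_linear:
  fixes \<sigma> \<epsilon> :: real
  assumes "0 < \<sigma>" "\<sigma> < 1" "\<epsilon> > 0"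
  shows "\<exists>C\<ge>0. \<forall>x\<ge>0. x powr \<sigma> \<le> \<epsilon> * x + C"
proof -
  have "\<forall>\<^sub>F x::real in at_top. x powr \<sigma> \<le> \<epsilon> * x"
    using assms by real_asymp
  then obtain X where X: "\<And>x. x \<ge> X \<Longrightarrow> x powr \<sigma> \<le> \<epsilon> * x"
    by (auto simp: eventually_at_top_linorder)
  have "x powr \<sigma> \<le> \<epsilon> * x + \<bar>X\<bar> powr \<sigma>" if "x \<ge> 0" for x
  proof (cases "x \<ge> X")
    case True
    then show ?thesis using X[of x] by (smt (verit) powr_ge_zero)
  next
    case False
    then have "x powr \<sigma> \<le> \<bar>X\<bar> powr \<sigma>" using that assms by (intro powr_mono2) auto
    then show ?thesis using that assms by (smt (verit) mult_nonneg_nonneg)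
  qed
  then show ?thesis by (intro exI[of _ "\<bar>X\<bar> powr \<sigma>"]) auto
qed

text \<open>Because \<open>\<sigma> < 1\<close>, the sum over \<open>m\<close> is of the order of
  \<open>n * (T / n) powr \<sigma>\<close>. Bounding the sublinear power at the mean
  \<open>T / n\<close> by a linear function makes the coefficient of \<open>T\<close> as small as
  desired, so that the exponential weights of an analytic potential can absorb it; the cost is a
  constant per step of the chain.\<close>

lemma sum_divisor_exponents_le:
  fixes A B \<sigma> \<epsilon> :: real
  assumes "0 < \<sigma>" "\<sigma> < 1" "\<epsilon> > 0" "A \<ge> 0" "B \<ge> 0"
  shows "\<exists>C\<ge>0. \<forall>n. \<forall>T\<ge>0. (\<Sum>m=1..n. A + B * (T / real m) powr \<sigma>) \<le> \<epsilon> * T + C * real n"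
proof -
  \<comment> \<open>The added \<open>1\<close> keeps \<open>B'\<close> positive, as it is a
    denominator below.\<close>
  define B' where "B' = B / (1 - \<sigma>) + 1"
  have B': "B' > 0" using assms by (simp add: B'_def add_nonneg_pos)
  obtain C where C: "C \<ge> 0" "\<And>x. x \<ge> 0 \<Longrightarrow> x powr \<sigma> \<le> \<epsilon> / B' * x + C"
    using powr_le_eps_linear[of \<sigma> "\<epsilon> / B'"] assms B' by auto
  have "(\<Sum>m=1..n. A + B * (T / real m) powr \<sigma>) \<le> \<epsilon> * T + (A + B' * C) * real n"
    if T: "T \<ge> 0" for n T
  proof (cases "n = 0")
    case False
    have "(T / real m) powr \<sigma> = T powr \<sigma> * real m powr (- \<sigma>)" for m
      using T by (subst powr_divide) (auto simp: powr_minus divide_inverse)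
    then have "(\<Sum>m=1..n. A + B * (T / real m) powr \<sigma>) =
        A * real n + B * T powr \<sigma> * (\<Sum>m=1..n. real m powr (- \<sigma>))"
      by (simp add: sum.distrib sum_distrib_left mult.assoc)
    also have "(\<Sum>m=1..n. real m powr (- \<sigma>)) \<le> real n powr (1 - \<sigma>) / (1 - \<sigma>)"
      using sum_powr_minus_le[of \<sigma> n] assms by (simp add: field_simps)
    also have "A * real n + B * T powr \<sigma> * (real n powr (1 - \<sigma>) / (1 - \<sigma>))
        \<le> A * real n + B' * (T powr \<sigma> * real n powr (1 - \<sigma>))"
      using assms by (simp add: B'_def algebra_simps)
    also have "T powr \<sigma> * real n powr (1 - \<sigma>) = real n * (T / real n) powr \<sigma>"
      using T False by (simp add: powr_divide powr_diff field_simps)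
    also have "\<dots> \<le> real n * (\<epsilon> / B' * (T / real n) + C)"
      using C(2)[of "T / real n"] T by (intro mult_left_mono) auto
    also have "A * real n + B' * (real n * (\<epsilon> / B' * (T / real n) + C)) =
        \<epsilon> * T + (A + B' * C) * real n"
      using False B' by (simp add: field_simps)
    finally show ?thesis using assms B' by (simp add: mult_left_mono)
  qed (use T assms in auto)
  then show ?thesis using assms B' C(1) by (intro exI[of _ "A + B' * C"]) auto
qed


section \<open>Sums over lists and almost periodic sums\<close>

lemma has_sum_product:
  fixes f :: "'a \<Rightarrow> complex" and g :: "'b \<Rightarrow> complex"
  assumes "f abs_summable_on A" "g abs_summable_on B"
  shows "(\<lambda>(x, y). f x * g y) abs_summable_on A \<times> B"
    and "((\<lambda>(x, y). f x * g y) has_sum infsum f A * infsum g B) (A \<times> B)"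
proof -
  have "(\<lambda>p. norm (f (fst p)) * norm (g (snd p))) summable_on A \<times> B"
  proof (rule summable_on_SigmaI)
    show "((\<lambda>y. norm (f (fst (x, y))) * norm (g (snd (x, y)))) has_sum
        norm (f x) * (\<Sum>\<^sub>\<infinity>y\<in>B. norm (g y))) B" for x
      using assms(2) by (auto intro!: has_sum_cmult_right)
    show "(\<lambda>x. norm (f x) * (\<Sum>\<^sub>\<infinity>y\<in>B. norm (g y))) summable_on A"
      using assms(1) by (rule summable_on_cmult_left)
  qed auto
  then show *: "(\<lambda>(x, y). f x * g y) abs_summable_on A \<times> B"
    by (simp add: case_prod_unfold norm_mult)
  then have **: "(\<lambda>(x, y). f x * g y) summable_on A \<times> B"
    by (rule abs_summable_summable)
  have "infsum (\<lambda>(x, y). f x * g y) (A \<times> B) = infsum f A * infsum g B"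
    using infsum_Sigma'_banach[OF **, symmetric]
    by (simp add: infsum_cmult_right' infsum_cmult_left')
  then show "((\<lambda>(x, y). f x * g y) has_sum infsum f A * infsum g B) (A \<times> B)"
    using ** by (simp add: has_sum_iff)
qed

text \<open>The lists of length \<open>n\<close> contribute at most the \<open>n\<close>-th power of
  the total of \<open>f\<close>, so the whole sum is dominated by a geometric series.\<close>

lemma summable_on_lists:
  fixes f :: "'a \<Rightarrow> real"
  assumes "f summable_on A" "\<And>x. x \<in> A \<Longrightarrow> f x \<ge> 0" "infsum f A \<le> s" "s < 1"
  shows "(\<lambda>xs. prod_list (map f xs)) summable_on lists A"
    and "infsum (\<lambda>xs. prod_list (map f xs)) (lists A) \<le> 1 / (1 - s)"
proof -
  have nonneg: "prod_list (map f xs) \<ge> 0" if "xs \<in> lists A" for xs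
    using that by (induction xs) (auto simp: assms(2))
  have s0: "s \<ge> 0" using assms(2,3) infsum_nonneg[of A f] by force
  have fin: "(\<Sum>xs\<in>F. prod_list (map f xs)) \<le> 1 / (1 - s)" if F: "finite F" "F \<subseteq> lists A" for F
  proof -
    \<comment> \<open>A finite family of lists uses finitely many letters and has bounded length, so
      it lies among the words of length below \<open>N\<close> over \<open>A'\<close>.\<close>
    define A' where "A' = (\<Union>xs\<in>F. set xs)"
    define N where "N = Suc (\<Sum>xs\<in>F. length xs)"
    have A': "finite A'" "A' \<subseteq> A" using F by (auto simp: A'_def)
    have len: "length xs < N" if "xs \<in> F" for xs
      using member_le_sum[of xs F length] F that by (simp add: N_def less_Suc_eq_le)
    define L where "L n = {xs. set xs \<subseteq> A' \<and> length xs = n}" for n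
    have finL: "finite (L n)" for n unfolding L_def using A'(1) by (rule finite_lists_length_eq)
    have sumL: "(\<Sum>xs\<in>L n. prod_list (map f xs)) = (\<Sum>x\<in>A'. f x) ^ n" for n
    proof (induction n)
      case 0
      have "L 0 = {[]}" by (auto simp: L_def)
      then show ?case by simp
    next
      case (Suc n)
      have eq: "L (Suc n) = (\<lambda>(x, xs). x # xs) ` (A' \<times> L n)"
        by (auto simp: L_def length_Suc_conv image_iff)
      have "(\<Sum>xs\<in>L (Suc n). prod_list (map f xs)) = (\<Sum>(x, xs)\<in>A' \<times> L n. f x * prod_list (map f xs))"
        unfolding eq by (subst sum.reindex) (auto simp: inj_on_def case_prod_unfold)
      also have "\<dots> = (\<Sum>x\<in>A'. f x) * (\<Sum>xs\<in>L n. prod_list (map f xs))"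
        by (simp add: sum_product sum.cartesian_product)
      finally show ?case using Suc by simp
    qed
    have "(\<Sum>xs\<in>F. prod_list (map f xs)) \<le> (\<Sum>xs\<in>(\<Union>n<N. L n). prod_list (map f xs))"
    proof (rule sum_mono2)
      show "F \<subseteq> (\<Union>n<N. L n)" using len by (auto simp: L_def A'_def)
      show "prod_list (map f xs) \<ge> 0" if "xs \<in> (\<Union>n<N. L n) - F" for xs
        using that A' by (intro nonneg) (auto simp: L_def)
    qed (use finL in auto)
    also have "\<dots> = (\<Sum>n<N. \<Sum>xs\<in>L n. prod_list (map f xs))"
      by (rule sum.UNION_disjoint) (use finL in \<open>auto simp: L_def\<close>)
    also have "\<dots> = (\<Sum>n<N. (\<Sum>x\<in>A'. f x) ^ n)" by (simp add: sumL)
    also have "\<dots> \<le> (\<Sum>n<N. s ^ n)"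
    proof (intro sum_mono power_mono)
      have "(\<Sum>x\<in>A'. f x) \<le> infsum f A"
        using A' assms by (intro finite_sum_le_infsum) auto
      then show "(\<Sum>x\<in>A'. f x) \<le> s" using assms by simp
      show "0 \<le> (\<Sum>x\<in>A'. f x)" using A' assms by (intro sum_nonneg) auto
    qed
    also have "\<dots> \<le> 1 / (1 - s)"
      using s0 assms(4) by (simp add: sum_gp_strict divide_right_mono)
    finally show ?thesis .
  qed
  show 1: "(\<lambda>xs. prod_list (map f xs)) summable_on lists A"
    by (rule nonneg_bdd_above_summable_on) (use nonneg fin in \<open>auto intro!: bdd_aboveI2\<close>)
  show "infsum (\<lambda>xs. prod_list (map f xs)) (lists A) \<le> 1 / (1 - s)"
    using 1 fin by (rule infsum_le_finite_sums)
qed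

lemma norm_sum_cis_le:
  assumes "cis \<theta> \<noteq> 1"
  shows "norm (\<Sum>n<N. cis (real n * \<theta>)) \<le> 2 / norm (1 - cis \<theta>)"
proof -
  have "(\<Sum>n<N. cis (real n * \<theta>)) = (1 - cis \<theta> ^ N) / (1 - cis \<theta>)"
  proof -
    have "cis (real n * \<theta>) = cis \<theta> ^ n" for n
      by (simp only: Complex.DeMoivre)
    then show ?thesis using assms by (simp add: sum_gp_strict)
  qed
  moreover have "norm (1 - cis \<theta> ^ N) \<le> 2"
    using norm_triangle_ineq4[of 1 "cis \<theta> ^ N"] by (simp add: norm_power)
  ultimately show ?thesis by (simp add: norm_divide divide_right_mono)
qed

text \<open>The mean over \<open>n\<close> extracts the coefficient of frequency zero: every other
  mode has bounded partial sums, being geometric, and averages to zero. Since the values are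
  constant in \<open>n\<close>, the mean is \<open>K\<close> itself. A finite truncation with tail
  at most \<open>\<epsilon>\<close> makes the bound on the partial sums uniform.\<close>

lemma constant_almost_periodic:
  fixes g :: "'i \<Rightarrow> complex" and \<theta> :: "'i \<Rightarrow> real"
  assumes g: "g abs_summable_on I" and i0: "i0 \<in> I" "\<theta> i0 = 0"
    and ne: "\<And>i. i \<in> I \<Longrightarrow> i \<noteq> i0 \<Longrightarrow> cis (\<theta> i) \<noteq> 1"
    and K: "\<And>n::nat. (\<Sum>\<^sub>\<infinity>i\<in>I. g i * cis (real n * \<theta> i)) = K"
  shows "K = g i0"
proof -
  have "norm (K - g i0) \<le> \<epsilon>" if \<epsilon>: "\<epsilon> > 0" for \<epsilon>
  proof -
    obtain F where F: "finite F" "F \<subseteq> I" "dist (\<Sum>i\<in>F. norm (g i)) (\<Sum>\<^sub>\<infinity>i\<in>I. norm (g i)) \<le> \<epsilon>"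
      using infsum_finite_approximation[OF g \<epsilon>] by blast
    define F' where "F' = insert i0 F"
    have F': "finite F'" "F' \<subseteq> I" "i0 \<in> F'" using F i0 by (auto simp: F'_def)
    have tail: "(\<Sum>\<^sub>\<infinity>i\<in>I - F'. norm (g i)) \<le> \<epsilon>"
    proof -
      have "(\<Sum>\<^sub>\<infinity>i\<in>I - F'. norm (g i)) = (\<Sum>\<^sub>\<infinity>i\<in>I. norm (g i)) - (\<Sum>i\<in>F'. norm (g i))"
        using F' g by (subst infsum_Diff) auto
      moreover have "(\<Sum>i\<in>F. norm (g i)) \<le> (\<Sum>i\<in>F'. norm (g i))"
        using F by (intro sum_mono2) (auto simp: F'_def)
      ultimately show ?thesis using F(3) by (simp add: dist_real_def abs_le_iff)
    qed
    define G where "G n = (\<Sum>i\<in>F'. g i * cis (real n * \<theta> i))" for n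
    have near: "norm (K - G n) \<le> \<epsilon>" for n
    proof -
      have abs: "(\<lambda>i. g i * cis (real n * \<theta> i)) abs_summable_on I"
        using g by (simp add: norm_mult)
      have abs': "(\<lambda>i. g i * cis (real n * \<theta> i)) abs_summable_on (I - F')"
        using abs by (rule summable_on_subset_banach) auto
      have "K - G n = (\<Sum>\<^sub>\<infinity>i\<in>I - F'. g i * cis (real n * \<theta> i))"
        unfolding K[of n, symmetric] G_def
        using F' abs_summable_summable[OF abs] by (subst infsum_Diff) auto
      also have "norm \<dots> \<le> (\<Sum>\<^sub>\<infinity>i\<in>I - F'. norm (g i * cis (real n * \<theta> i)))"
        using abs' by (rule norm_infsum_bound)
      also have "\<dots> = (\<Sum>\<^sub>\<infinity>i\<in>I - F'. norm (g i))" by (simp add: norm_mult)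
      finally show ?thesis using tail by simp
    qed
    \<comment> \<open>Bounds the partial sums of all retained modes other than \<open>i0\<close>,
      independently of the number of terms.\<close>
    define C where "C = (\<Sum>i\<in>F' - {i0}. norm (g i) * (2 / norm (1 - cis (\<theta> i))))"
    have bd: "real N * norm (K - g i0) \<le> real N * \<epsilon> + C" for N
    proof -
      have "(\<Sum>n<N. G n) = (\<Sum>i\<in>F'. g i * (\<Sum>n<N. cis (real n * \<theta> i)))"
        unfolding G_def by (subst sum.swap) (simp add: sum_distrib_left)
      also have "\<dots> = of_nat N * g i0 + (\<Sum>i\<in>F' - {i0}. g i * (\<Sum>n<N. cis (real n * \<theta> i)))"
        using F' i0 by (subst sum.remove[of F' i0]) auto
      finally have "of_nat N * (K - g i0) = (\<Sum>n<N. K - G n)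
          + (\<Sum>i\<in>F' - {i0}. g i * (\<Sum>n<N. cis (real n * \<theta> i)))"
        by (simp add: sum_subtractf algebra_simps)
      then have "norm (of_nat N * (K - g i0)) \<le> norm (\<Sum>n<N. K - G n)
          + norm (\<Sum>i\<in>F' - {i0}. g i * (\<Sum>n<N. cis (real n * \<theta> i)))"
        by (simp only: norm_triangle_ineq)
      also have "norm (\<Sum>n<N. K - G n) \<le> (\<Sum>n<N. \<epsilon>)"
        by (rule sum_norm_le) (rule near)
      also have "norm (\<Sum>i\<in>F' - {i0}. g i * (\<Sum>n<N. cis (real n * \<theta> i))) \<le> C"
        unfolding C_def
      proof (rule sum_norm_le)
        fix i assume i: "i \<in> F' - {i0}"
        then have "cis (\<theta> i) \<noteq> 1" using ne F' by auto
        from norm_sum_cis_le[OF this]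
        show "norm (g i * (\<Sum>n<N. cis (real n * \<theta> i))) \<le> norm (g i) * (2 / norm (1 - cis (\<theta> i)))"
          unfolding norm_mult by (rule mult_left_mono) simp
      qed
      finally show ?thesis by (simp add: norm_mult)
    qed
    show ?thesis
    proof (rule ccontr)
      assume "\<not> ?thesis"
      then obtain N where "C < real N * (norm (K - g i0) - \<epsilon>)"
        using reals_Archimedean3[of "norm (K - g i0) - \<epsilon>"] by auto
      then show False using bd[of N] by (simp add: algebra_simps)
    qed
  qed
  then have "norm (K - g i0) \<le> 0" by (rule field_le_epsilon[of _ 0, simplified])
  then show ?thesis by simp
qed


section \<open>Floquet solutions\<close>

text \<open>The factor by which \<open>p n \<mapsto> \<nu> * p (n + 1) + p (n - 1) / \<nu> - (\<nu> + 1 / \<nu>) * p n\<close> multiplies the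
  mode \<open>p n = cis (n * \<theta>)\<close>.\<close>

definition floquet_divisor :: "complex \<Rightarrow> real \<Rightarrow> complex" where
  "floquet_divisor \<nu> \<theta> = \<nu> * cis \<theta> + inverse \<nu> * cis (- \<theta>) - \<nu> - inverse \<nu>"

lemma floquet_divisor_0 [simp]: "floquet_divisor \<nu> 0 = 0"
  by (simp add: floquet_divisor_def)

text \<open>For \<open>\<nu> = \<mu>\<close> the divisor equals \<open>\<mu> * cis (- \<theta>) *
  (cis \<theta> - 1) * (cis \<theta> - z)\<close> with \<open>z = inverse \<mu> ^ 2\<close>; passing
  to \<open>inverse \<mu>\<close> reverses the sign of \<open>\<theta>\<close>, which conjugates
  \<open>z\<close>. The factor \<open>cmod \<mu> > 1\<close> is dropped. The first root lies on the
  unit circle, the second strictly inside it.\<close>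

lemma norm_floquet_divisor_ge:
  assumes "cmod \<mu> > 1" "\<nu> = \<mu> \<or> \<nu> = inverse \<mu>"
  obtains z where "cmod z = 1 / (cmod \<mu>)\<^sup>2"
    "\<And>\<theta>. cmod (floquet_divisor \<nu> \<theta>) \<ge> cmod (cis \<theta> - 1) * cmod (cis \<theta> - z)"
proof -
  have \<mu>: "\<mu> \<noteq> 0" using assms(1) by auto
  have cis: "cis (- \<theta>) * cis \<theta> = 1" for \<theta> by (simp add: cis_mult)
  show ?thesis
  proof (cases "\<nu> = \<mu>")
    case True
    have "floquet_divisor \<nu> \<theta> = \<mu> * cis (- \<theta>) * ((cis \<theta> - 1) * (cis \<theta> - inverse \<mu> ^ 2))" for \<theta>
    proof -
      have "\<mu> * cis (- \<theta>) * ((cis \<theta> - 1) * (cis \<theta> - inverse \<mu> ^ 2)) =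
          \<mu> * (cis (- \<theta>) * cis \<theta>) * (cis \<theta> - 1) + (\<mu> * inverse \<mu>) * inverse \<mu> * (cis (- \<theta>) - cis (- \<theta>) * cis \<theta>)"
        by (simp add: algebra_simps power2_eq_square)
      also have "\<dots> = floquet_divisor \<nu> \<theta>"
        using \<mu> cis True by (simp add: floquet_divisor_def algebra_simps)
      finally show ?thesis ..
    qed
    then have "cmod (floquet_divisor \<nu> \<theta>) = cmod \<mu> * (cmod (cis \<theta> - 1) * cmod (cis \<theta> - inverse \<mu> ^ 2))" for \<theta>
      by (simp add: norm_mult)
    then show ?thesis
      using assms(1) by (intro that[of "inverse \<mu> ^ 2"])
        (simp_all add: norm_power norm_inverse norm_divide power_divide inverse_eq_divide mult_le_cancel_right1 mult_less_0_iff)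
  next
    case False
    then have \<nu>: "\<nu> = inverse \<mu>" using assms by simp
    have "floquet_divisor \<nu> \<theta> = - (\<mu> * cis (- \<theta>) * (cis \<theta> - 1)) * (cis (- \<theta>) - inverse \<mu> ^ 2) * cis \<theta>" for \<theta>
    proof -
      have "- (\<mu> * cis (- \<theta>) * (cis \<theta> - 1)) * (cis (- \<theta>) - inverse \<mu> ^ 2) * cis \<theta> =
         - \<mu> * (cis (- \<theta>) * cis \<theta>) * (cis (- \<theta>) * cis \<theta> - cis (- \<theta>)) +
         (\<mu> * inverse \<mu>) * inverse \<mu> * (cis (- \<theta>) * cis \<theta>) * (cis \<theta> - 1)"
        by (simp add: algebra_simps power2_eq_square)
      also have "\<dots> = floquet_divisor \<nu> \<theta>"
        using \<mu> cis \<nu> by (simp add: floquet_divisor_def algebra_simps)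
      finally show ?thesis ..
    qed
    moreover have "cmod (cis (- \<theta>) - inverse \<mu> ^ 2) = cmod (cis \<theta> - cnj (inverse \<mu> ^ 2))" for \<theta>
      by (metis cis_cnj complex_cnj_cnj complex_cnj_diff complex_mod_cnj)
    ultimately have "cmod (floquet_divisor \<nu> \<theta>) = cmod \<mu> * (cmod (cis \<theta> - 1) * cmod (cis \<theta> - cnj (inverse \<mu> ^ 2)))" for \<theta>
      by (simp add: norm_mult)
    then show ?thesis
      using assms(1) by (intro that[of "cnj (inverse \<mu> ^ 2)"])
        (simp_all add: norm_power norm_inverse norm_divide power_divide inverse_eq_divide mult_le_cancel_right1 mult_less_0_iff)
  qed
qed

text \<open>Abstract form of the data for the small divisor argument. In the application
  \<open>\<kappa> k\<close> is the pairing of \<open>k\<close> with the frequency vector and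
  \<open>N k\<close> is its weighted norm. The bound is imposed on whole chains; that chains in a
  cone cannot add up to zero is what makes this possible. The factor \<open>2\<close> is used up by
  the triangle inequality in \<open>suffix_separation\<close>.\<close>

locale nonresonant_frequencies =
  fixes \<Gamma> :: "'k set" and \<kappa> N :: "'k \<Rightarrow> real" and A B \<sigma> :: real
  assumes N_nonneg: "k \<in> \<Gamma> \<Longrightarrow> N k \<ge> 0"
    and params: "0 < \<sigma>" "\<sigma> < 1" "A \<ge> 0" "B \<ge> 0"
    and diophantine: "ks \<in> lists \<Gamma> \<Longrightarrow> ks \<noteq> [] \<Longrightarrow>
      cmod (cis (sum_list (map \<kappa> ks)) - 1) \<ge> 2 * exp (- (A + B * sum_list (map N ks) powr \<sigma>))"
begin

lemma N_sum_nonneg: "ks \<in> lists \<Gamma> \<Longrightarrow> sum_list (map N ks) \<ge> 0"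
  by (induction ks) (auto simp: N_nonneg)

lemma cis_sum_ne_1: "ks \<in> lists \<Gamma> \<Longrightarrow> ks \<noteq> [] \<Longrightarrow> cis (sum_list (map \<kappa> ks)) \<noteq> 1"
  using diophantine[of ks] by (auto simp: not_le)

text \<open>If two phase factors were both close to the same \<open>z\<close>, they would be close
  to each other; but their distance is that of the phase factor of the intermediate chain from
  \<open>1\<close>, which the Diophantine bound controls.\<close>

lemma suffix_separation:
  assumes "ks \<in> lists \<Gamma>" "i < j" "j \<le> length ks"
  shows "max (cmod (cis (sum_list (map \<kappa> (drop i ks))) - z)) (cmod (cis (sum_list (map \<kappa> (drop j ks))) - z))
    \<ge> exp (- (A + B * \<bar>sum_list (map N (drop i ks)) - sum_list (map N (drop j ks))\<bar> powr \<sigma>))"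
proof -
  define ms where "ms = take (j - i) (drop i ks)"
  have eq: "drop i ks = ms @ drop j ks"
    using assms append_take_drop_id[of "j - i" "drop i ks"] by (simp add: ms_def)
  have "set ms \<subseteq> set ks" unfolding ms_def by (meson order_trans set_drop_subset set_take_subset)
  then have ms: "ms \<in> lists \<Gamma>" "ms \<noteq> []" using assms by (auto simp: ms_def)
  define a b where "a = sum_list (map \<kappa> ms)" and "b = sum_list (map \<kappa> (drop j ks))"
  have "2 * exp (- (A + B * sum_list (map N ms) powr \<sigma>)) \<le> cmod (cis a - 1)"
    using diophantine ms by (simp add: a_def)
  also have "\<dots> = cmod (cis b * (cis a - 1))" by (simp add: norm_mult)
  also have "cis b * (cis a - 1) = (cis (a + b) - z) - (cis b - z)"
    by (simp add: right_diff_distrib cis_mult add.commute)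
  also have "cmod \<dots> \<le> cmod (cis (a + b) - z) + cmod (cis b - z)"
    by (rule norm_triangle_ineq4)
  \<comment> \<open>The larger of two numbers is at least half their sum.\<close>
  finally have "exp (- (A + B * sum_list (map N ms) powr \<sigma>)) \<le> max (cmod (cis (a + b) - z)) (cmod (cis b - z))"
    by linarith
  then show ?thesis using N_sum_nonneg[OF ms(1)] unfolding eq by (simp add: a_def b_def)
qed

text \<open>The suffixes are placed on \<open>[0, T]\<close> by their total norms. Counting the
  empty suffix, of phase zero, gives one point more than there are divisors; the next two lemmas use
  it to deal with the exceptional index \<open>j\<close>.\<close>

lemma prod_suffix_divisors:
  assumes "ks \<in> lists \<Gamma>"
  shows "\<exists>j\<le>length ks. (\<Prod>i\<in>{..length ks} - {j}. cmod (cis (sum_list (map \<kappa> (drop i ks))) - z))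
    \<ge> exp (- (\<Sum>m=1..length ks. A + B * (sum_list (map N ks) / real m) powr \<sigma>))"
proof -
  have "\<exists>j\<in>{..length ks}. (\<Prod>i\<in>{..length ks} - {j}. cmod (cis (sum_list (map \<kappa> (drop i ks))) - z))
    \<ge> exp (- (\<Sum>m=1..length ks. A + B * (sum_list (map N ks) / real m) powr \<sigma>))"
  proof (rule prod_small_divisors_ge[where t = "\<lambda>i. sum_list (map N (drop i ks))"
        and \<Omega> = "\<lambda>s. A + B * s powr \<sigma>"])
    fix j assume "j \<in> {..length ks}"
    have "set (drop j ks) \<subseteq> \<Gamma>" "set (take j ks) \<subseteq> \<Gamma>"
      using assms by (auto dest: in_set_dropD in_set_takeD)
    then have "sum_list (map N (drop j ks)) \<ge> 0" "sum_list (map N (take j ks)) \<ge> 0"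
      by (auto intro: N_sum_nonneg)
    moreover have "sum_list (map N ks) = sum_list (map N (take j ks)) + sum_list (map N (drop j ks))"
      by (metis append_take_drop_id map_append sum_list_append)
    ultimately show "0 \<le> sum_list (map N (drop j ks)) \<and> sum_list (map N (drop j ks)) \<le> sum_list (map N ks)"
      by simp
  next
    fix a b :: real assume "0 \<le> a" "a \<le> b"
    then show "A + B * a powr \<sigma> \<le> A + B * b powr \<sigma>"
      using params by (auto intro!: mult_left_mono powr_mono2)
  next
    fix i j assume "i \<in> {..length ks}" "j \<in> {..length ks}" "i \<noteq> j"
    then show "exp (- (A + B * \<bar>sum_list (map N (drop i ks)) - sum_list (map N (drop j ks))\<bar> powr \<sigma>))
       \<le> max (cmod (cis (sum_list (map \<kappa> (drop i ks))) - z)) (cmod (cis (sum_list (map \<kappa> (drop j ks))) - z))"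
      using suffix_separation[OF assms, of i j z] suffix_separation[OF assms, of j i z]
      by (cases "i < j") (auto simp: max.commute abs_minus_commute)
  qed auto
  then show ?thesis by blast
qed

text \<open>For \<open>z = 1\<close> the divisor at the empty suffix vanishes, so a product with a
  positive lower bound can only be the one that omits it: the exceptional index is the empty suffix,
  and all genuine divisors are controlled.\<close>

lemma prod_suffix_divisors_1:
  assumes "ks \<in> lists \<Gamma>"
  shows "(\<Prod>i<length ks. cmod (cis (sum_list (map \<kappa> (drop i ks))) - 1))
    \<ge> exp (- (\<Sum>m=1..length ks. A + B * (sum_list (map N ks) / real m) powr \<sigma>))"
proof -
  obtain j where j: "j \<le> length ks" "(\<Prod>i\<in>{..length ks} - {j}. cmod (cis (sum_list (map \<kappa> (drop i ks))) - 1))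
    \<ge> exp (- (\<Sum>m=1..length ks. A + B * (sum_list (map N ks) / real m) powr \<sigma>))" (is "?P \<ge> _")
    using prod_suffix_divisors[OF assms] by blast
  have "?P > 0" using j(2) by (rule less_le_trans[rotated]) simp
  have "j = length ks"
  proof (rule ccontr)
    assume "j \<noteq> length ks"
    then have "?P = 0" by (intro prod_zero) (auto intro!: bexI[of _ "length ks"])
    with \<open>?P > 0\<close> show False by (metis less_irrefl)
  qed
  moreover have "{..length ks} - {length ks} = {..<length ks}" by auto
  ultimately show ?thesis using j(2) by simp
qed

lemma prod_suffix_divisors_inside:
  assumes "ks \<in> lists \<Gamma>" "cmod z < 1"
  shows "(\<Prod>i<length ks. cmod (cis (sum_list (map \<kappa> (drop i ks))) - z))
    \<ge> (1 - cmod z) / 2 * exp (- (\<Sum>m=1..length ks. A + B * (sum_list (map N ks) / real m) powr \<sigma>))"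
    (is "(\<Prod>i<_. ?\<delta> i) \<ge> _ * ?e")
proof -
  obtain j where j: "j \<le> length ks" "(\<Prod>i\<in>{..length ks} - {j}. ?\<delta> i) \<ge> ?e"
    using prod_suffix_divisors[OF assms(1)] by blast
  have lower: "?\<delta> i \<ge> 1 - cmod z" for i
    using norm_triangle_ineq2[of "cis (sum_list (map \<kappa> (drop i ks)))" z] by simp
  show ?thesis
  proof (cases "j = length ks")
    case True
    moreover have "{..length ks} - {length ks} = {..<length ks}" by auto
    ultimately have "(\<Prod>i<length ks. ?\<delta> i) \<ge> ?e" using j(2) by simp
    moreover have "(1 - cmod z) / 2 * ?e \<le> 1 * ?e"
    proof (rule mult_right_mono)
      have "- 1 \<le> cmod z" by (rule order_trans[OF _ norm_ge_zero]) simp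
      then show "(1 - cmod z) / 2 \<le> 1" by simp
    qed simp
    ultimately show ?thesis by linarith
  next
    case False
    then have j': "j < length ks" using j by simp
    have "{..length ks} - {j} = insert (length ks) ({..<length ks} - {j})" using j' by auto
    then have "(\<Prod>i\<in>{..length ks} - {j}. ?\<delta> i) = cmod (1 - z) * (\<Prod>i\<in>{..<length ks} - {j}. ?\<delta> i)"
      by simp
    also have "\<dots> \<le> 2 * (\<Prod>i\<in>{..<length ks} - {j}. ?\<delta> i)"
      using norm_triangle_ineq4[of 1 z] assms(2) by (intro mult_right_mono prod_nonneg) auto
    finally have "?e / 2 \<le> (\<Prod>i\<in>{..<length ks} - {j}. ?\<delta> i)" using j(2) by linarith
    then have "(1 - cmod z) * (?e / 2) \<le> ?\<delta> j * (\<Prod>i\<in>{..<length ks} - {j}. ?\<delta> i)"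
      using assms(2) lower by (intro mult_mono) auto
    also have "\<dots> = (\<Prod>i<length ks. ?\<delta> i)"
      using j' by (subst prod.remove[of "{..<length ks}" j]) auto
    finally show ?thesis by simp
  qed
qed

text \<open>A term of the Floquet series is indexed by the chain of frequencies of the factors of the
  potential which produce it; the partial sums of the chain are its small divisors.\<close>

primrec floquet_coeff :: "('k \<Rightarrow> complex) \<Rightarrow> complex \<Rightarrow> 'k list \<Rightarrow> complex" where
  "floquet_coeff c \<nu> [] = 1"
| "floquet_coeff c \<nu> (k # ks) =
     - c k / floquet_divisor \<nu> (\<kappa> k + sum_list (map \<kappa> ks)) * floquet_coeff c \<nu> ks"

text \<open>By construction the coefficient is the product of the \<open>c k\<close> divided by the
  divisors, up to sign. This is an inequality because \<open>x / 0 = 0\<close>, so that a vanishing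
  divisor can only decrease the left side.\<close>

lemma norm_floquet_coeff:
  "cmod (floquet_coeff c \<nu> ks) * (\<Prod>i<length ks. cmod (floquet_divisor \<nu> (sum_list (map \<kappa> (drop i ks)))))
    \<le> prod_list (map (\<lambda>k. cmod (c k)) ks)"
proof (induction ks)
  case (Cons k ks)
  let ?D = "cmod (floquet_divisor \<nu> (\<kappa> k + sum_list (map \<kappa> ks)))"
  let ?P = "\<Prod>i<length ks. cmod (floquet_divisor \<nu> (sum_list (map \<kappa> (drop i ks))))"
  have "cmod (floquet_coeff c \<nu> (k # ks)) *
      (\<Prod>i<length (k # ks). cmod (floquet_divisor \<nu> (sum_list (map \<kappa> (drop i (k # ks))))))
      = (cmod (c k) / ?D * ?D) * (cmod (floquet_coeff c \<nu> ks) * ?P)"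
    by (simp add: prod.lessThan_Suc_shift norm_mult norm_divide del: prod.lessThan_Suc)
  also have "\<dots> \<le> cmod (c k) * prod_list (map (\<lambda>k. cmod (c k)) ks)"
    by (intro mult_mono Cons) (auto intro!: mult_nonneg_nonneg prod_nonneg simp: divide_simps)
  finally show ?case by simp
qed simp

text \<open>The divisor dominates a product of two factors, with roots \<open>1\<close> and
  \<open>z\<close>. Over a chain of length \<open>n\<close> and total norm \<open>T\<close> each of
  them costs at most \<open>exp (h / 2 * T + C * n)\<close>, the second one also
  \<open>2 / (1 - cmod z)\<close>. The part \<open>h * T\<close> becomes the weights
  \<open>exp (h * N k)\<close>, the rest a constant per letter. The constant is chosen before
  \<open>\<mu>\<close> and \<open>c\<close>, whence the uniformity in the energy.\<close>

lemma floquet_coeff_bound: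
  assumes "h > 0"
  shows "\<exists>C\<ge>0. \<forall>\<mu> \<nu> c ks. cmod \<mu> > 1 \<longrightarrow> \<nu> = \<mu> \<or> \<nu> = inverse \<mu> \<longrightarrow> ks \<in> lists \<Gamma> \<longrightarrow>
    cmod (floquet_coeff c \<nu> ks) \<le> 2 / (1 - 1 / (cmod \<mu>)\<^sup>2) *
      prod_list (map (\<lambda>k. exp C * (cmod (c k) * exp (h * N k))) ks)"
proof -
  obtain C where C: "C \<ge> 0" "\<And>n T. T \<ge> 0 \<Longrightarrow> (\<Sum>m=1..n. A + B * (T / real m) powr \<sigma>) \<le> h / 2 * T + C * real n"
    using sum_divisor_exponents_le[of \<sigma> "h / 2" A B] params assms by auto
  have "cmod (floquet_coeff c \<nu> ks) \<le> 2 / (1 - 1 / (cmod \<mu>)\<^sup>2) *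
      prod_list (map (\<lambda>k. exp (2 * C) * (cmod (c k) * exp (h * N k))) ks)"
    if \<mu>: "cmod \<mu> > 1" "\<nu> = \<mu> \<or> \<nu> = inverse \<mu>" and ks: "ks \<in> lists \<Gamma>" for \<mu> \<nu> c ks
  proof -
    obtain z where z: "cmod z = 1 / (cmod \<mu>)\<^sup>2"
      "\<And>\<theta>. cmod (floquet_divisor \<nu> \<theta>) \<ge> cmod (cis \<theta> - 1) * cmod (cis \<theta> - z)"
      using norm_floquet_divisor_ge[OF \<mu>] by blast
    define T where "T = sum_list (map N ks)"
    define n where "n = length ks"
    define e where "e = exp (- (h / 2 * T + C * real n))"
    define q where "q = 1 - 1 / (cmod \<mu>)\<^sup>2"
    define P where "P = (\<Prod>i<n. cmod (floquet_divisor \<nu> (sum_list (map \<kappa> (drop i ks)))))"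
    have \<mu>2: "(cmod \<mu>)\<^sup>2 > 1" using \<mu>(1) by (simp add: one_less_power)
    then have q: "q > 0" by (simp add: q_def divide_less_eq)
    have e: "e \<le> exp (- (\<Sum>m=1..n. A + B * (T / real m) powr \<sigma>))" "e > 0"
      using C(2)[of T n] N_sum_nonneg[OF ks] by (auto simp: e_def T_def)
    have "e * (q / 2 * e) \<le> (\<Prod>i<n. cmod (cis (sum_list (map \<kappa> (drop i ks))) - 1)) *
        (\<Prod>i<n. cmod (cis (sum_list (map \<kappa> (drop i ks))) - z))"
    proof (rule mult_mono)
      show "e \<le> (\<Prod>i<n. cmod (cis (sum_list (map \<kappa> (drop i ks))) - 1))"
        using prod_suffix_divisors_1[OF ks] e(1) by (simp add: n_def T_def)
      have "q / 2 * e \<le> q / 2 * exp (- (\<Sum>m=1..n. A + B * (T / real m) powr \<sigma>))"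
        using e q by (intro mult_left_mono) auto
      also have "\<dots> \<le> (\<Prod>i<n. cmod (cis (sum_list (map \<kappa> (drop i ks))) - z))"
        using prod_suffix_divisors_inside[OF ks, of z] q
        by (simp add: n_def T_def q_def z(1))
      finally show "q / 2 * e \<le> (\<Prod>i<n. cmod (cis (sum_list (map \<kappa> (drop i ks))) - z))" .
    qed (use e q in \<open>auto intro!: prod_nonneg\<close>)
    also have "\<dots> \<le> P"
      unfolding P_def prod.distrib[symmetric] by (intro prod_mono) (use z(2) in auto)
    finally have P: "e * (q / 2 * e) \<le> P" .
    have "cmod (floquet_coeff c \<nu> ks) * (e * (q / 2 * e)) \<le> cmod (floquet_coeff c \<nu> ks) * P"
      using P by (intro mult_left_mono) auto
    also have "\<dots> \<le> prod_list (map (\<lambda>k. cmod (c k)) ks)"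
      using norm_floquet_coeff by (simp add: P_def n_def)
    finally have "cmod (floquet_coeff c \<nu> ks) \<le> 2 / q * (inverse e * inverse e * prod_list (map (\<lambda>k. cmod (c k)) ks))"
      using e q by (simp add: field_simps)
    also have "inverse e * inverse e = exp (h * T) * exp (2 * C * real n)"
      by (simp add: e_def exp_minus[symmetric] exp_add[symmetric])
    also have "exp (h * T) * exp (2 * C * real n) * prod_list (map (\<lambda>k. cmod (c k)) ks) =
        prod_list (map (\<lambda>k. exp (2 * C) * (cmod (c k) * exp (h * N k))) ks)"
      unfolding T_def n_def by (induction ks) (auto simp: exp_add algebra_simps)
    finally show ?thesis by (simp add: q_def)
  qed
  then show ?thesis using C(1) by (intro exI[of _ "2 * C"]) auto
qed

end

text \<open>A pair of solutions modelled on the free ones, \<open>\<mu> powi n\<close> and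
  \<open>\<mu> powi (- n)\<close>: the Wronskian has the free value, and the sizes differ from the
  free ones by a factor that degenerates only as \<open>cmod \<mu>\<close> tends to
  \<open>1\<close>.\<close>

definition floquet_pair ::
    "(int \<Rightarrow> complex) \<Rightarrow> complex \<Rightarrow> (int \<Rightarrow> complex) \<Rightarrow> (int \<Rightarrow> complex) \<Rightarrow> bool" where
  "floquet_pair V \<mu> u v \<longleftrightarrow>
     (\<forall>n. u (n + 1) + u (n - 1) + V n * u n = (\<mu> + inverse \<mu>) * u n) \<and>
     (\<forall>n. v (n + 1) + v (n - 1) + V n * v n = (\<mu> + inverse \<mu>) * v n) \<and>
     (\<forall>n. u (n + 1) * v n - u n * v (n + 1) = \<mu> - inverse \<mu>) \<and>
     (\<forall>n. cmod (u n) \<le> 4 / (1 - 1 / (cmod \<mu>)\<^sup>2) * cmod \<mu> powi n) \<and>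
     (\<forall>n. cmod (v n) \<le> 4 / (1 - 1 / (cmod \<mu>)\<^sup>2) * cmod \<mu> powi (- n))"

lemma wronskian_constant:
  fixes u v V :: "int \<Rightarrow> complex"
  assumes "\<And>n. u (n + 1) + u (n - 1) + V n * u n = E * u n"
    and "\<And>n. v (n + 1) + v (n - 1) + V n * v n = E * v n"
  shows "u (n + 1) * v n - u n * v (n + 1) = u 1 * v 0 - u 0 * v 1"
proof -
  have step: "u (m + 1) * v m - u m * v (m + 1) = u m * v (m - 1) - u (m - 1) * v m" for m
  proof -
    have "u (m + 1) = E * u m - V m * u m - u (m - 1)" "v (m + 1) = E * v m - V m * v m - v (m - 1)"
      using assms[of m] by (simp_all only: eq_diff_eq)
    then show ?thesis by (simp only:) (simp add: algebra_simps)
  qed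
  show ?thesis
  proof (induction n rule: int_induct[where k = 0])
    case (step1 i)
    then show ?case using step[of "i + 1"] by simp
  next
    case (step2 i)
    then show ?case using step[of i] by simp
  qed simp
qed

section \<open>Convergence, equation and Wronskian of the Floquet series\<close>

context nonresonant_frequencies
begin

text \<open>The quasiperiodic factor \<open>p\<close> of a Floquet solution, along the orbit of one
  point. The starting point is encoded in the phases of \<open>c\<close>.\<close>

definition floquet_phase :: "('k \<Rightarrow> complex) \<Rightarrow> complex \<Rightarrow> int \<Rightarrow> complex" where
  "floquet_phase c \<nu> n =
     (\<Sum>\<^sub>\<infinity>ks\<in>lists \<Gamma>. floquet_coeff c \<nu> ks * cis (of_int n * sum_list (map \<kappa> ks)))"

lemma floquet_divisor_nonzero:
  assumes "cmod \<mu> > 1" "\<nu> = \<mu> \<or> \<nu> = inverse \<mu>" "ks \<in> lists \<Gamma>" "ks \<noteq> []"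
  shows "floquet_divisor \<nu> (sum_list (map \<kappa> ks)) \<noteq> 0"
proof -
  obtain z where z: "cmod z = 1 / (cmod \<mu>)\<^sup>2"
    "\<And>\<theta>. cmod (floquet_divisor \<nu> \<theta>) \<ge> cmod (cis \<theta> - 1) * cmod (cis \<theta> - z)"
    using norm_floquet_divisor_ge[OF assms(1,2)] by blast
  have "(cmod \<mu>)\<^sup>2 > 1" using assms(1) by (simp add: one_less_power)
  then have "cmod z \<noteq> 1" by (simp add: z(1))
  then have "cis (sum_list (map \<kappa> ks)) \<noteq> z" by force
  then show ?thesis using cis_sum_ne_1[OF assms(3,4)] z(2)[of "sum_list (map \<kappa> ks)"]
    by (metis mult_pos_pos norm_zero not_le right_minus_eq zero_less_norm_iff)
qed

text \<open>The conjugated free operator multiplies the term of a chain by its divisor. For a chain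
  \<open>k # ks\<close> the recursion cancels this divisor and leaves minus the term of
  \<open>ks\<close> times a mode of the potential; splitting nonempty chains into head and tail
  therefore turns the sum into minus the product of the potential with \<open>p\<close>.\<close>

lemma floquet_phase_equation:
  assumes \<mu>: "cmod \<mu> > 1" "\<nu> = \<mu> \<or> \<nu> = inverse \<mu>"
    and a: "floquet_coeff c \<nu> abs_summable_on lists \<Gamma>" and c: "c abs_summable_on \<Gamma>"
  shows "\<nu> * floquet_phase c \<nu> (n + 1) + inverse \<nu> * floquet_phase c \<nu> (n - 1)
      + (\<Sum>\<^sub>\<infinity>k\<in>\<Gamma>. c k * cis (of_int n * \<kappa> k)) * floquet_phase c \<nu> n
      = (\<nu> + inverse \<nu>) * floquet_phase c \<nu> n"
proof -
  define K where "K ks = sum_list (map \<kappa> ks)" for ks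
  define f where "f m ks = floquet_coeff c \<nu> ks * cis (of_int m * K ks)" for m :: int and ks
  define V where "V = (\<Sum>\<^sub>\<infinity>k\<in>\<Gamma>. c k * cis (of_int n * \<kappa> k))"
  have fabs: "f m abs_summable_on lists \<Gamma>" for m
    using a by (simp add: f_def norm_mult)
  have fs: "(f m has_sum floquet_phase c \<nu> m) (lists \<Gamma>)" for m
    using abs_summable_summable[OF fabs[of m]] unfolding floquet_phase_def f_def K_def by simp
  have shift: "f (n + 1) ks = f n ks * cis (K ks)" "f (n - 1) ks = f n ks * cis (- K ks)" for ks
    by (simp_all add: f_def cis_mult algebra_simps)
  have "((\<lambda>ks. \<nu> * f (n + 1) ks + inverse \<nu> * f (n - 1) ks + - (\<nu> + inverse \<nu>) * f n ks) has_sum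
     (\<nu> * floquet_phase c \<nu> (n + 1) + inverse \<nu> * floquet_phase c \<nu> (n - 1)
      + - (\<nu> + inverse \<nu>) * floquet_phase c \<nu> n)) (lists \<Gamma>)"
    by (intro has_sum_add has_sum_cmult_right fs)
  moreover have "\<nu> * f (n + 1) ks + inverse \<nu> * f (n - 1) ks + - (\<nu> + inverse \<nu>) * f n ks
      = floquet_divisor \<nu> (K ks) * f n ks" for ks
    unfolding shift floquet_divisor_def by (simp add: algebra_simps)
  ultimately have 1: "((\<lambda>ks. floquet_divisor \<nu> (K ks) * f n ks) has_sum
     (\<nu> * floquet_phase c \<nu> (n + 1) + inverse \<nu> * floquet_phase c \<nu> (n - 1)
      + - (\<nu> + inverse \<nu>) * floquet_phase c \<nu> n)) (lists \<Gamma>)"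
    by simp
  have lists: "lists \<Gamma> = insert [] ((\<lambda>(k, ks). k # ks) ` (\<Gamma> \<times> lists \<Gamma>))" (is "_ = insert [] ?I")
  proof (intro equalityI subsetI)
    fix ks assume "ks \<in> lists \<Gamma>"
    then show "ks \<in> insert [] ?I" by (cases ks) (auto simp: image_iff)
  qed auto
  have "(\<lambda>k. c k * cis (of_int n * \<kappa> k)) abs_summable_on \<Gamma>"
    using c by (simp add: norm_mult)
  from has_sum_product(2)[OF this fabs[of n]]
  have "((\<lambda>p. - ((\<lambda>(k, ks). c k * cis (of_int n * \<kappa> k) * f n ks) p)) has_sum - (V * floquet_phase c \<nu> n)) (\<Gamma> \<times> lists \<Gamma>)"
    using infsumI[OF fs[of n]] by (intro has_sum_uminusI) (simp add: V_def)
  then have "((\<lambda>p. (\<lambda>ks. floquet_divisor \<nu> (K ks) * f n ks) ((\<lambda>(k, ks). k # ks) p)) has_sum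
      - (V * floquet_phase c \<nu> n)) (\<Gamma> \<times> lists \<Gamma>)"
  proof (rule has_sum_cong[THEN iffD1, rotated])
    fix p assume p: "p \<in> \<Gamma> \<times> lists \<Gamma>"
    obtain k ks where pk: "p = (k, ks)" by force
    have "floquet_divisor \<nu> (K (k # ks)) \<noteq> 0"
      using floquet_divisor_nonzero[OF \<mu>, of "k # ks"] p pk by (simp add: K_def)
    moreover have "cis (of_int n * \<kappa> k) * cis (of_int n * K ks) = cis (of_int n * K (k # ks))"
      by (simp add: cis_mult K_def algebra_simps)
    ultimately show "- ((\<lambda>(k, ks). c k * cis (of_int n * \<kappa> k) * f n ks) p) =
        (\<lambda>ks. floquet_divisor \<nu> (K ks) * f n ks) ((\<lambda>(k, ks). k # ks) p)"
      by (simp add: pk f_def K_def)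
  qed
  then have "((\<lambda>ks. floquet_divisor \<nu> (K ks) * f n ks) has_sum - (V * floquet_phase c \<nu> n)) ?I"
    by (subst has_sum_reindex) (auto simp: inj_on_def o_def)
  \<comment> \<open>The empty chain contributes nothing, since the divisor vanishes at phase
    zero.\<close>
  from has_sum_insert[OF _ this, of "[]"]
  have "((\<lambda>ks. floquet_divisor \<nu> (K ks) * f n ks) has_sum - (V * floquet_phase c \<nu> n)) (insert [] ?I)"
    by (force simp: K_def)
  then have 2: "((\<lambda>ks. floquet_divisor \<nu> (K ks) * f n ks) has_sum - (V * floquet_phase c \<nu> n)) (lists \<Gamma>)"
    by (subst lists)
  show ?thesis
    using has_sum_unique[OF 1 2] by (simp add: V_def algebra_simps)
qed

text \<open>The Wronskian along the orbit is an almost periodic double series over pairs of chains.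
  Being constant, it equals its mean, and the only pair of total frequency zero consists of the two
  empty chains, with coefficient \<open>\<mu> - inverse \<mu>\<close>.\<close>

lemma floquet_wronskian:
  assumes \<mu>: "cmod \<mu> > 1"
    and a: "floquet_coeff c \<mu> abs_summable_on lists \<Gamma>"
    and b: "floquet_coeff c (inverse \<mu>) abs_summable_on lists \<Gamma>"
    and W: "\<And>n. \<mu> * floquet_phase c \<mu> (n + 1) * floquet_phase c (inverse \<mu>) n
        - inverse \<mu> * floquet_phase c \<mu> n * floquet_phase c (inverse \<mu>) (n + 1) = W"
  shows "W = \<mu> - inverse \<mu>"
proof -
  define K where "K ks = sum_list (map \<kappa> ks)" for ks
  define f where "f m ks = floquet_coeff c \<mu> ks * cis (of_int m * K ks)" for m :: int and ks
  define g where "g m ks = floquet_coeff c (inverse \<mu>) ks * cis (of_int m * K ks)" for m :: int and ks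
  define G where "G = (\<lambda>(s, t). floquet_coeff c \<mu> s * floquet_coeff c (inverse \<mu>) t *
     (\<mu> * cis (K s) - inverse \<mu> * cis (K t)))"
  have fabs: "f m abs_summable_on lists \<Gamma>" "g m abs_summable_on lists \<Gamma>" for m
    using a b by (simp_all add: f_def g_def norm_mult)
  have fsum: "infsum (f m) (lists \<Gamma>) = floquet_phase c \<mu> m"
    "infsum (g m) (lists \<Gamma>) = floquet_phase c (inverse \<mu>) m" for m
    by (simp_all add: f_def[abs_def] g_def[abs_def] floquet_phase_def K_def)
  have "W = G ([], [])"
  proof (rule constant_almost_periodic[where I = "lists \<Gamma> \<times> lists \<Gamma>" and \<theta> = "\<lambda>(s, t). K s + K t"])
    have "(\<lambda>p. (cmod \<mu> + cmod (inverse \<mu>)) * cmod ((\<lambda>(s, t). floquet_coeff c \<mu> s * floquet_coeff c (inverse \<mu>) t) p))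
        summable_on lists \<Gamma> \<times> lists \<Gamma>"
      using has_sum_product(1)[OF a b] by (rule summable_on_cmult_right)
    then show "G abs_summable_on lists \<Gamma> \<times> lists \<Gamma>"
    proof (rule summable_on_comparison_test)
      fix p :: "'k list \<times> 'k list"
      obtain s t where p: "p = (s, t)" by force
      have *: "cmod (\<mu> * cis (K s) - inverse \<mu> * cis (K t)) \<le> cmod \<mu> + cmod (inverse \<mu>)"
        using norm_triangle_ineq4[of "\<mu> * cis (K s)" "inverse \<mu> * cis (K t)"] by (simp add: norm_mult)
      show "cmod (G p) \<le> (cmod \<mu> + cmod (inverse \<mu>)) *
          cmod ((\<lambda>(s, t). floquet_coeff c \<mu> s * floquet_coeff c (inverse \<mu>) t) p)"
        unfolding p G_def using mult_right_mono[OF *, of "cmod (floquet_coeff c \<mu> s) * cmod (floquet_coeff c (inverse \<mu>) t)"]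
        by (simp add: norm_mult mult.commute)
    qed auto
  next
    fix p assume p: "p \<in> lists \<Gamma> \<times> lists \<Gamma>" "p \<noteq> ([], [])"
    \<comment> \<open>The frequency of a pair of chains is that of their concatenation, so
      nonresonance applies to it.\<close>
    then have "fst p @ snd p \<in> lists \<Gamma>" "fst p @ snd p \<noteq> []" by auto
    from cis_sum_ne_1[OF this] show "cis (case p of (s, t) \<Rightarrow> K s + K t) \<noteq> 1"
      by (simp add: K_def case_prod_unfold)
  next
    fix n :: nat
    have 1: "((\<lambda>(s, t). f (int n + 1) s * g (int n) t) has_sum
        floquet_phase c \<mu> (int n + 1) * floquet_phase c (inverse \<mu>) (int n)) (lists \<Gamma> \<times> lists \<Gamma>)"
      using has_sum_product(2)[OF fabs(1)[of "int n + 1"] fabs(2)[of "int n"]] by (simp add: fsum)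
    have 2: "((\<lambda>(s, t). f (int n) s * g (int n + 1) t) has_sum
        floquet_phase c \<mu> (int n) * floquet_phase c (inverse \<mu>) (int n + 1)) (lists \<Gamma> \<times> lists \<Gamma>)"
      using has_sum_product(2)[OF fabs(1)[of "int n"] fabs(2)[of "int n + 1"]] by (simp add: fsum)
    have "((\<lambda>p. \<mu> * (\<lambda>(s, t). f (int n + 1) s * g (int n) t) p
          + - inverse \<mu> * (\<lambda>(s, t). f (int n) s * g (int n + 1) t) p) has_sum
        \<mu> * (floquet_phase c \<mu> (int n + 1) * floquet_phase c (inverse \<mu>) (int n))
        + - inverse \<mu> * (floquet_phase c \<mu> (int n) * floquet_phase c (inverse \<mu>) (int n + 1)))
        (lists \<Gamma> \<times> lists \<Gamma>)"
      by (intro has_sum_add has_sum_cmult_right 1 2)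
    moreover have "\<mu> * (\<lambda>(s, t). f (int n + 1) s * g (int n) t) p
          + - inverse \<mu> * (\<lambda>(s, t). f (int n) s * g (int n + 1) t) p
        = G p * cis (real n * (\<lambda>(s, t). K s + K t) p)" for p
    proof -
      obtain s t where p: "p = (s, t)" by force
      have fg: "f (int n + 1) s = f (int n) s * cis (K s)" "g (int n + 1) t = g (int n) t * cis (K t)"
        by (simp_all add: f_def g_def cis_mult algebra_simps)
      have cis: "cis (real n * (K s + K t)) = cis (real n * K s) * cis (real n * K t)"
        by (simp add: cis_mult algebra_simps)
      show ?thesis
        by (simp only: p case_prod_conv fg cis G_def) (simp add: f_def g_def algebra_simps)
    qed
    ultimately have "((\<lambda>p. G p * cis (real n * (\<lambda>(s, t). K s + K t) p)) has_sum W) (lists \<Gamma> \<times> lists \<Gamma>)"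
      using W[of "int n"] by (simp add: mult.assoc)
    then show "(\<Sum>\<^sub>\<infinity>p\<in>lists \<Gamma> \<times> lists \<Gamma>. G p * cis (real n * (case p of (s, t) \<Rightarrow> K s + K t))) = W"
      by (rule infsumI)
  qed (auto simp: K_def)
  then show ?thesis by (simp add: G_def K_def)
qed

text \<open>A single \<open>C\<close> serves all coefficients, potentials and \<open>\<mu>\<close>;
  smallness therefore does not depend on the energy or on the starting point.\<close>

theorem floquet_pair_exists:
  assumes "h > 0"
  shows "\<exists>C>0. \<forall>c V \<mu>. (\<lambda>k. cmod (c k) * exp (h * N k)) summable_on \<Gamma> \<longrightarrow>
     C * (\<Sum>\<^sub>\<infinity>k\<in>\<Gamma>. cmod (c k) * exp (h * N k)) \<le> 1 / 2 \<longrightarrow>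
     (\<forall>n. V n = (\<Sum>\<^sub>\<infinity>k\<in>\<Gamma>. c k * cis (of_int n * \<kappa> k))) \<longrightarrow> cmod \<mu> > 1 \<longrightarrow>
     (\<exists>u v. floquet_pair V \<mu> u v)"
proof -
  obtain C where C: "\<And>\<mu> \<nu> c ks. cmod \<mu> > 1 \<Longrightarrow> \<nu> = \<mu> \<or> \<nu> = inverse \<mu> \<Longrightarrow> ks \<in> lists \<Gamma> \<Longrightarrow>
    cmod (floquet_coeff c \<nu> ks) \<le> 2 / (1 - 1 / (cmod \<mu>)\<^sup>2) *
      prod_list (map (\<lambda>k. exp C * (cmod (c k) * exp (h * N k))) ks)"
    using floquet_coeff_bound[OF assms] by blast
  have "\<exists>u v. floquet_pair V \<mu> u v"
    if sm: "(\<lambda>k. cmod (c k) * exp (h * N k)) summable_on \<Gamma>"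
      and le: "exp C * (\<Sum>\<^sub>\<infinity>k\<in>\<Gamma>. cmod (c k) * exp (h * N k)) \<le> 1 / 2"
      and V: "\<And>n. V n = (\<Sum>\<^sub>\<infinity>k\<in>\<Gamma>. c k * cis (of_int n * \<kappa> k))" and \<mu>: "cmod \<mu> > 1" for c V \<mu>
  proof -
    define q where "q = 1 - 1 / (cmod \<mu>)\<^sup>2"
    have \<mu>2: "(cmod \<mu>)\<^sup>2 > 1" "\<mu> \<noteq> 0" using \<mu> by (auto simp: one_less_power)
    have q: "q > 0" using \<mu>2 by (simp add: q_def divide_less_eq)
    \<comment> \<open>With total at most \<open>1 / 2\<close> the geometric series over chains is at
      most \<open>2\<close>; together with the prefactor \<open>2 / q\<close> this gives the
      constant \<open>4 / q\<close> of \<open>floquet_pair\<close>.\<close>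
    define F where "F k = exp C * (cmod (c k) * exp (h * N k))" for k
    have F: "F summable_on \<Gamma>" "\<And>k. F k \<ge> 0" "infsum F \<Gamma> \<le> 1 / 2"
      using sm le by (auto simp: F_def[abs_def] summable_on_cmult_right infsum_cmult_right)
    have Fl: "(\<lambda>ks. prod_list (map F ks)) summable_on lists \<Gamma>"
      "infsum (\<lambda>ks. prod_list (map F ks)) (lists \<Gamma>) \<le> 2"
      using summable_on_lists[OF F(1) F(2) F(3)] by simp_all
    have Fl': "(\<lambda>ks. 2 / q * prod_list (map F ks)) summable_on lists \<Gamma>"
      using Fl(1) by (rule summable_on_cmult_right)
    have a: "floquet_coeff c \<nu> abs_summable_on lists \<Gamma>"
      and p: "cmod (floquet_phase c \<nu> n) \<le> 4 / q" if \<nu>: "\<nu> = \<mu> \<or> \<nu> = inverse \<mu>" for \<nu> n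
    proof -
      show *: "floquet_coeff c \<nu> abs_summable_on lists \<Gamma>"
        using Fl' by (rule summable_on_comparison_test) (use C[OF \<mu> \<nu>] in \<open>auto simp: q_def F_def[abs_def]\<close>)
      then have "cmod (floquet_phase c \<nu> n) \<le> (\<Sum>\<^sub>\<infinity>ks\<in>lists \<Gamma>. cmod (floquet_coeff c \<nu> ks))"
        unfolding floquet_phase_def
        using norm_infsum_bound[of "\<lambda>ks. floquet_coeff c \<nu> ks * cis (of_int n * sum_list (map \<kappa> ks))" "lists \<Gamma>"]
        by (simp add: norm_mult)
      also have "\<dots> \<le> (\<Sum>\<^sub>\<infinity>ks\<in>lists \<Gamma>. 2 / q * prod_list (map F ks))"
        using * Fl' by (rule infsum_mono) (use C[OF \<mu> \<nu>] in \<open>auto simp: q_def F_def[abs_def]\<close>)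
      also have "\<dots> = 2 / q * infsum (\<lambda>ks. prod_list (map F ks)) (lists \<Gamma>)"
        using Fl(1) by (intro infsum_cmult_right)
      also have "\<dots> \<le> 2 / q * 2" using Fl(2) q by (intro mult_left_mono) auto
      finally show "cmod (floquet_phase c \<nu> n) \<le> 4 / q" by simp
    qed
    have c: "c abs_summable_on \<Gamma>"
      using sm
    proof (rule summable_on_comparison_test)
      fix k assume "k \<in> \<Gamma>"
      then have "1 \<le> exp (h * N k)" using N_nonneg assms by simp
      then show "cmod (c k) \<le> cmod (c k) * exp (h * N k)"
        using mult_left_mono[of 1 "exp (h * N k)" "cmod (c k)"] by simp
    qed auto
    define sol where "sol \<nu> n = \<nu> powi n * floquet_phase c \<nu> n" for \<nu> n
    have sol: "sol \<nu> (n + 1) + sol \<nu> (n - 1) + V n * sol \<nu> n = (\<mu> + inverse \<mu>) * sol \<nu> n"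
      if \<nu>: "\<nu> = \<mu> \<or> \<nu> = inverse \<mu>" for \<nu> n
    proof -
      have \<nu>0: "\<nu> \<noteq> 0" and E: "\<nu> + inverse \<nu> = \<mu> + inverse \<mu>" using \<nu> \<mu>2 by auto
      have pw: "\<nu> powi (n + 1) = \<nu> powi n * \<nu>" "\<nu> powi (n - 1) = \<nu> powi n * inverse \<nu>"
        using \<nu>0 by (simp_all add: power_int_add power_int_diff field_simps)
      have "sol \<nu> (n + 1) + sol \<nu> (n - 1) + V n * sol \<nu> n = \<nu> powi n *
         (\<nu> * floquet_phase c \<nu> (n + 1) + inverse \<nu> * floquet_phase c \<nu> (n - 1) + V n * floquet_phase c \<nu> n)"
        unfolding sol_def pw by (simp add: algebra_simps)
      also have "\<dots> = \<nu> powi n * ((\<nu> + inverse \<nu>) * floquet_phase c \<nu> n)"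
        unfolding V floquet_phase_equation[OF \<mu> \<nu> a[OF \<nu>] c] ..
      finally show ?thesis by (simp add: sol_def E)
    qed
    define u where "u = sol \<mu>"
    define v where "v = sol (inverse \<mu>)"
    define W where "W = u 1 * v 0 - u 0 * v 1"
    have solu: "u (n + 1) + u (n - 1) + V n * u n = (\<mu> + inverse \<mu>) * u n"
      and solv: "v (n + 1) + v (n - 1) + V n * v n = (\<mu> + inverse \<mu>) * v n" for n
      using sol by (simp_all add: u_def v_def)
    have W: "u (n + 1) * v n - u n * v (n + 1) = W" for n
      unfolding W_def by (rule wronskian_constant[where V = V]) (rule solu solv)+
    have "W = \<mu> - inverse \<mu>"
    proof (rule floquet_wronskian[OF \<mu>])
      fix n
      have "inverse \<mu> powi n * \<mu> powi n = 1"
        using \<mu>2 by (simp add: power_int_inverse)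
      then have eq: "\<mu> powi (n + 1) * inverse \<mu> powi n = \<mu>" "\<mu> powi n * inverse \<mu> powi (n + 1) = inverse \<mu>"
        using \<mu>2 by (simp_all add: power_int_add field_simps)
      have "u (n + 1) * v n - u n * v (n + 1) =
         (\<mu> powi (n + 1) * inverse \<mu> powi n) * floquet_phase c \<mu> (n + 1) * floquet_phase c (inverse \<mu>) n
         - (\<mu> powi n * inverse \<mu> powi (n + 1)) * floquet_phase c \<mu> n * floquet_phase c (inverse \<mu>) (n + 1)"
        by (simp add: u_def v_def sol_def algebra_simps)
      then show "\<mu> * floquet_phase c \<mu> (n + 1) * floquet_phase c (inverse \<mu>) n
        - inverse \<mu> * floquet_phase c \<mu> n * floquet_phase c (inverse \<mu>) (n + 1) = W"
        using W[of n] by (simp only: eq)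
    qed (auto intro: a)
    moreover have "cmod (u n) \<le> 4 / q * cmod \<mu> powi n" for n
      using mult_right_mono[OF p[of \<mu> n], of "cmod \<mu> powi n"]
      by (simp add: u_def sol_def norm_mult norm_power_int mult.commute)
    moreover have "cmod (v n) \<le> 4 / q * cmod \<mu> powi (- n)" for n
      using mult_right_mono[OF p[of "inverse \<mu>" n], of "cmod \<mu> powi (- n)"]
      by (simp add: v_def sol_def norm_mult norm_power_int norm_inverse power_int_inverse
          power_int_minus mult.commute)
    ultimately show ?thesis
      unfolding floquet_pair_def using solu solv W by (auto simp: q_def)
  qed
  then show ?thesis by (intro exI[of _ "exp C"]) auto
qed

end


section \<open>Arithmetic of the cone\<close>

lemma bracket_ge_1: "bracket j \<ge> 1"
  by (simp add: bracket_def)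

lemma bracket_powr_ge_1: "a \<ge> 0 \<Longrightarrow> bracket j powr a \<ge> 1"
  by (simp add: bracket_ge_1 ge_one_powr_ge_zero)

definition lattice_support :: "enat \<Rightarrow> (nat \<Rightarrow> int) \<Rightarrow> nat set" where
  "lattice_support d k = {j \<in> coords d. k j \<noteq> 0}"

text \<open>Every coordinate in the support contributes at least \<open>1\<close> to a convergent
  sum.\<close>

lemma finite_lattice_support:
  assumes "k \<in> lattice_fin d \<eta>" "\<eta> > 0"
  shows "finite (lattice_support d k)"
proof -
  let ?f = "\<lambda>j. bracket j powr \<eta> * \<bar>of_int (k j)\<bar> :: real"
  have sm: "?f summable_on coords d" using assms(1) by (simp add: lattice_fin_def)
  have "card G \<le> nat \<lceil>infsum ?f (coords d)\<rceil>" if G: "G \<subseteq> lattice_support d k" "finite G" for G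
  proof -
    have "real (card G) = (\<Sum>j\<in>G. 1)" by simp
    also have "\<dots> \<le> (\<Sum>j\<in>G. ?f j)"
    proof (rule sum_mono)
      fix j assume "j \<in> G"
      then have "\<bar>of_int (k j)\<bar> \<ge> (1 :: real)" using G by (auto simp: lattice_support_def)
      then show "1 \<le> ?f j"
        using mult_mono[of 1 "bracket j powr \<eta>" 1 "\<bar>of_int (k j)\<bar>"] bracket_powr_ge_1[of \<eta> j] assms(2) by simp
    qed
    also have "\<dots> \<le> infsum ?f (coords d)"
      using sm G by (intro finite_sum_le_infsum) (auto simp: lattice_support_def)
    finally show ?thesis by linarith
  qed
  then show ?thesis using finite_if_finite_subsets_card_bdd by blast
qed

lemma summable_on_coords:
  fixes f :: "nat \<Rightarrow> 'a::{topological_comm_monoid_add, t2_space}"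
  assumes "k \<in> lattice_fin d \<eta>" "\<eta> > 0" "\<And>j. k j = 0 \<Longrightarrow> f j = 0"
  shows "f summable_on coords d"
  using finite_subset[OF _ finite_lattice_support[OF assms(1,2)], of "{x \<in> coords d. f x \<noteq> 0}"] assms(3)
  by (intro finite_nonzero_values_imp_summable_on) (auto simp: lattice_support_def)

lemma infsum_coords:
  fixes f :: "nat \<Rightarrow> 'a::{topological_comm_monoid_add, t2_space}"
  assumes "k \<in> lattice_fin d \<eta>" "\<eta> > 0" "\<And>j. k j = 0 \<Longrightarrow> f j = 0"
  shows "infsum f (coords d) = (\<Sum>j\<in>lattice_support d k. f j)"
proof -
  have "infsum f (coords d) = infsum f (lattice_support d k)"
    using assms(3) by (intro infsum_cong_neutral) (auto simp: lattice_support_def)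
  then show ?thesis using finite_lattice_support[OF assms(1,2)] by simp
qed

lemma eta_norm_nonneg: "eta_norm d \<eta> k \<ge> 0"
  unfolding eta_norm_def by (intro infsum_nonneg) auto

definition lattice_sum :: "(nat \<Rightarrow> int) list \<Rightarrow> nat \<Rightarrow> int" where
  "lattice_sum ks j = sum_list (map (\<lambda>k. k j) ks)"

text \<open>The linear functional that cuts out the cone. It is additive, whereas the norm is only
  subadditive.\<close>

definition cone_height :: "enat \<Rightarrow> real \<Rightarrow> (nat \<Rightarrow> real) \<Rightarrow> (nat \<Rightarrow> int) \<Rightarrow> real" where
  "cone_height d \<eta> w k = (\<Sum>\<^sub>\<infinity>j\<in>coords d. bracket j powr \<eta> * of_int (k j) * w j)"

lemma lattice_add:
  fixes x :: "nat \<Rightarrow> real"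
  assumes k: "k \<in> lattice_fin d \<eta>" and l: "l \<in> lattice_fin d \<eta>" and \<eta>: "\<eta> > 0"
  defines "m \<equiv> \<lambda>j. k j + l j"
  shows "m \<in> lattice_fin d \<eta>" and "eta_norm d \<eta> m \<le> eta_norm d \<eta> k + eta_norm d \<eta> l"
    and "pairing d m x = pairing d k x + pairing d l x"
    and "cone_height d \<eta> w m = cone_height d \<eta> w k + cone_height d \<eta> w l"
proof -
  have ks: "f summable_on coords d" if "\<And>j. k j = 0 \<Longrightarrow> f j = 0" for f :: "nat \<Rightarrow> real"
    using summable_on_coords[OF k \<eta>] that by blast
  have ls: "f summable_on coords d" if "\<And>j. l j = 0 \<Longrightarrow> f j = 0" for f :: "nat \<Rightarrow> real"
    using summable_on_coords[OF l \<eta>] that by blast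
  have ms: "f summable_on coords d" if "\<And>j. k j = 0 \<Longrightarrow> l j = 0 \<Longrightarrow> f j = 0" for f :: "nat \<Rightarrow> real"
  proof -
    have "finite (lattice_support d k \<union> lattice_support d l)"
      using finite_lattice_support k l \<eta> by auto
    then show ?thesis
      by (intro finite_nonzero_values_imp_summable_on, elim finite_subset[rotated])
        (use that in \<open>auto simp: lattice_support_def\<close>)
  qed
  show "m \<in> lattice_fin d \<eta>"
    using k l by (auto simp: lattice_fin_def m_def intro!: ms)
  have "eta_norm d \<eta> m \<le> (\<Sum>\<^sub>\<infinity>j\<in>coords d. bracket j powr \<eta> * \<bar>of_int (k j)\<bar> + bracket j powr \<eta> * \<bar>of_int (l j)\<bar>)"
    unfolding eta_norm_def m_def
    by (intro infsum_mono ms) (auto simp: distrib_left[symmetric] intro!: mult_left_mono)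
  also have "\<dots> = eta_norm d \<eta> k + eta_norm d \<eta> l"
    unfolding eta_norm_def by (intro infsum_add ks ls) auto
  finally show "eta_norm d \<eta> m \<le> eta_norm d \<eta> k + eta_norm d \<eta> l" .
  have "pairing d m x = (\<Sum>\<^sub>\<infinity>j\<in>coords d. of_int (k j) * x j + of_int (l j) * x j)"
    unfolding pairing_def m_def by (simp add: distrib_right)
  also have "\<dots> = pairing d k x + pairing d l x"
    unfolding pairing_def by (intro infsum_add ks ls) auto
  finally show "pairing d m x = pairing d k x + pairing d l x" .
  have "cone_height d \<eta> w m = (\<Sum>\<^sub>\<infinity>j\<in>coords d. bracket j powr \<eta> * of_int (k j) * w j + bracket j powr \<eta> * of_int (l j) * w j)"
    unfolding cone_height_def m_def by (simp add: algebra_simps)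
  also have "\<dots> = cone_height d \<eta> w k + cone_height d \<eta> w l"
    unfolding cone_height_def by (intro infsum_add ks ls) auto
  finally show "cone_height d \<eta> w m = cone_height d \<eta> w k + cone_height d \<eta> w l" .
qed

lemma lattice_sum_cone:
  fixes x :: "nat \<Rightarrow> real"
  assumes "ks \<in> lists (spectral_cone d \<eta> w r)" "\<eta> > 0"
  shows "lattice_sum ks \<in> lattice_fin d \<eta>"
    and "eta_norm d \<eta> (lattice_sum ks) \<le> sum_list (map (eta_norm d \<eta>) ks)"
    and "pairing d (lattice_sum ks) x = sum_list (map (\<lambda>k. pairing d k x) ks)"
    and "cone_height d \<eta> w (lattice_sum ks) \<ge> r * sum_list (map (eta_norm d \<eta>) ks)"
proof -
  have "lattice_sum ks \<in> lattice_fin d \<eta> \<and>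
    eta_norm d \<eta> (lattice_sum ks) \<le> sum_list (map (eta_norm d \<eta>) ks) \<and>
    pairing d (lattice_sum ks) x = sum_list (map (\<lambda>k. pairing d k x) ks) \<and>
    cone_height d \<eta> w (lattice_sum ks) \<ge> r * sum_list (map (eta_norm d \<eta>) ks)"
    using assms(1)
  proof (induction ks)
    case Nil
    then show ?case
      by (simp add: lattice_sum_def[abs_def] lattice_fin_def eta_norm_def pairing_def cone_height_def)
  next
    case (Cons k ks)
    have k: "k \<in> lattice_fin d \<eta>" "cone_height d \<eta> w k \<ge> r * eta_norm d \<eta> k"
      using Cons.hyps by (auto simp: spectral_cone_def lattice_star_def cone_height_def)
    have eq: "lattice_sum (k # ks) = (\<lambda>j. k j + lattice_sum ks j)"
      by (simp add: lattice_sum_def fun_eq_iff)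
    have IH: "lattice_sum ks \<in> lattice_fin d \<eta>" using Cons.IH by blast
    show ?case
      unfolding eq using lattice_add[OF k(1) IH assms(2)] Cons.IH k(2)
      by (simp add: distrib_left)
  qed
  then show "lattice_sum ks \<in> lattice_fin d \<eta>"
    and "eta_norm d \<eta> (lattice_sum ks) \<le> sum_list (map (eta_norm d \<eta>) ks)"
    and "pairing d (lattice_sum ks) x = sum_list (map (\<lambda>k. pairing d k x) ks)"
    and "cone_height d \<eta> w (lattice_sum ks) \<ge> r * sum_list (map (eta_norm d \<eta>) ks)"
    by auto
qed

text \<open>This is where the cone enters: the height of a sum is at least \<open>r\<close> times
  the sum of the norms, hence positive, so the frequencies of a chain cannot cancel.\<close>

lemma lattice_sum_cone_star:
  assumes "ks \<in> lists (spectral_cone d \<eta> w r)" "\<eta> > 0" "r > 0" "ks \<noteq> []"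
  shows "lattice_sum ks \<in> lattice_star d \<eta>"
proof -
  obtain k ls where ks: "ks = k # ls" using assms(4) by (cases ks) auto
  have "eta_norm d \<eta> k > 0" using assms(1) by (auto simp: ks spectral_cone_def lattice_star_def)
  moreover have "sum_list (map (eta_norm d \<eta>) ls) \<ge> 0"
    by (intro sum_list_nonneg) (auto simp: eta_norm_nonneg)
  ultimately have "r * sum_list (map (eta_norm d \<eta>) ks) > 0" using assms(3) by (simp add: ks)
  then have ch: "cone_height d \<eta> w (lattice_sum ks) > 0"
    using lattice_sum_cone(4)[OF assms(1,2)] by linarith
  have fin: "lattice_sum ks \<in> lattice_fin d \<eta>" using lattice_sum_cone(1)[OF assms(1,2)] .
  have "lattice_support d (lattice_sum ks) \<noteq> {}"
  proof
    assume "lattice_support d (lattice_sum ks) = {}"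
    then have "cone_height d \<eta> w (lattice_sum ks) = 0"
      unfolding cone_height_def by (subst infsum_coords[OF fin assms(2)]) auto
    then show False using ch by simp
  qed
  then obtain j where j: "j \<in> lattice_support d (lattice_sum ks)" by blast
  have "0 < bracket j powr \<eta> * \<bar>of_int (lattice_sum ks j)\<bar>"
    using j bracket_ge_1[of j] by (simp add: lattice_support_def)
  also have "\<dots> \<le> (\<Sum>j\<in>lattice_support d (lattice_sum ks). bracket j powr \<eta> * \<bar>of_int (lattice_sum ks j)\<bar>)"
    using j finite_lattice_support[OF fin assms(2)]
    by (intro member_le_sum[of j _ "\<lambda>j. bracket j powr \<eta> * \<bar>of_int (lattice_sum ks j)\<bar>"]) auto
  also have "\<dots> = eta_norm d \<eta> (lattice_sum ks)"
    unfolding eta_norm_def by (subst infsum_coords[OF fin assms(2)]) auto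
  finally show ?thesis using fin by (simp add: lattice_star_def)
qed

section \<open>From the Diophantine condition to lower bounds on phase factors\<close>

lemma sin_ge_linear:
  assumes "0 \<le> x" "x \<le> pi / 2"
  shows "sin x \<ge> 2 / pi * x"
proof -
  \<comment> \<open>Jordan's inequality: a concave function lies above its chord.\<close>
  have "concave_on {0..pi / 2} sin"
    by (rule f''_le0_imp_concave[where f' = cos and f'' = "\<lambda>x. - sin x"])
      (auto intro!: derivative_eq_intros sin_ge_zero)
  from concave_onD_Icc'[OF this, of x] show ?thesis using assms by simp
qed

text \<open>After subtracting the nearest multiple of \<open>2 * pi\<close> the chord has length
  \<open>2 * \<bar>sin (\<phi> / 2)\<bar>\<close>, to which Jordan's inequality applies.\<close>

lemma norm_cis_minus_1_ge:
  assumes "\<And>n::int. \<bar>\<theta> - 2 * pi * of_int n\<bar> \<ge> \<delta>"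
  shows "cmod (cis \<theta> - 1) \<ge> 2 / pi * \<delta>"
proof -
  define n where "n = round (\<theta> / (2 * pi))"
  define \<phi> where "\<phi> = \<theta> - 2 * pi * of_int n"
  have "\<bar>of_int n - \<theta> / (2 * pi)\<bar> \<le> 1 / 2" unfolding n_def by (rule of_int_round_abs_le)
  then have "\<bar>of_int n - \<theta> / (2 * pi)\<bar> * (2 * pi) \<le> 1 / 2 * (2 * pi)" by (intro mult_right_mono) auto
  moreover have "\<bar>of_int n - \<theta> / (2 * pi)\<bar> * (2 * pi) = \<bar>\<phi>\<bar>"
    by (simp add: \<phi>_def abs_mult_pos[symmetric] field_simps abs_minus_commute)
  ultimately have \<phi>: "\<bar>\<phi>\<bar> \<le> pi" by simp
  have "cis \<theta> = cis \<phi> * cis (2 * pi * of_int n)"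
    unfolding \<phi>_def cis_mult by simp
  then have "cis \<theta> = cis \<phi>" by (simp add: cis_multiple_2pi)
  then have "cmod (cis \<theta> - 1) = 2 * \<bar>sin (\<phi> / 2)\<bar>"
    using dist_exp_i_1[of \<phi>] by (simp add: cis_conv_exp)
  also have "\<bar>sin (\<phi> / 2)\<bar> = sin (\<bar>\<phi>\<bar> / 2)"
    using \<phi> sin_ge_zero[of "\<bar>\<phi>\<bar> / 2"] by (auto simp: abs_if split: if_splits)
  also have "2 * sin (\<bar>\<phi>\<bar> / 2) \<ge> 2 * (2 / pi * (\<bar>\<phi>\<bar> / 2))"
    using \<phi> by (intro mult_left_mono sin_ge_linear) auto
  finally have "cmod (cis \<theta> - 1) \<ge> 2 / pi * \<bar>\<phi>\<bar>" by simp
  moreover have "2 / pi * \<bar>\<phi>\<bar> \<ge> 2 / pi * \<delta>"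
    using assms[of n] by (intro mult_left_mono) (auto simp: \<phi>_def)
  ultimately show ?thesis by linarith
qed

text \<open>Half of \<open>S\<close> lies beyond half its cardinality. Applied to the support of \<open>k\<close>, this makes the
  logarithm of the Diophantine denominator sublinear in \<open>\<bar>k\<bar>\<^sub>\<eta>\<close> in infinite dimension too.\<close>

lemma card_le_of_sum_powr:
  fixes S :: "nat set"
  assumes "finite S" "0 \<notin> S" "\<eta> > 0" "(\<Sum>j\<in>S. real j powr \<eta>) \<le> s"
  shows "real (card S) \<le> 2 * s powr (1 / (1 + \<eta>))"
proof (cases "S = {}")
  case False
  define x where "x = real (card S) / 2"
  have x: "x > 0" using False assms(1) by (simp add: x_def card_gt_0_iff)
  define S' where "S' = {j \<in> S. real j \<ge> x}"
  have "card S - card S' = card (S - S')" using assms(1) by (subst card_Diff_subset) (auto simp: S'_def)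
  also have "\<dots> \<le> card {1..nat \<lfloor>x\<rfloor>}"
  proof (rule card_mono)
    show "S - S' \<subseteq> {1..nat \<lfloor>x\<rfloor>}"
    proof
      fix j assume j: "j \<in> S - S'"
      then have "real j < x" "j \<noteq> 0" using assms(2) by (auto simp: S'_def intro!: Nat.gr0I)
      then show "j \<in> {1..nat \<lfloor>x\<rfloor>}" by (auto simp: le_nat_floor)
    qed
  qed simp
  also have "\<dots> = nat \<lfloor>x\<rfloor>" by simp
  finally have "real (card S) - real (card S') \<le> x" using x by linarith
  then have "real (card S') \<ge> x" by (simp add: x_def)
  then have "x * x powr \<eta> \<le> real (card S') * x powr \<eta>" by (intro mult_right_mono) auto
  also have "\<dots> = (\<Sum>j\<in>S'. x powr \<eta>)" by simp
  also have "\<dots> \<le> (\<Sum>j\<in>S'. real j powr \<eta>)"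
    using x assms(3) by (intro sum_mono powr_mono2) (auto simp: S'_def)
  also have "\<dots> \<le> (\<Sum>j\<in>S. real j powr \<eta>)" using assms(1) by (intro sum_mono2) (auto simp: S'_def)
  also have "\<dots> \<le> s" by fact
  finally have "x powr (1 + \<eta>) \<le> s" using x by (simp add: powr_add)
  then have "(x powr (1 + \<eta>)) powr (1 / (1 + \<eta>)) \<le> s powr (1 / (1 + \<eta>))"
    using assms(3) by (intro powr_mono2) auto
  then show ?thesis using x assms(3) by (simp add: powr_powr x_def)
qed simp

text \<open>The number of factors is sublinear in \<open>s\<close> by
  \<open>card_le_of_sum_powr\<close>, and each factor is polynomial in \<open>s\<close>. The
  exponent \<open>q\<close> satisfies \<open>q \<ge> 1\<close> and
  \<open>\<eta> * q \<ge> 1\<close>, so that both the index and the entry are dominated by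
  \<open>q\<close>-th powers of the quantities occurring in the norm.\<close>

lemma diophantine_denominator_le:
  assumes "k \<in> lattice_star d \<eta>" "\<eta> > 0" "\<tau> > 0"
  defines "s \<equiv> eta_norm d \<eta> k"
  defines "q \<equiv> max 1 (1 / \<eta>)"
  shows "s \<ge> 1" and "(\<Prod>j\<in>lattice_support d k. 1 + bracket j powr \<tau> * \<bar>of_int (k j)\<bar> powr \<tau>)
     \<le> exp (2 * s powr (1 / (1 + \<eta>)) * (ln 2 + \<tau> * q * ln s))"
proof -
  let ?S = "lattice_support d k"
  have fin: "k \<in> lattice_fin d \<eta>" "s > 0" using assms by (auto simp: lattice_star_def)
  have S: "finite ?S" using finite_lattice_support fin assms by blast
  have s: "s = (\<Sum>j\<in>?S. bracket j powr \<eta> * \<bar>of_int (k j)\<bar>)"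
    unfolding s_def eta_norm_def by (rule infsum_coords[OF fin(1) assms(2)]) simp
  have S1: "j \<ge> 1" "bracket j = real j" "\<bar>of_int (k j)\<bar> \<ge> (1::real)" if "j \<in> ?S" for j
    using that by (auto simp: lattice_support_def coords_def bracket_def)
  have term_le: "bracket j powr \<eta> * \<bar>of_int (k j)\<bar> \<le> s" if "j \<in> ?S" for j
    unfolding s using S that by (intro member_le_sum[of j _ "\<lambda>j. bracket j powr \<eta> * \<bar>of_int (k j)\<bar>"]) auto
  have "?S \<noteq> {}" using fin(2) s by auto
  then obtain j0 where j0: "j0 \<in> ?S" by blast
  have "1 * 1 \<le> bracket j0 powr \<eta> * \<bar>of_int (k j0)\<bar>"
    using S1(3)[OF j0] bracket_powr_ge_1[of \<eta> j0] assms(2) by (intro mult_mono) auto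
  then show s1: "s \<ge> 1" using term_le[OF j0] by linarith
  have "(\<Sum>j\<in>?S. real j powr \<eta>) \<le> s"
    unfolding s
  proof (rule sum_mono)
    fix j assume j: "j \<in> ?S"
    show "real j powr \<eta> \<le> bracket j powr \<eta> * \<bar>of_int (k j)\<bar>"
      using S1[OF j] mult_left_mono[of 1 "\<bar>of_int (k j)\<bar>" "real j powr \<eta>"] by simp
  qed
  moreover have "0 \<notin> ?S" by (auto simp: lattice_support_def coords_def)
  ultimately have card: "real (card ?S) \<le> 2 * s powr (1 / (1 + \<eta>))"
    using card_le_of_sum_powr[OF S] assms(2) by blast
  have q: "q \<ge> 1" "\<eta> * q \<ge> 1" using assms(2) by (auto simp: q_def max_def field_simps)
  have fac: "1 + bracket j powr \<tau> * \<bar>of_int (k j)\<bar> powr \<tau> \<le> exp (ln 2 + \<tau> * q * ln s)" if j: "j \<in> ?S" for j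
  proof -
    let ?a = "\<bar>of_int (k j)\<bar> :: real"
    have "bracket j \<le> bracket j powr (\<eta> * q)"
      using powr_mono[of 1 "\<eta> * q" "bracket j"] q bracket_ge_1[of j] by simp
    moreover have "?a \<le> ?a powr q" using powr_mono[of 1 q ?a] q S1(3)[OF j] by simp
    ultimately have "bracket j * ?a \<le> bracket j powr (\<eta> * q) * ?a powr q"
      using bracket_ge_1[of j] by (intro mult_mono) auto
    also have "\<dots> = (bracket j powr \<eta> * ?a) powr q" by (simp add: powr_mult powr_powr)
    also have "\<dots> \<le> s powr q" using term_le[OF j] q by (intro powr_mono2) auto
    finally have "(bracket j * ?a) powr \<tau> \<le> (s powr q) powr \<tau>"
      using bracket_ge_1[of j] assms(3) by (intro powr_mono2) auto
    then have "bracket j powr \<tau> * ?a powr \<tau> \<le> s powr (q * \<tau>)"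
      using bracket_ge_1[of j] by (simp add: powr_mult powr_powr)
    moreover have "s powr (q * \<tau>) \<ge> 1" using s1 q assms(3) by (intro ge_one_powr_ge_zero) auto
    ultimately have "1 + bracket j powr \<tau> * ?a powr \<tau> \<le> 2 * s powr (q * \<tau>)" by linarith
    also have "\<dots> = exp (ln 2 + \<tau> * q * ln s)"
      using s1 by (simp add: exp_add powr_def algebra_simps)
    finally show ?thesis .
  qed
  have "(\<Prod>j\<in>?S. 1 + bracket j powr \<tau> * \<bar>of_int (k j)\<bar> powr \<tau>) \<le> (\<Prod>j\<in>?S. exp (ln 2 + \<tau> * q * ln s))"
    by (intro prod_mono) (use fac in \<open>auto intro!: add_nonneg_nonneg\<close>)
  also have "\<dots> = exp (real (card ?S) * (ln 2 + \<tau> * q * ln s))" by (simp add: exp_of_nat_mult)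
  also have "\<dots> \<le> exp (2 * s powr (1 / (1 + \<eta>)) * (ln 2 + \<tau> * q * ln s))"
    using card s1 q assms(3) by (auto intro!: mult_right_mono add_nonneg_nonneg)
  finally show "(\<Prod>j\<in>?S. 1 + bracket j powr \<tau> * \<bar>of_int (k j)\<bar> powr \<tau>)
     \<le> exp (2 * s powr (1 / (1 + \<eta>)) * (ln 2 + \<tau> * q * ln s))" .
qed

lemma DC_norm_cis_ge:
  assumes "\<alpha> \<in> DC d \<eta> \<tau>" "\<eta> > 0" "\<tau> > 0"
  shows "\<exists>A\<ge>0. \<exists>B\<ge>0. \<exists>\<sigma>. 0 < \<sigma> \<and> \<sigma> < 1 \<and> (\<forall>k\<in>lattice_star d \<eta>.
    cmod (cis (pairing d k \<alpha>) - 1) \<ge> 2 * exp (- (A + B * eta_norm d \<eta> k powr \<sigma>)))"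
proof -
  obtain \<gamma> where \<gamma>: "0 < \<gamma>" "\<gamma> < 1" "\<alpha> \<in> DC_const d \<eta> \<gamma> \<tau>" using assms(1) by (auto simp: DC_def)
  define \<rho> where "\<rho> = 1 / (1 + \<eta>)"
  \<comment> \<open>Any exponent strictly between \<open>\<rho>\<close> and \<open>1\<close> would
    do; the gap \<open>\<sigma> - \<rho>\<close> absorbs the logarithm of \<open>s\<close>.\<close>
  define \<sigma> where "\<sigma> = (1 + \<rho>) / 2"
  define q where "q = max 1 (1 / \<eta>)"
  define B where "B = 2 * (ln 2 + \<tau> * q / (\<sigma> - \<rho>))"
  \<comment> \<open>Chosen so that \<open>exp (- A)\<close> is \<open>\<gamma> / pi\<close>, which
    turns Jordan's \<open>2 / pi * \<gamma>\<close> into \<open>2 * exp (- A)\<close>.\<close>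
  define A where "A = ln (pi / \<gamma>)"
  have \<rho>: "0 < \<rho>" "\<rho> < 1" using assms(2) by (auto simp: \<rho>_def)
  have \<sigma>: "0 < \<sigma>" "\<sigma> < 1" "\<sigma> > \<rho>" using \<rho> by (auto simp: \<sigma>_def)
  have q: "q \<ge> 1" by (simp add: q_def)
  have B: "B \<ge> 0" using \<sigma> q assms(3) by (simp add: B_def)
  have A: "A \<ge> 0" using \<gamma> pi_gt3 by (simp add: A_def)
  have "cmod (cis (pairing d k \<alpha>) - 1) \<ge> 2 * exp (- (A + B * eta_norm d \<eta> k powr \<sigma>))"
    if k: "k \<in> lattice_star d \<eta>" for k
  proof -
    define s where "s = eta_norm d \<eta> k"
    define P where "P = (\<Prod>j\<in>lattice_support d k. 1 + bracket j powr \<tau> * \<bar>of_int (k j)\<bar> powr \<tau>)"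
    have s1: "s \<ge> 1" and P: "P \<le> exp (2 * s powr \<rho> * (ln 2 + \<tau> * q * ln s))"
      using diophantine_denominator_le[OF k assms(2,3)] by (simp_all add: s_def P_def \<rho>_def q_def)
    have P0: "P > 0" unfolding P_def by (intro prod_pos) (auto intro!: add_pos_nonneg)
    have "s powr \<rho> * ln s \<le> s powr \<rho> * (s powr (\<sigma> - \<rho>) / (\<sigma> - \<rho>))"
      using s1 \<sigma> by (intro mult_left_mono ln_powr_bound) auto
    also have "\<dots> = s powr \<sigma> / (\<sigma> - \<rho>)" using s1 by (simp add: powr_add[symmetric])
    finally have 1: "\<tau> * q * (s powr \<rho> * ln s) \<le> \<tau> * q * (s powr \<sigma> / (\<sigma> - \<rho>))"
      using q assms(3) by (intro mult_left_mono) auto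
    have 2: "s powr \<rho> * ln 2 \<le> s powr \<sigma> * ln 2"
      using s1 \<sigma> by (intro mult_right_mono powr_mono) auto
    have "2 * s powr \<rho> * (ln 2 + \<tau> * q * ln s) = 2 * (s powr \<rho> * ln 2 + \<tau> * q * (s powr \<rho> * ln s))"
      by (simp add: algebra_simps)
    also have "\<dots> \<le> 2 * (s powr \<sigma> * ln 2 + \<tau> * q * (s powr \<sigma> / (\<sigma> - \<rho>)))"
      by (rule mult_left_mono[OF add_mono[OF 2 1]]) simp
    also have "\<dots> = B * s powr \<sigma>" by (simp add: B_def algebra_simps)
    finally have "P \<le> exp (B * s powr \<sigma>)" using P by (meson exp_le_cancel_iff order_trans)
    then have Pinv: "exp (- (B * s powr \<sigma>)) \<le> 1 / P"
      using P0 by (simp add: exp_minus inverse_eq_divide frac_le)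
    have inf: "(INF n::int. \<bar>pairing d k \<alpha> - 2 * pi * of_int n\<bar>) \<ge> \<gamma> * (1 / P)"
      using \<gamma>(3) k by (auto simp: DC_const_def P_def lattice_support_def prod_dividef)
    have "\<bar>pairing d k \<alpha> - 2 * pi * of_int n\<bar> \<ge> \<gamma> * (1 / P)" for n :: int
      using inf by (rule order_trans) (rule cINF_lower, auto intro!: bdd_belowI[of _ 0])
    then have "cmod (cis (pairing d k \<alpha>) - 1) \<ge> 2 / pi * (\<gamma> * (1 / P))"
      by (rule norm_cis_minus_1_ge)
    moreover have "2 / pi * (\<gamma> * (1 / P)) \<ge> 2 / pi * (\<gamma> * exp (- (B * s powr \<sigma>)))"
      using \<gamma> Pinv by (intro mult_left_mono) auto
    moreover have "2 / pi * (\<gamma> * exp (- (B * s powr \<sigma>))) = 2 * exp (- (A + B * s powr \<sigma>))"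
      using \<gamma> by (simp add: A_def exp_add exp_minus exp_diff field_simps)
    ultimately show ?thesis by (simp add: s_def)
  qed
  then show ?thesis using A B \<sigma> by blast
qed

lemma cone_nonresonant:
  assumes "\<alpha> \<in> DC d \<eta> \<tau>" "\<eta> > 0" "\<tau> > 0" "r > 0"
  shows "\<exists>A B \<sigma>. nonresonant_frequencies (spectral_cone d \<eta> w r) (\<lambda>k. pairing d k \<alpha>) (eta_norm d \<eta>) A B \<sigma>"
proof -
  obtain A B \<sigma> where AB: "A \<ge> 0" "B \<ge> 0" "0 < \<sigma>" "\<sigma> < 1"
    and dc: "\<And>k. k \<in> lattice_star d \<eta> \<Longrightarrow> cmod (cis (pairing d k \<alpha>) - 1) \<ge> 2 * exp (- (A + B * eta_norm d \<eta> k powr \<sigma>))"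
    using DC_norm_cis_ge[OF assms(1-3)] by blast
  have "nonresonant_frequencies (spectral_cone d \<eta> w r) (\<lambda>k. pairing d k \<alpha>) (eta_norm d \<eta>) A B \<sigma>"
  proof
    fix ks assume ks: "ks \<in> lists (spectral_cone d \<eta> w r)" "ks \<noteq> []"
    \<comment> \<open>By subadditivity, replacing the norm of the sum by the sum of the norms only
      weakens the bound.\<close>
    have "2 * exp (- (A + B * sum_list (map (eta_norm d \<eta>) ks) powr \<sigma>))
        \<le> 2 * exp (- (A + B * eta_norm d \<eta> (lattice_sum ks) powr \<sigma>))"
      using lattice_sum_cone(2)[OF ks(1) assms(2)] AB eta_norm_nonneg
      by (auto intro!: mult_left_mono powr_mono2)
    also have "\<dots> \<le> cmod (cis (pairing d (lattice_sum ks) \<alpha>) - 1)"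
      by (intro dc lattice_sum_cone_star[OF ks(1) assms(2,4) ks(2)])
    finally show "cmod (cis (sum_list (map (\<lambda>k. pairing d k \<alpha>) ks)) - 1)
        \<ge> 2 * exp (- (A + B * sum_list (map (eta_norm d \<eta>) ks) powr \<sigma>))"
      using lattice_sum_cone(3)[OF ks(1) assms(2)] by simp
  qed (use AB eta_norm_nonneg in auto)
  then show ?thesis by blast
qed


section \<open>Transfer matrices\<close>

lemma norm_vec2_le: "norm (u :: complex^2) \<le> cmod (u $ 1) + cmod (u $ 2)"
  unfolding norm_vec_def using L2_set_le_sum[of UNIV "\<lambda>i. cmod (u $ i)"] by (simp add: sum_2)

lemma norm_vec2_power2: "(norm (u :: complex^2))\<^sup>2 = (cmod (u $ 1))\<^sup>2 + (cmod (u $ 2))\<^sup>2"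
  unfolding norm_vec_def L2_set_def by (simp add: sum_2)

lemma matrix_vector_2:
  fixes A :: "complex^2^2"
  shows "(A *v u) $ i = A $ i $ 1 * u $ 1 + A $ i $ 2 * u $ 2"
  by (simp add: matrix_vector_mult_def sum_2)

lemma onorm_matrix2_le:
  fixes A :: "complex^2^2"
  shows "onorm (\<lambda>u. A *v u) \<le> cmod (A $ 1 $ 1) + cmod (A $ 1 $ 2) + cmod (A $ 2 $ 1) + cmod (A $ 2 $ 2)"
proof (rule onorm_bound)
  fix u :: "complex^2"
  have u: "cmod (u $ i) \<le> norm u" for i by (rule Finite_Cartesian_Product.norm_nth_le)
  have "norm (A *v u) \<le> cmod (A $ 1 $ 1 * u $ 1 + A $ 1 $ 2 * u $ 2) + cmod (A $ 2 $ 1 * u $ 1 + A $ 2 $ 2 * u $ 2)"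
    using norm_vec2_le[of "A *v u"] by (simp add: matrix_vector_2)
  also have "\<dots> \<le> (cmod (A $ 1 $ 1) * cmod (u $ 1) + cmod (A $ 1 $ 2) * cmod (u $ 2))
      + (cmod (A $ 2 $ 1) * cmod (u $ 1) + cmod (A $ 2 $ 2) * cmod (u $ 2))"
    by (intro add_mono norm_triangle_le) (simp_all add: norm_mult)
  also have "\<dots> \<le> (cmod (A $ 1 $ 1) * norm u + cmod (A $ 1 $ 2) * norm u)
      + (cmod (A $ 2 $ 1) * norm u + cmod (A $ 2 $ 2) * norm u)"
    by (intro add_mono mult_left_mono u) auto
  finally show "norm (A *v u) \<le> (cmod (A $ 1 $ 1) + cmod (A $ 1 $ 2) + cmod (A $ 2 $ 1) + cmod (A $ 2 $ 2)) * norm u"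
    by (simp add: algebra_simps)
qed auto

text \<open>The two products in the determinant are bounded by half the sum of the squared column
  norms, and each column is the image of a unit vector.\<close>

lemma onorm_ge_1:
  fixes A :: "complex^2^2"
  assumes "A $ 1 $ 1 * A $ 2 $ 2 - A $ 1 $ 2 * A $ 2 $ 1 = 1"
  shows "onorm (\<lambda>u. A *v u) \<ge> 1"
proof -
  let ?N = "onorm (\<lambda>u. A *v u)"
  have N0: "?N \<ge> 0" by (rule onorm_pos_le) simp
  have col: "(cmod (A $ 1 $ i))\<^sup>2 + (cmod (A $ 2 $ i))\<^sup>2 \<le> ?N\<^sup>2" for i
  proof -
    have "(A *v axis i 1) $ j = A $ j $ i" for j
      using exhaust_2[of i] by (auto simp: matrix_vector_2 axis_def)
    moreover have "norm (A *v axis i 1) \<le> ?N * norm (axis i 1 :: complex^2)"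
      by (rule onorm) simp
    then have "(norm (A *v axis i 1))\<^sup>2 \<le> ?N\<^sup>2" by (intro power_mono) auto
    ultimately show ?thesis by (simp add: norm_vec2_power2)
  qed
  have am: "x * y \<le> (x\<^sup>2 + y\<^sup>2) / 2" for x y :: real
    using sum_squares_bound[of x y] by simp
  have "1 = cmod (A $ 1 $ 1 * A $ 2 $ 2 - A $ 1 $ 2 * A $ 2 $ 1)" using assms by simp
  also have "\<dots> \<le> cmod (A $ 1 $ 1) * cmod (A $ 2 $ 2) + cmod (A $ 1 $ 2) * cmod (A $ 2 $ 1)"
    using norm_triangle_ineq4[of "A $ 1 $ 1 * A $ 2 $ 2" "A $ 1 $ 2 * A $ 2 $ 1"] by (simp add: norm_mult)
  also have "\<dots> \<le> ?N\<^sup>2"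
    using am[of "cmod (A $ 1 $ 1)" "cmod (A $ 2 $ 2)"] am[of "cmod (A $ 1 $ 2)" "cmod (A $ 2 $ 1)"] col[of 1] col[of 2]
    by (simp add: field_simps)
  finally show ?thesis using N0 by (metis one_le_power one_power2 power2_le_imp_le power_one)
qed

text \<open>Serves the measurability of the integrand in the Lyapunov exponent. The operator norm is
  at most the sum of the moduli of the four entries, hence Lipschitz with constant
  \<open>4\<close>.\<close>

lemma continuous_onorm_matrix2:
  "continuous_on UNIV (\<lambda>(a, b, c, d). onorm (\<lambda>u. (vector [vector [a, b], vector [c, d]] :: complex^2^2) *v u))"
proof -
  define M :: "complex \<times> complex \<times> complex \<times> complex \<Rightarrow> complex^2^2"
    where "M = (\<lambda>(a, b, c, d). vector [vector [a, b], vector [c, d]])"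
  define F where "F p = onorm (\<lambda>u. M p *v u)" for p
  have le: "F p \<le> F q + 4 * norm (p - q)" for p q
  proof -
    obtain a b c d where p: "p = (a, b, c, d)" by (cases p) auto
    obtain a' b' c' d' where q: "q = (a', b', c', d')" by (cases q) auto
    have pq: "p - q = (a - a', b - b', c - c', d - d')" by (simp add: p q)
    have n: "cmod (a - a') \<le> norm (p - q)" "cmod (b - b') \<le> norm (p - q)"
       "cmod (c - c') \<le> norm (p - q)" "cmod (d - d') \<le> norm (p - q)"
      unfolding pq by (meson norm_fst_le norm_snd_le order_trans order_refl)+
    have "F p = onorm (\<lambda>u. M q *v u + (M p - M q) *v u)"
      unfolding F_def by (simp add: matrix_vector_mult_diff_rdistrib)
    also have "\<dots> \<le> F q + onorm (\<lambda>u. (M p - M q) *v u)"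
      unfolding F_def by (rule onorm_triangle) auto
    also have "onorm (\<lambda>u. (M p - M q) *v u) \<le> 4 * norm (p - q)"
      using onorm_matrix2_le[of "M p - M q"] n by (simp add: M_def p q)
    finally show ?thesis by simp
  qed
  have "4-lipschitz_on UNIV F"
  proof (rule lipschitz_onI)
    fix p q
    show "dist (F p) (F q) \<le> 4 * dist p q"
      using le[of p q] le[of q p] by (simp add: dist_norm norm_minus_commute abs_le_iff)
  qed simp
  then have "continuous_on UNIV F" by (rule lipschitz_on_continuous_on)
  then show ?thesis by (simp add: F_def[abs_def] M_def case_prod_unfold)
qed

lemma transfer_matrix_Suc_entries:
  "transfer_matrix \<alpha> V E (Suc n) x $ 1 $ j =
     (E - V (\<lambda>i. x i + of_nat n * \<alpha> i)) * transfer_matrix \<alpha> V E n x $ 1 $ j - transfer_matrix \<alpha> V E n x $ 2 $ j"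
  "transfer_matrix \<alpha> V E (Suc n) x $ 2 $ j = transfer_matrix \<alpha> V E n x $ 1 $ j"
  by (simp_all add: schrodinger_matrix_def matrix_matrix_mult_def sum_2)

lemma transfer_matrix_0_entries:
  "transfer_matrix \<alpha> V E 0 x $ 1 $ 1 = 1" "transfer_matrix \<alpha> V E 0 x $ 1 $ 2 = 0"
  "transfer_matrix \<alpha> V E 0 x $ 2 $ 1 = 0" "transfer_matrix \<alpha> V E 0 x $ 2 $ 2 = 1"
  by (simp_all add: mat_def)

lemma transfer_matrix_det:
  "transfer_matrix \<alpha> V E n x $ 1 $ 1 * transfer_matrix \<alpha> V E n x $ 2 $ 2
   - transfer_matrix \<alpha> V E n x $ 1 $ 2 * transfer_matrix \<alpha> V E n x $ 2 $ 1 = 1"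
proof (induction n)
  case (Suc n)
  then show ?case unfolding transfer_matrix_Suc_entries by (simp add: algebra_simps)
qed (simp add: transfer_matrix_0_entries del: transfer_matrix.simps)

lemma transfer_matrix_solution:
  assumes "\<And>n::int. y (n + 1) + y (n - 1) + V (\<lambda>j. x j + of_int n * \<alpha> j) * y n = E * y n"
  shows "transfer_matrix \<alpha> V E n x $ 1 $ 1 * y 0 + transfer_matrix \<alpha> V E n x $ 1 $ 2 * y (- 1) = y (int n)"
    and "transfer_matrix \<alpha> V E n x $ 2 $ 1 * y 0 + transfer_matrix \<alpha> V E n x $ 2 $ 2 * y (- 1) = y (int n - 1)"
proof -
  have "transfer_matrix \<alpha> V E n x $ 1 $ 1 * y 0 + transfer_matrix \<alpha> V E n x $ 1 $ 2 * y (- 1) = y (int n) \<and>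
    transfer_matrix \<alpha> V E n x $ 2 $ 1 * y 0 + transfer_matrix \<alpha> V E n x $ 2 $ 2 * y (- 1) = y (int n - 1)"
  proof (induction n)
    case 0
    then show ?case by (simp add: transfer_matrix_0_entries del: transfer_matrix.simps)
  next
    case (Suc n)
    define T where "T i j = transfer_matrix \<alpha> V E n x $ i $ j" for i j
    define v where "v = V (\<lambda>j. x j + of_nat n * \<alpha> j)"
    have IH: "T 1 1 * y 0 + T 1 2 * y (- 1) = y (int n)" "T 2 1 * y 0 + T 2 2 * y (- 1) = y (int n - 1)"
      using Suc.IH by (simp_all add: T_def)
    have y: "y (int n + 1) = (E - v) * y (int n) - y (int n - 1)"
    proof -
      have "y (int n + 1) + y (int n - 1) + v * y (int n) = E * y (int n)"
        using assms[of "int n"] by (simp add: v_def)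
      then show ?thesis by (simp add: left_diff_distrib eq_diff_eq add.assoc add.commute)
    qed
    have "((E - v) * T 1 1 - T 2 1) * y 0 + ((E - v) * T 1 2 - T 2 2) * y (- 1)
        = (E - v) * (T 1 1 * y 0 + T 1 2 * y (- 1)) - (T 2 1 * y 0 + T 2 2 * y (- 1))"
      by (simp add: algebra_simps)
    also have "\<dots> = y (int n + 1)" unfolding IH y ..
    finally show ?case
      unfolding transfer_matrix_Suc_entries using IH by (simp add: T_def v_def add.commute)
  qed
  then show "transfer_matrix \<alpha> V E n x $ 1 $ 1 * y 0 + transfer_matrix \<alpha> V E n x $ 1 $ 2 * y (- 1) = y (int n)"
    and "transfer_matrix \<alpha> V E n x $ 2 $ 1 * y 0 + transfer_matrix \<alpha> V E n x $ 2 $ 2 * y (- 1) = y (int n - 1)"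
    by auto
qed

lemma floquet_pair_wronskian_ge:
  assumes "cmod \<mu> > 1"
  shows "cmod (\<mu> - inverse \<mu>) \<ge> cmod \<mu> * (1 - 1 / (cmod \<mu>)\<^sup>2)"
proof -
  have "cmod \<mu> * (1 - 1 / (cmod \<mu>)\<^sup>2) = cmod \<mu> - cmod (inverse \<mu>)"
    using assms by (auto simp: norm_inverse norm_divide field_simps power2_eq_square)
  then show ?thesis using norm_triangle_ineq2[of \<mu> "inverse \<mu>"] by simp
qed

lemma powi_mono_base:
  fixes m :: real
  assumes "m > 1" "i \<le> j"
  shows "m powi i \<le> m powi j"
  using assms by (intro power_int_increasing) auto

text \<open>Cramer's rule, from the action of the transfer matrix on the two Floquet solutions. The
  numerators have size \<open>2 * K\<^sup>2 * cmod \<mu> ^ (n + 1)\<close>; the Wronskian, at least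
  \<open>cmod \<mu> * q\<close>, takes away one power of \<open>cmod \<mu>\<close> and adds a third
  factor \<open>1 / q\<close> to the two in \<open>K\<^sup>2\<close>.\<close>

lemma transfer_matrix_entry_le:
  assumes pair: "floquet_pair (\<lambda>n. V (\<lambda>j. x j + of_int n * \<alpha> j)) \<mu> u v" and \<mu>: "cmod \<mu> > 1"
  defines "q \<equiv> 1 - 1 / (cmod \<mu>)\<^sup>2"
  shows "cmod (transfer_matrix \<alpha> V (\<mu> + inverse \<mu>) n x $ i $ j) \<le> 32 * cmod \<mu> ^ n / q ^ 3"
proof -
  let ?T = "transfer_matrix \<alpha> V (\<mu> + inverse \<mu>) n x"
  let ?m = "cmod \<mu>"
  define K where "K = 4 / q"
  define W where "W = \<mu> - inverse \<mu>"
  have "?m\<^sup>2 > 1" using \<mu> by (simp add: one_less_power)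
  then have q: "q > 0" by (simp add: q_def divide_less_eq)
  have Wge: "cmod W \<ge> ?m * q" using floquet_pair_wronskian_ge[OF \<mu>] by (simp add: W_def q_def)
  have mq: "?m * q > 0" using \<mu> q by (intro mult_pos_pos) linarith+
  have W0: "W \<noteq> 0" "\<mu> \<noteq> 0" using Wge mq by auto
  have equ: "u (n + 1) + u (n - 1) + V (\<lambda>j. x j + of_int n * \<alpha> j) * u n = (\<mu> + inverse \<mu>) * u n"
    and eqv: "v (n + 1) + v (n - 1) + V (\<lambda>j. x j + of_int n * \<alpha> j) * v n = (\<mu> + inverse \<mu>) * v n"
    and wr: "u (n + 1) * v n - u n * v (n + 1) = W"
    and bu: "cmod (u n) \<le> K * ?m powi n" and bv: "cmod (v n) \<le> K * ?m powi (- n)" for n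
    using pair by (simp_all add: floquet_pair_def W_def K_def q_def)
  have K: "K > 0" using q by (simp add: K_def)
  have wr0: "u 0 * v (- 1) - u (- 1) * v 0 = W" using wr[of "- 1"] by simp
  have cramer: "?T $ 1 $ 1 * W = u (int n) * v (- 1) - v (int n) * u (- 1)"
      "?T $ 1 $ 2 * W = v (int n) * u 0 - u (int n) * v 0"
      "?T $ 2 $ 1 * W = u (int n - 1) * v (- 1) - v (int n - 1) * u (- 1)"
      "?T $ 2 $ 2 * W = v (int n - 1) * u 0 - u (int n - 1) * v 0"
    unfolding wr0[symmetric] transfer_matrix_solution[where y = u, OF equ, of n, symmetric]
      transfer_matrix_solution[where y = v, OF eqv, of n, symmetric]
    by (simp_all add: algebra_simps)
  \<comment> \<open>A product of a value of \<open>u\<close> and a value of \<open>v\<close> is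
    controlled by the difference of their positions, at most \<open>n + 1\<close> in all four
    numerators.\<close>
  have bd: "cmod (u a * v b - v c * u d) \<le> 2 * K\<^sup>2 * ?m ^ (n + 1)"
    if "a - b \<le> int n + 1" "d - c \<le> int n + 1" for a b c d
  proof -
    have two: "cmod (u i) * cmod (v j) \<le> K\<^sup>2 * ?m ^ (n + 1)" if "i - j \<le> int n + 1" for i j
    proof -
      have "cmod (u i) * cmod (v j) \<le> (K * ?m powi i) * (K * ?m powi (- j))"
        using bu bv K by (intro mult_mono) auto
      also have "\<dots> = K\<^sup>2 * ?m powi (i - j)"
        using W0 by (simp add: power2_eq_square power_int_diff power_int_minus divide_inverse)
      also have "\<dots> \<le> K\<^sup>2 * ?m powi (int (n + 1))"
        using that \<mu> by (intro mult_left_mono powi_mono_base) auto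
      also have "?m powi (int (n + 1)) = ?m ^ (n + 1)" by (rule power_int_of_nat)
      finally show ?thesis .
    qed
    have "cmod (u a * v b - v c * u d) \<le> cmod (u a) * cmod (v b) + cmod (u d) * cmod (v c)"
      using norm_triangle_ineq4[of "u a * v b" "v c * u d"] by (simp add: norm_mult mult.commute)
    then show ?thesis using two[of a b] two[of d c] that by simp
  qed
  have "cmod (?T $ i $ j * W) \<le> 2 * K\<^sup>2 * ?m ^ (n + 1)"
  proof -
    consider "i = 1" "j = 1" | "i = 1" "j = 2" | "i = 2" "j = 1" | "i = 2" "j = 2"
      using exhaust_2[of i] exhaust_2[of j] by blast
    then show ?thesis
    proof cases
      case 1
      show ?thesis unfolding 1 cramer(1) by (rule bd) linarith+
    next
      case 2
      show ?thesis unfolding 2 cramer(2) by (subst norm_minus_commute, rule bd) linarith+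
    next
      case 3
      show ?thesis unfolding 3 cramer(3) by (rule bd) linarith+
    next
      case 4
      show ?thesis unfolding 4 cramer(4) by (subst norm_minus_commute, rule bd) linarith+
    qed
  qed
  then have "cmod (?T $ i $ j) * cmod W \<le> 2 * K\<^sup>2 * ?m ^ (n + 1)" by (simp add: norm_mult)
  moreover have "cmod (?T $ i $ j) * (?m * q) \<le> cmod (?T $ i $ j) * cmod W"
    using Wge by (intro mult_left_mono) auto
  ultimately have "cmod (?T $ i $ j) * (?m * q) \<le> 2 * K\<^sup>2 * ?m ^ (n + 1)" by linarith
  then have "cmod (?T $ i $ j) \<le> 2 * K\<^sup>2 * ?m ^ (n + 1) / (?m * q)"
    by (simp only: pos_le_divide_eq[OF mq])
  also have "\<dots> = 32 * ?m ^ n / q ^ 3"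
    using W0 q by (simp add: K_def power2_eq_square power3_eq_cube field_simps)
  finally show ?thesis .
qed

text \<open>The matrix is tested on the initial data of the growing solution \<open>u\<close>. Its
  later data cannot be small, because their Wronskian with the decaying solution \<open>v\<close> is
  a fixed nonzero number.\<close>

lemma transfer_matrix_onorm_ge:
  assumes pair: "floquet_pair (\<lambda>n. V (\<lambda>j. x j + of_int n * \<alpha> j)) \<mu> u v" and \<mu>: "cmod \<mu> > 1"
  defines "q \<equiv> 1 - 1 / (cmod \<mu>)\<^sup>2"
  shows "onorm (\<lambda>w. transfer_matrix \<alpha> V (\<mu> + inverse \<mu>) n x *v w) \<ge> q ^ 3 / 64 * cmod \<mu> ^ n"
proof -
  let ?T = "transfer_matrix \<alpha> V (\<mu> + inverse \<mu>) n x"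
  let ?m = "cmod \<mu>"
  define K where "K = 4 / q"
  define W where "W = \<mu> - inverse \<mu>"
  have "?m\<^sup>2 > 1" using \<mu> by (simp add: one_less_power)
  then have q: "q > 0" by (simp add: q_def divide_less_eq)
  have Wge: "cmod W \<ge> ?m * q" using floquet_pair_wronskian_ge[OF \<mu>] by (simp add: W_def q_def)
  have mq: "?m * q > 0" using \<mu> q by (intro mult_pos_pos) linarith+
  have W0: "W \<noteq> 0" "\<mu> \<noteq> 0" using Wge mq by auto
  have equ: "u (n + 1) + u (n - 1) + V (\<lambda>j. x j + of_int n * \<alpha> j) * u n = (\<mu> + inverse \<mu>) * u n"
    and wr: "u (n + 1) * v n - u n * v (n + 1) = W"
    and bu: "cmod (u n) \<le> K * ?m powi n" and bv: "cmod (v n) \<le> K * ?m powi (- n)" for n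
    using pair by (simp_all add: floquet_pair_def W_def K_def q_def)
  have K: "K > 0" using q by (simp add: K_def)
  define a where "a k = (vector [u k, u (k - 1)] :: complex^2)" for k
  have wr': "cmod W \<le> 2 * norm (a k) * (K * ?m powi (1 - k))" for k
  proof -
    have "cmod (v k) \<le> K * ?m powi (1 - k)"
      using bv[of k] powi_mono_base[OF \<mu>, of "- k" "1 - k"] K by (smt (verit) mult_left_mono)
    moreover have "cmod (v (k - 1)) \<le> K * ?m powi (1 - k)" using bv[of "k - 1"] by simp
    moreover have "cmod (u k) \<le> norm (a k)" "cmod (u (k - 1)) \<le> norm (a k)"
      using Finite_Cartesian_Product.norm_nth_le[of "a k" 1] Finite_Cartesian_Product.norm_nth_le[of "a k" 2]
      by (simp_all add: a_def)
    moreover have "W = u k * v (k - 1) - u (k - 1) * v k" using wr[of "k - 1"] by simp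
    then have "cmod W \<le> cmod (u k) * cmod (v (k - 1)) + cmod (u (k - 1)) * cmod (v k)"
      by (metis norm_mult norm_triangle_ineq4)
    ultimately have "cmod W \<le> norm (a k) * (K * ?m powi (1 - k)) + norm (a k) * (K * ?m powi (1 - k))"
      by (smt (verit) mult_mono norm_ge_zero)
    then show ?thesis by (simp add: mult_ac)
  qed
  have a0: "norm (a 0) \<le> 2 * K"
  proof -
    have "norm (a 0) \<le> cmod (u 0) + cmod (u (- 1))" using norm_vec2_le[of "a 0"] by (simp add: a_def)
    also have "\<dots> \<le> K + K"
      using bu[of 0] bu[of "- 1"] powi_mono_base[OF \<mu>, of "- 1" 0] K
      by (intro add_mono) (auto intro: order_trans mult_left_mono[of _ 1 K, simplified])
    finally show ?thesis by simp
  qed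
  have a0pos: "norm (a 0) > 0"
    using wr'[of 0] W0 by (cases "a 0 = 0") auto
  have an: "norm (a (int n)) \<ge> q / (2 * K) * ?m ^ n"
  proof -
    have mp: "?m powi (1 - int n) * ?m ^ n = ?m"
      using W0 by (simp add: power_int_diff)
    have "?m * q * ?m ^ n \<le> cmod W * ?m ^ n" using Wge by (intro mult_right_mono) auto
    also have "\<dots> \<le> 2 * norm (a (int n)) * (K * ?m powi (1 - int n)) * ?m ^ n"
      using wr' by (intro mult_right_mono) auto
    also have "\<dots> = 2 * norm (a (int n)) * K * (?m powi (1 - int n) * ?m ^ n)" by simp
    also have "\<dots> = ?m * (2 * norm (a (int n)) * K)" unfolding mp by simp
    finally have "?m * (q * ?m ^ n) \<le> ?m * (2 * norm (a (int n)) * K)" by (simp add: mult.assoc)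
    moreover have "?m > 0" using \<mu> by linarith
    ultimately have "q * ?m ^ n \<le> 2 * norm (a (int n)) * K" by simp
    then show ?thesis using K by (simp add: field_simps)
  qed
  have Ta: "?T *v a 0 = a (int n)"
    using transfer_matrix_solution[where y = u, OF equ, of n]
    by (simp add: vec_eq_iff forall_2 matrix_vector_2 a_def)
  have "q ^ 3 / 64 * ?m ^ n = (q / (2 * K) * ?m ^ n) / (2 * K)"
    using q by (simp add: K_def power3_eq_cube field_simps)
  also have "\<dots> \<le> norm (a (int n)) / norm (a 0)"
    using an a0 a0pos q K by (intro frac_le) auto
  also have "\<dots> = norm (?T *v a 0) / norm (a 0)" by (simp add: Ta)
  also have "\<dots> \<le> onorm (\<lambda>w. ?T *v w)" by (rule le_onorm) simp
  finally show ?thesis .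
qed

section \<open>The Joukowski map and the energies in \<open>[-2, 2]\<close>\<close>

lemma joukowski_imaginary_part_le:
  assumes "cmod \<mu> > 1"
  shows "\<bar>Im (\<mu> + inverse \<mu>)\<bar> \<le> cmod \<mu> * (1 - 1 / (cmod \<mu>)\<^sup>2)"
proof -
  have "(cmod \<mu>)\<^sup>2 > 1" using assms by (simp add: one_less_power)
  then have q: "1 - 1 / (cmod \<mu>)\<^sup>2 > 0" by (simp add: divide_less_eq)
  \<comment> \<open>The inverse is the conjugate divided by \<open>(cmod \<mu>)\<^sup>2\<close>.
    This formula relates the degeneration of the Floquet bounds to the distance of the energy from
    the real axis.\<close>
  have "Im (\<mu> + inverse \<mu>) = Im \<mu> * (1 - 1 / (cmod \<mu>)\<^sup>2)"
    by (simp add: cmod_power2 algebra_simps)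
  then have "\<bar>Im (\<mu> + inverse \<mu>)\<bar> = \<bar>Im \<mu>\<bar> * (1 - 1 / (cmod \<mu>)\<^sup>2)" using q by (simp add: abs_mult)
  also have "\<dots> \<le> cmod \<mu> * (1 - 1 / (cmod \<mu>)\<^sup>2)"
    using q abs_Im_le_cmod[of \<mu>] by (intro mult_right_mono) auto
  finally show ?thesis .
qed

text \<open>The level sets of \<open>\<bar>\<mu>\<bar>\<close> are the ellipses with foci \<open>2\<close> and \<open>-2\<close>.\<close>

lemma joukowski_focal_sum:
  assumes "\<mu> \<noteq> 0"
  shows "cmod (\<mu> + inverse \<mu> - 2) + cmod (\<mu> + inverse \<mu> + 2) = 2 * (cmod \<mu> + 1 / cmod \<mu>)"
proof -
  define s where "s = csqrt \<mu>"
  have s: "s\<^sup>2 = \<mu>" "s \<noteq> 0" using assms by (auto simp: s_def)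
  have eq: "\<mu> + inverse \<mu> - 2 = (s - inverse s)\<^sup>2" "\<mu> + inverse \<mu> + 2 = (s + inverse s)\<^sup>2"
    using s by (auto simp: power2_eq_square field_simps)
  have "(cmod (s - inverse s))\<^sup>2 + (cmod (s + inverse s))\<^sup>2 = 2 * (cmod s)\<^sup>2 + 2 * (cmod (inverse s))\<^sup>2"
    unfolding cmod_power2 by (simp add: power2_eq_square algebra_simps)
  also have "(cmod s)\<^sup>2 = cmod \<mu>" using s by (metis norm_power)
  also have "(cmod (inverse s))\<^sup>2 = 1 / cmod \<mu>" using s by (metis norm_power norm_inverse power_inverse inverse_eq_divide)
  finally show ?thesis unfolding eq by (simp add: norm_power)
qed

text \<open>A point of the focal segment has focal sum \<open>4\<close>, and moving by
  \<open>\<rho>\<close> changes it by at most \<open>2 * \<rho>\<close>. With \<open>R\<close> for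
  the modulus this gives \<open>R + 1 / R \<le> 2 + \<rho>\<close>, that is,
  \<open>(R - 1)\<^sup>2 \<le> R * \<rho>\<close>; the crude bound \<open>R \<le> 3\<close>
  finishes.\<close>

lemma joukowski_radius_le:
  assumes "cmod \<mu> \<ge> 1" "E0 \<in> \<real>" "\<bar>Re E0\<bar> \<le> 2" "cmod (\<mu> + inverse \<mu> - E0) \<le> \<rho>" "\<rho> \<le> 1"
  shows "cmod \<mu> \<le> 1 + sqrt (3 * \<rho>)"
proof -
  define R where "R = cmod \<mu>"
  have R: "R \<ge> 1" using assms by (simp add: R_def)
  then have \<mu>0: "\<mu> \<noteq> 0" by (auto simp: R_def)
  have \<rho>0: "\<rho> \<ge> 0" using assms(4) norm_ge_zero order_trans by blast
  have E0: "E0 = of_real (Re E0)" using assms(2) by (metis Reals_cases Re_complex_of_real)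
  have "cmod (E0 - 2) = \<bar>Re E0 - 2\<bar>" "cmod (E0 + 2) = \<bar>Re E0 + 2\<bar>"
    by (subst E0, metis norm_of_real of_real_diff of_real_numeral, subst E0, metis norm_of_real of_real_add of_real_numeral)
  then have foc: "cmod (E0 - 2) + cmod (E0 + 2) = 4" using assms(3) by simp
  have "2 * (R + 1 / R) = cmod (\<mu> + inverse \<mu> - 2) + cmod (\<mu> + inverse \<mu> + 2)"
    using joukowski_focal_sum[OF \<mu>0] by (simp add: R_def)
  also have "\<dots> \<le> (\<rho> + cmod (E0 - 2)) + (\<rho> + cmod (E0 + 2))"
    using norm_triangle_ineq[of "\<mu> + inverse \<mu> - E0" "E0 - 2"]
      norm_triangle_ineq[of "\<mu> + inverse \<mu> - E0" "E0 + 2"] assms(4)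
    by (intro add_mono) (simp_all add: algebra_simps)
  finally have 1: "R + 1 / R \<le> 2 + \<rho>" using foc by simp
  then have R3: "R \<le> 3" using assms(5) R by (smt (verit) divide_nonneg_nonneg)
  have "R * (R + 1 / R) \<le> R * (2 + \<rho>)" using 1 R by (intro mult_left_mono) auto
  moreover have "R * (R + 1 / R) = R\<^sup>2 + 1" using R by (simp add: field_simps power2_eq_square)
  ultimately have "(R - 1)\<^sup>2 \<le> R * \<rho>" by (simp add: power2_eq_square algebra_simps)
  also have "\<dots> \<le> 3 * \<rho>" using R3 \<rho>0 by (intro mult_right_mono) auto
  finally have "R - 1 \<le> sqrt (3 * \<rho>)" by (rule real_le_rsqrt)
  then show ?thesis by (simp add: R_def)
qed

lemma joukowski_branch:
  fixes E :: complex
  defines "\<mu> \<equiv> E / 2 + sqrt_branch E / 2"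
  shows "cmod \<mu> \<ge> 1" "\<mu> + inverse \<mu> = E"
proof -
  show 1: "cmod \<mu> \<ge> 1" unfolding \<mu>_def by (rule sqrt_branch_ge_1)
  have "\<mu> * (E - \<mu>) = (E\<^sup>2 - (sqrt_branch E)\<^sup>2) / 4"
    by (simp add: \<mu>_def power2_eq_square algebra_simps add_divide_distrib diff_divide_distrib)
  then have "\<mu> * (E - \<mu>) = 1" by (simp add: sqrt_branch_power2)
  then have "inverse \<mu> = E - \<mu>" by (rule inverse_unique)
  then show "\<mu> + inverse \<mu> = E" by simp
qed

lemma joukowski_unit_circle:
  assumes "cmod \<mu> = 1"
  shows "\<mu> + inverse \<mu> \<in> \<real>" "\<bar>Re (\<mu> + inverse \<mu>)\<bar> \<le> 2"
proof -
  have "\<mu> * cnj \<mu> = 1" using assms complex_norm_square[of \<mu>] by simp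
  then have "inverse \<mu> = cnj \<mu>" by (rule inverse_unique)
  then have eq: "\<mu> + inverse \<mu> = of_real (2 * Re \<mu>)" by (simp add: complex_add_cnj)
  show "\<mu> + inverse \<mu> \<in> \<real>" unfolding eq by (rule Reals_of_real)
  show "\<bar>Re (\<mu> + inverse \<mu>)\<bar> \<le> 2" unfolding eq using abs_Re_le_cmod[of \<mu>] assms by simp
qed

lemma holomorphic_transfer_matrix:
  "(\<lambda>E. transfer_matrix \<alpha> V E n x $ i $ j) holomorphic_on S"
proof -
  have "\<forall>i. (\<lambda>E. transfer_matrix \<alpha> V E n x $ i $ j) holomorphic_on S"
  proof (induction n)
    case 0
    then show ?case by (simp add: holomorphic_on_const)
  next
    case (Suc n)
    then show ?case
      unfolding forall_2 transfer_matrix_Suc_entries by (auto intro!: holomorphic_intros)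
  qed
  then show ?thesis by blast
qed

text \<open>On \<open>[-2, 2]\<close> the Floquet solutions may fail to exist, but the maximum principle bounds the
  transfer matrix by its values on the circle of radius \<open>\<rho>\<close> about the energy. The bound there
  degenerates like \<open>1 / \<bar>Im E\<bar> ^ 3\<close>, which the factor \<open>((E - E0)\<^sup>2 - \<rho>\<^sup>2) ^ 3\<close> compensates, as
  it vanishes at the two real points of the circle.\<close>

lemma transfer_matrix_spectrum_entry_le:
  assumes pair: "\<And>\<mu>. cmod \<mu> > 1 \<Longrightarrow> \<exists>u v. floquet_pair (\<lambda>n. V (\<lambda>j. x j + of_int n * \<alpha> j)) \<mu> u v"
    and E0: "E0 \<in> \<real>" "\<bar>Re E0\<bar> \<le> 2" and \<rho>: "0 < \<rho>" "\<rho> \<le> 1"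
  shows "cmod (transfer_matrix \<alpha> V E0 n x $ i $ j) \<le> 256 / \<rho> ^ 3 * (1 + sqrt (3 * \<rho>)) ^ (n + 3)"
proof -
  define f where "f E = transfer_matrix \<alpha> V E n x $ i $ j" for E
  define g where "g E = f E * ((E - E0)\<^sup>2 - of_real (\<rho>\<^sup>2)) ^ 3" for E
  define R where "R = 1 + sqrt (3 * \<rho>)"
  have hol: "g holomorphic_on S" for S
    unfolding g_def f_def by (intro holomorphic_intros holomorphic_transfer_matrix)
  have bd: "cmod (g E) \<le> 256 * \<rho> ^ 3 * R ^ (n + 3)" if "E \<in> frontier (ball E0 \<rho>)" for E
  proof -
    have E: "cmod (E - E0) = \<rho>" using that \<rho> by (simp add: frontier_ball dist_norm norm_minus_commute)
    have ImE0: "Im E0 = 0" using E0(1) by (simp add: complex_is_Real_iff)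
    define y where "y = \<bar>Im E\<bar>"
    have fac: "cmod ((E - E0)\<^sup>2 - of_real (\<rho>\<^sup>2)) = 2 * \<rho> * y"
    proof -
      define z where "z = E - E0"
      \<comment> \<open>On the circle this makes the compensating factor equal to
        \<open>z * (z - cnj z)\<close>, which exposes the imaginary part.\<close>
      have "of_real (\<rho>\<^sup>2) = z * cnj z" using E complex_norm_square[of z] by (simp add: z_def)
      then have "(E - E0)\<^sup>2 - of_real (\<rho>\<^sup>2) = z * (z - cnj z)"
        by (simp add: z_def power2_eq_square algebra_simps)
      also have "z - cnj z = 2 * \<i> * of_real (Im z)" by (simp add: complex_eq_iff)
      finally have "cmod ((E - E0)\<^sup>2 - of_real (\<rho>\<^sup>2)) = cmod z * cmod (2 * \<i> * of_real (Im z))"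
        by (simp only: norm_mult)
      also have "cmod (2 * \<i> * of_real (Im z)) = 2 * \<bar>Im z\<bar>"
        by (simp add: norm_mult)
      finally show ?thesis using E ImE0 by (simp add: z_def y_def)
    qed
    show ?thesis
    proof (cases "Im E = 0")
      case True
      then have "(E - E0)\<^sup>2 - of_real (\<rho>\<^sup>2) = 0" using fac by (simp add: y_def)
      then have "g E = 0" by (simp add: g_def)
      then show ?thesis using \<rho> by (auto simp: R_def)
    next
      case False
      then have y: "y > 0" by (simp add: y_def)
      define \<mu> where "\<mu> = E / 2 + sqrt_branch E / 2"
      have \<mu>: "cmod \<mu> \<ge> 1" "\<mu> + inverse \<mu> = E" using joukowski_branch[of E] by (auto simp: \<mu>_def)
      have "cmod \<mu> \<noteq> 1" using joukowski_unit_circle(1)[of \<mu>] \<mu>(2) False by (auto simp: complex_is_Real_iff)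
      then have \<mu>1: "cmod \<mu> > 1" using \<mu>(1) by simp
      define q where "q = 1 - 1 / (cmod \<mu>)\<^sup>2"
      have yq: "y \<le> cmod \<mu> * q" using joukowski_imaginary_part_le[OF \<mu>1] by (simp add: \<mu>(2) y_def q_def)
      have \<mu>R: "cmod \<mu> \<le> R"
        unfolding R_def using joukowski_radius_le[OF \<mu>(1) E0, of \<rho>] \<rho> E \<mu>(2) by simp
      have \<mu>0: "cmod \<mu> > 0" using \<mu>1 by linarith
      have q: "q > 0" using yq y \<mu>0 by (smt (verit) mult_nonneg_nonpos)
      obtain u v where "floquet_pair (\<lambda>n. V (\<lambda>j. x j + of_int n * \<alpha> j)) \<mu> u v" using pair \<mu>1 by blast
      from transfer_matrix_entry_le[OF this \<mu>1, of n i j]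
      have fE: "cmod (f E) \<le> 32 * cmod \<mu> ^ n / q ^ 3" by (simp add: \<mu>(2) f_def q_def)
      have "cmod (g E) = cmod (f E) * (2 * \<rho> * y) ^ 3" by (simp only: g_def norm_mult norm_power fac)
      \<comment> \<open>The cube of \<open>y \<le> cmod \<mu> * q\<close> cancels
        \<open>q ^ 3\<close> and leaves three extra powers of \<open>cmod \<mu>\<close>.\<close>
      also have "\<dots> \<le> 32 * cmod \<mu> ^ n / q ^ 3 * (2 * \<rho> * (cmod \<mu> * q)) ^ 3"
        using yq y \<rho> fE q by (intro mult_mono power_mono mult_left_mono) auto
      also have "\<dots> = 256 * \<rho> ^ 3 * cmod \<mu> ^ (n + 3)"
        using q by (simp add: power_mult_distrib power_add)
      also have "\<dots> \<le> 256 * \<rho> ^ 3 * R ^ (n + 3)"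
        using \<mu>R \<mu>0 \<rho> by (intro mult_left_mono power_mono) auto
      finally show ?thesis .
    qed
  qed
  have "cmod (g E0) \<le> 256 * \<rho> ^ 3 * R ^ (n + 3)"
    by (rule maximum_modulus_frontier[where S = "ball E0 \<rho>"])
      (use \<rho> bd in \<open>auto intro!: hol holomorphic_on_imp_continuous_on\<close>)
  \<comment> \<open>At the centre the compensating factor is
    \<open>(- \<rho>\<^sup>2) ^ 3\<close>.\<close>
  moreover have "cmod (g E0) = cmod (f E0) * \<rho> ^ 6"
    using \<rho> by (simp add: g_def norm_mult norm_power power_mult[symmetric])
  ultimately have "cmod (f E0) \<le> 256 * \<rho> ^ 3 * R ^ (n + 3) / \<rho> ^ 6"
    using \<rho> by (simp add: pos_le_divide_eq)
  also have "\<dots> = 256 / \<rho> ^ 3 * R ^ (n + 3)"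
    using \<rho> by (simp add: field_simps power_add[symmetric])
  finally show ?thesis by (simp add: f_def R_def)
qed


section \<open>Lyapunov exponents\<close>

lemma prob_space_torus_haar: "prob_space (torus_haar d)"
proof -
  have "emeasure lborel {0..<2 * pi} = ennreal (2 * pi)" by (subst emeasure_lborel_Ico) auto
  then have "prob_space (uniform_measure lborel {0..<2 * pi})"
    using pi_gt_zero by (intro prob_space_uniform_measure) (simp_all add: ennreal_eq_0_iff not_le del: pi_gt_zero)
  then show ?thesis unfolding torus_haar_def by (intro prob_space_PiM)
qed

lemma measurable_torus_coordinate [measurable]:
  "j \<in> coords d \<Longrightarrow> (\<lambda>x. x j) \<in> borel_measurable (torus_haar d)"
proof -
  assume "j \<in> coords d"
  then have "(\<lambda>x. x j) \<in> measurable (torus_haar d) (uniform_measure lborel {0..<2 * pi})"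
    unfolding torus_haar_def by (rule measurable_component_singleton)
  then show ?thesis by (simp cong: measurable_cong_sets)
qed

lemma borel_measurable_onorm_matrix2:
  fixes A :: "'a \<Rightarrow> complex^2^2"
  assumes "\<And>i j. (\<lambda>x. A x $ i $ j) \<in> borel_measurable M"
  shows "(\<lambda>x. onorm (\<lambda>u. A x *v u)) \<in> borel_measurable M"
proof -
  have eq: "A x = vector [vector [A x $ 1 $ 1, A x $ 1 $ 2], vector [A x $ 2 $ 1, A x $ 2 $ 2]]" for x
    by (simp add: vec_eq_iff forall_2)
  have "(\<lambda>x. (A x $ 1 $ 1, A x $ 1 $ 2, A x $ 2 $ 1, A x $ 2 $ 2)) \<in> borel_measurable M"
    using assms by (intro borel_measurable_Pair)
  from borel_measurable_continuous_on[OF continuous_onorm_matrix2 this]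
  show ?thesis by (simp add: eq[symmetric])
qed

lemma borel_measurable_transfer_matrix:
  assumes "\<And>n::nat. (\<lambda>x. V (\<lambda>j. x j + of_nat n * \<alpha> j)) \<in> borel_measurable M"
  shows "(\<lambda>x. transfer_matrix \<alpha> V E n x $ i $ j) \<in> borel_measurable M"
proof -
  have "\<forall>i. (\<lambda>x. transfer_matrix \<alpha> V E n x $ i $ j) \<in> borel_measurable M"
  proof (induction n)
    case 0
    then show ?case by simp
  next
    case (Suc n)
    then show ?case
      unfolding forall_2 transfer_matrix_Suc_entries
      by (auto intro!: borel_measurable_diff borel_measurable_times assms)
  qed
  then show ?thesis by blast
qed

lemma has_lyapunov_exponentI:
  assumes meas: "\<And>n::nat. (\<lambda>x. V (\<lambda>j. x j + of_nat n * \<alpha> j)) \<in> borel_measurable (torus_haar d)"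
    and bds: "\<And>n x. n \<ge> 1 \<Longrightarrow> a n \<le> ln (onorm (\<lambda>u. transfer_matrix \<alpha> V E n x *v u))"
       "\<And>n x. n \<ge> 1 \<Longrightarrow> ln (onorm (\<lambda>u. transfer_matrix \<alpha> V E n x *v u)) \<le> b n"
    and lim: "(\<lambda>n. a n / real n) \<longlonglongrightarrow> L" "(\<lambda>n. b n / real n) \<longlonglongrightarrow> L"
  shows "has_lyapunov_exponent d \<alpha> V E L"
proof -
  interpret prob_space "torus_haar d" by (rule prob_space_torus_haar)
  define f where "f n x = ln (onorm (\<lambda>u. transfer_matrix \<alpha> V E n x *v u))" for n x
  have fm: "f n \<in> borel_measurable (torus_haar d)" for n
    unfolding f_def using borel_measurable_transfer_matrix[OF meas]
    by (intro borel_measurable_ln borel_measurable_onorm_matrix2)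
  \<comment> \<open>The integral of a nonintegrable function is \<open>0\<close> by convention, so
    integrability must precede the comparison of integrals.\<close>
  have int: "integrable (torus_haar d) (f n)" if "n \<ge> 1" for n
  proof (rule integrable_const_bound[where B = "\<bar>a n\<bar> + \<bar>b n\<bar>"])
    have "norm (f n x) \<le> \<bar>a n\<bar> + \<bar>b n\<bar>" for x
      using bds[OF that, of x] by (auto simp: f_def)
    then show "AE x in torus_haar d. norm (f n x) \<le> \<bar>a n\<bar> + \<bar>b n\<bar>" by simp
  qed (rule fm)
  have 1: "a n \<le> (LINT x|torus_haar d. f n x)" if "n \<ge> 1" for n
    using integral_mono[OF _ int[OF that], of "\<lambda>_. a n"] bds(1)[OF that] by (simp add: f_def[abs_def] prob_space)
  have 2: "(LINT x|torus_haar d. f n x) \<le> b n" if "n \<ge> 1" for n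
    using integral_mono[OF int[OF that], of "\<lambda>_. b n"] bds(2)[OF that] by (simp add: f_def[abs_def] prob_space)
  have "(\<lambda>n. 1 / real n * (LINT x|torus_haar d. f n x)) \<longlonglongrightarrow> L"
  proof (rule tendsto_sandwich[OF _ _ lim])
    show "\<forall>\<^sub>F n in sequentially. a n / real n \<le> 1 / real n * (LINT x|torus_haar d. f n x)"
      using eventually_ge_at_top[of 1] by eventually_elim (use 1 in \<open>simp add: divide_right_mono\<close>)
    show "\<forall>\<^sub>F n in sequentially. 1 / real n * (LINT x|torus_haar d. f n x) \<le> b n / real n"
      using eventually_ge_at_top[of 1] by eventually_elim (use 2 in \<open>simp add: divide_right_mono\<close>)
  qed
  then show ?thesis by (simp add: has_lyapunov_exponent_def f_def)
qed

text \<open>Off \<open>[-2, 2]\<close> the norms lie between two constant multiples of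
  \<open>cmod \<mu> ^ n\<close>, uniformly in \<open>x\<close>, and the constants vanish after
  division by \<open>n\<close>. On \<open>[-2, 2]\<close> the expected exponent is zero, and a
  subexponential upper bound suffices.\<close>

theorem lyapunov_exponent_of_floquet_pairs:
  assumes meas: "\<And>n::nat. (\<lambda>x. V (\<lambda>j. x j + of_nat n * \<alpha> j)) \<in> borel_measurable (torus_haar d)"
    and pair: "\<And>x \<mu>. cmod \<mu> > 1 \<Longrightarrow> \<exists>u v. floquet_pair (\<lambda>n. V (\<lambda>j. x j + of_int n * \<alpha> j)) \<mu> u v"
  shows "has_lyapunov_exponent d \<alpha> V E (ln (cmod (E / 2 + sqrt_branch E / 2)))"
proof -
  define \<mu> where "\<mu> = E / 2 + sqrt_branch E / 2"
  have \<mu>: "cmod \<mu> \<ge> 1" "\<mu> + inverse \<mu> = E" using joukowski_branch[of E] by (auto simp: \<mu>_def)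
  have ge1: "onorm (\<lambda>u. transfer_matrix \<alpha> V E n x *v u) \<ge> 1" for n x
    by (rule onorm_ge_1) (rule transfer_matrix_det)
  show ?thesis
    unfolding \<mu>_def[symmetric]
  proof (cases "cmod \<mu> > 1")
    case True
    define q where "q = 1 - 1 / (cmod \<mu>)\<^sup>2"
    have "(cmod \<mu>)\<^sup>2 > 1" using True by (simp add: one_less_power)
    then have q: "q > 0" by (simp add: q_def divide_less_eq)
    have m0: "cmod \<mu> > 0" using \<mu> by linarith
    have le: "onorm (\<lambda>u. transfer_matrix \<alpha> V E n x *v u) \<le> 128 / q ^ 3 * cmod \<mu> ^ n" for n x
    proof -
      obtain u v where uv: "floquet_pair (\<lambda>n. V (\<lambda>j. x j + of_int n * \<alpha> j)) \<mu> u v" using pair True by blast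
      show ?thesis
        using onorm_matrix2_le[of "transfer_matrix \<alpha> V E n x"]
          transfer_matrix_entry_le[OF uv True, of n 1 1] transfer_matrix_entry_le[OF uv True, of n 1 2]
          transfer_matrix_entry_le[OF uv True, of n 2 1] transfer_matrix_entry_le[OF uv True, of n 2 2]
        unfolding \<mu>(2) q_def[symmetric] by simp
    qed
    have ge: "onorm (\<lambda>u. transfer_matrix \<alpha> V E n x *v u) \<ge> q ^ 3 / 64 * cmod \<mu> ^ n" for n x
    proof -
      obtain u v where uv: "floquet_pair (\<lambda>n. V (\<lambda>j. x j + of_int n * \<alpha> j)) \<mu> u v" using pair True by blast
      show ?thesis using transfer_matrix_onorm_ge[OF uv True, of n] unfolding \<mu>(2) q_def[symmetric] .
    qed
    have lncalc: "ln (C * cmod \<mu> ^ n) = ln C + real n * ln (cmod \<mu>)" if "C > 0" for C n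
      using that m0 by (simp add: ln_mult ln_realpow)
    have lim: "(\<lambda>n. (C + real n * l) / real n) \<longlonglongrightarrow> l" for C l :: real by real_asymp
    show "has_lyapunov_exponent d \<alpha> V E (ln (cmod \<mu>))"
    proof (rule has_lyapunov_exponentI[where a = "\<lambda>n. ln (q ^ 3 / 64) + real n * ln (cmod \<mu>)"
            and b = "\<lambda>n. ln (128 / q ^ 3) + real n * ln (cmod \<mu>)", OF meas])
      fix n :: nat and x
      have "ln (q ^ 3 / 64 * cmod \<mu> ^ n) \<le> ln (onorm (\<lambda>u. transfer_matrix \<alpha> V E n x *v u))"
        using ge m0 q by (intro ln_mono) auto
      then show "ln (q ^ 3 / 64) + real n * ln (cmod \<mu>) \<le> ln (onorm (\<lambda>u. transfer_matrix \<alpha> V E n x *v u))"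
        using q by (subst (asm) lncalc) auto
      have "ln (onorm (\<lambda>u. transfer_matrix \<alpha> V E n x *v u)) \<le> ln (128 / q ^ 3 * cmod \<mu> ^ n)"
        using le ge1[of n x] by (intro ln_mono) auto
      then show "ln (onorm (\<lambda>u. transfer_matrix \<alpha> V E n x *v u)) \<le> ln (128 / q ^ 3) + real n * ln (cmod \<mu>)"
        using q by (subst (asm) lncalc) auto
    qed (rule lim)+
  next
    case False
    then have \<mu>1: "cmod \<mu> = 1" using \<mu> by simp
    have E: "E \<in> \<real>" "\<bar>Re E\<bar> \<le> 2" using joukowski_unit_circle[OF \<mu>1] \<mu>(2) by simp_all
    \<comment> \<open>The upper bound is the maximum principle estimate with radius
      \<open>\<rho> = 1 / n\<close>, summed over four entries: \<open>4 * 256 = 1024\<close>. The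
      power of \<open>1 + sqrt (3 / n)\<close> grows only like the exponential of a multiple of
      \<open>sqrt n\<close>.\<close>
    show "has_lyapunov_exponent d \<alpha> V E (ln (cmod \<mu>))"
    proof (rule has_lyapunov_exponentI[where a = "\<lambda>_. 0"
            and b = "\<lambda>n. ln (1024 * real n ^ 3) + (real n + 3) * ln (1 + sqrt (3 / real n))", OF meas])
      fix n :: nat and x assume n: "n \<ge> 1"
      show "0 \<le> ln (onorm (\<lambda>u. transfer_matrix \<alpha> V E n x *v u))" using ge1[of n x] by simp
      have ent: "cmod (transfer_matrix \<alpha> V E n x $ i $ j) \<le> 256 * real n ^ 3 * (1 + sqrt (3 / real n)) ^ (n + 3)" for i j
        using transfer_matrix_spectrum_entry_le[of V x \<alpha> E "1 / real n" n i j, OF pair E] n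
        by (simp add: power_divide)
      have pos: "1 + sqrt (3 / real n) > 0" by (intro add_pos_nonneg) auto
      have "onorm (\<lambda>u. transfer_matrix \<alpha> V E n x *v u) \<le> 1024 * real n ^ 3 * (1 + sqrt (3 / real n)) ^ (n + 3)"
        using onorm_matrix2_le[of "transfer_matrix \<alpha> V E n x"] ent[of 1 1] ent[of 1 2] ent[of 2 1] ent[of 2 2] by simp
      then have "ln (onorm (\<lambda>u. transfer_matrix \<alpha> V E n x *v u)) \<le> ln (1024 * real n ^ 3 * (1 + sqrt (3 / real n)) ^ (n + 3))"
        using ge1[of n x] by (intro ln_mono) auto
      also have "\<dots> = ln (1024 * real n ^ 3) + ln ((1 + sqrt (3 / real n)) ^ (n + 3))"
        using n pos by (intro ln_mult_pos) auto
      also have "ln ((1 + sqrt (3 / real n)) ^ (n + 3)) = (real n + 3) * ln (1 + sqrt (3 / real n))"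
        using pos by (subst ln_realpow) auto
      finally show "ln (onorm (\<lambda>u. transfer_matrix \<alpha> V E n x *v u))
          \<le> ln (1024 * real n ^ 3) + (real n + 3) * ln (1 + sqrt (3 / real n))" .
    next
      have "(\<lambda>n. (ln (1024 * real n ^ 3) + (real n + 3) * ln (1 + sqrt (3 / real n))) / real n) \<longlonglongrightarrow> 0"
        by real_asymp
      then show "(\<lambda>n. (ln (1024 * real n ^ 3) + (real n + 3) * ln (1 + sqrt (3 / real n))) / real n) \<longlonglongrightarrow> ln (cmod \<mu>)"
        by (simp add: \<mu>1)
    qed (simp add: \<mu>1)
  qed
qed


section \<open>The resolvent\<close>

lemma has_sum_finite_sum:
  fixes f :: "'i \<Rightarrow> 'a \<Rightarrow> 'b::topological_comm_monoid_add"
  assumes "finite F" "\<And>i. i \<in> F \<Longrightarrow> (f i has_sum s i) A"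
  shows "((\<lambda>x. \<Sum>i\<in>F. f i x) has_sum (\<Sum>i\<in>F. s i)) A"
  using assms by (induction F rule: finite_induct) (auto intro!: has_sum_add)

text \<open>With \<open>Q\<close>, \<open>S\<close>, \<open>P\<close> as in the proof, summing
  \<open>a x * (Q * b x - S)\<^sup>2\<close> gives \<open>Q * (Q * P - S\<^sup>2) \<ge> 0\<close>;
  if \<open>Q = 0\<close> all weights vanish.\<close>

lemma weighted_Cauchy_Schwarz_infsum:
  fixes a b :: "'a \<Rightarrow> real"
  assumes "\<And>x. x \<in> A \<Longrightarrow> a x \<ge> 0"
    and "a summable_on A" "(\<lambda>x. a x * b x) summable_on A" "(\<lambda>x. a x * (b x)\<^sup>2) summable_on A"
  shows "(\<Sum>\<^sub>\<infinity>x\<in>A. a x * b x)\<^sup>2 \<le> (\<Sum>\<^sub>\<infinity>x\<in>A. a x) * (\<Sum>\<^sub>\<infinity>x\<in>A. a x * (b x)\<^sup>2)"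
proof -
  define Q S P where "Q = (\<Sum>\<^sub>\<infinity>x\<in>A. a x)" and "S = (\<Sum>\<^sub>\<infinity>x\<in>A. a x * b x)"
    and "P = (\<Sum>\<^sub>\<infinity>x\<in>A. a x * (b x)\<^sup>2)"
  have sums: "(a has_sum Q) A" "((\<lambda>x. a x * b x) has_sum S) A" "((\<lambda>x. a x * (b x)\<^sup>2) has_sum P) A"
    using assms by (simp_all add: Q_def S_def P_def)
  have Q0: "Q \<ge> 0" unfolding Q_def using assms(1) by (rule infsum_nonneg)
  have "((\<lambda>x. Q\<^sup>2 * (a x * (b x)\<^sup>2) + (- 2 * Q * S) * (a x * b x) + S\<^sup>2 * a x) has_sum
      (Q\<^sup>2 * P + (- 2 * Q * S) * S + S\<^sup>2 * Q)) A"
    by (intro has_sum_add has_sum_cmult_right sums)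
  then have "0 \<le> Q\<^sup>2 * P + (- 2 * Q * S) * S + S\<^sup>2 * Q"
  proof (rule has_sum_nonneg)
    fix x assume "x \<in> A"
    have "Q\<^sup>2 * (a x * (b x)\<^sup>2) + (- 2 * Q * S) * (a x * b x) + S\<^sup>2 * a x = a x * (Q * b x - S)\<^sup>2"
      by (simp add: power2_eq_square algebra_simps)
    then show "0 \<le> Q\<^sup>2 * (a x * (b x)\<^sup>2) + (- 2 * Q * S) * (a x * b x) + S\<^sup>2 * a x"
      using assms(1)[OF \<open>x \<in> A\<close>] by simp
  qed
  also have "\<dots> = Q * (Q * P - S\<^sup>2)" by (simp add: power2_eq_square algebra_simps)
  finally have *: "0 \<le> Q * (Q * P - S\<^sup>2)" .
  have "S\<^sup>2 \<le> Q * P"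
  proof (cases "Q = 0")
    case True
    then have "a x = 0" if "x \<in> A" for x
      using nonneg_infsum_le_0D[of a A x] assms(1,2) that by (simp add: Q_def)
    then have "S = 0" unfolding S_def by (intro infsum_0) auto
    then show ?thesis using True by simp
  next
    case False
    then show ?thesis using * Q0 by (simp add: zero_le_mult_iff)
  qed
  then show ?thesis by (simp add: Q_def S_def P_def)
qed

section \<open>Kernels with summable off-diagonal decay\<close>

lemma ell2_bounded: "\<psi> \<in> ell2 \<Longrightarrow> cmod (\<psi> n) \<le> ell2_norm \<psi>"
proof -
  assume "\<psi> \<in> ell2"
  then have "(\<Sum>m\<in>{n}. (cmod (\<psi> m))\<^sup>2) \<le> (\<Sum>\<^sub>\<infinity>m. (cmod (\<psi> m))\<^sup>2)"
    by (intro finite_sum_le_infsum) (auto simp: ell2_def)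
  then show ?thesis unfolding ell2_norm_def by (intro real_le_rsqrt) simp
qed

lemma has_sum_int_shift:
  fixes f :: "int \<Rightarrow> 'a::{topological_comm_monoid_add, t2_space}"
  shows "((\<lambda>m. f (m + a)) has_sum s) UNIV \<longleftrightarrow> (f has_sum s) UNIV"
  by (rule has_sum_reindex_bij_betw)
    (auto simp: bij_betw_def inj_on_def surj_def intro!: exI[of _ "_ - a"])

lemma has_sum_int_reflect:
  fixes f :: "int \<Rightarrow> 'a::{topological_comm_monoid_add, t2_space}"
  shows "((\<lambda>m. f (a - m)) has_sum s) UNIV \<longleftrightarrow> (f has_sum s) UNIV"
  by (rule has_sum_reindex_bij_betw)
    (auto simp: bij_betw_def inj_on_def surj_def intro!: exI[of _ "a - _"])

lemma summable_on_int_geometric: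
  fixes m :: real
  assumes "m > 1"
  shows "(\<lambda>k::int. m powi (- \<bar>k\<bar>)) summable_on UNIV"
proof -
  have geo: "(\<lambda>n::nat. (1 / m) ^ n) summable_on UNIV"
    using assms by (intro summable_nonneg_imp_summable_on summable_geometric) auto
  have pw: "m powi (- int n) = (1 / m) ^ n" for n
    using assms by (simp add: power_int_minus power_one_over inverse_eq_divide)
  have "(\<lambda>k. m powi (- \<bar>k\<bar>)) summable_on range int"
    by (subst summable_on_reindex) (auto simp: o_def pw geo)
  moreover have "(\<lambda>k. m powi (- \<bar>k\<bar>)) summable_on range (\<lambda>n. - int n)"
    by (subst summable_on_reindex) (auto simp: o_def pw geo inj_on_def)
  moreover have "(UNIV :: int set) = range int \<union> range (\<lambda>n. - int n)"
  proof -
    have "x \<in> range int \<union> range (\<lambda>n. - int n)" for x by (cases x rule: int_cases2) auto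
    then show ?thesis by auto
  qed
  ultimately show ?thesis by (metis summable_on_union)
qed

text \<open>Young's inequality for the convolution of a summable with a square summable sequence, in
  the form of Schur's test: Cauchy-Schwarz with the weights \<open>g (n - m)\<close>, then summation
  over \<open>n\<close>.\<close>

lemma ell2_schur_test:
  fixes G :: "int \<Rightarrow> int \<Rightarrow> complex" and g :: "int \<Rightarrow> real"
  assumes G: "\<And>n m. cmod (G n m) \<le> g (n - m)" and g: "g summable_on UNIV"
    and \<psi>: "\<psi> \<in> ell2"
  shows "(\<lambda>m. G n m * \<psi> m) abs_summable_on UNIV"
    and "(\<lambda>n. \<Sum>\<^sub>\<infinity>m. G n m * \<psi> m) \<in> ell2"
    and "ell2_norm (\<lambda>n. \<Sum>\<^sub>\<infinity>m. G n m * \<psi> m) \<le> infsum g UNIV * ell2_norm \<psi>"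
proof -
  define B where "B = ell2_norm \<psi>"
  define Q where "Q = infsum g UNIV"
  have B: "cmod (\<psi> m) \<le> B" for m using ell2_bounded[OF \<psi>] by (simp add: B_def)
  have B0: "B \<ge> 0" using B[of 0] norm_ge_zero order_trans by blast
  have g0: "g k \<ge> 0" for k using order_trans[OF norm_ge_zero G[of k 0]] by simp
  have gQ: "(g has_sum Q) UNIV" using g by (simp add: Q_def)
  have gn: "((\<lambda>m. g (n - m)) has_sum Q) UNIV" for n
    using gQ by (simp add: has_sum_int_reflect[of g n])
  have gm: "((\<lambda>n. g (n - m)) has_sum Q) UNIV" for m
    using gQ has_sum_int_shift[of g "- m"] by simp
  have Q0: "Q \<ge> 0" using gQ g0 by (auto intro: has_sum_nonneg)
  have s1: "(\<lambda>m. g (n - m) * cmod (\<psi> m)) summable_on UNIV" for n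
  proof (rule summable_on_comparison_test)
    show "(\<lambda>m. g (n - m) * B) summable_on UNIV"
      using gn[of n] by (intro summable_on_cmult_left) (auto simp: summable_on_def)
    show "g (n - m) * cmod (\<psi> m) \<le> g (n - m) * B" for m
      using B g0 by (intro mult_left_mono) auto
  qed (auto simp: g0)
  have s2: "(\<lambda>m. g (n - m) * (cmod (\<psi> m))\<^sup>2) summable_on UNIV" for n
  proof (rule summable_on_comparison_test)
    show "(\<lambda>m. g (n - m) * B\<^sup>2) summable_on UNIV"
      using gn[of n] by (intro summable_on_cmult_left) (auto simp: summable_on_def)
    show "g (n - m) * (cmod (\<psi> m))\<^sup>2 \<le> g (n - m) * B\<^sup>2" for m
      using B g0 by (intro mult_left_mono power_mono) auto
  qed (auto simp: g0)
  show abs: "(\<lambda>m. G n m * \<psi> m) abs_summable_on UNIV" for n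
    by (rule summable_on_comparison_test[OF s1[of n]]) (auto simp: norm_mult intro!: mult_right_mono G)
  define \<phi> where "\<phi> n = (\<Sum>\<^sub>\<infinity>m. G n m * \<psi> m)" for n
  define T where "T n = (\<Sum>\<^sub>\<infinity>m. g (n - m) * (cmod (\<psi> m))\<^sup>2)" for n
  have pt: "(cmod (\<phi> n))\<^sup>2 \<le> Q * T n" for n
  proof -
    have "cmod (\<phi> n) \<le> (\<Sum>\<^sub>\<infinity>m. cmod (G n m * \<psi> m))"
      unfolding \<phi>_def using abs by (rule norm_infsum_bound)
    also have "\<dots> \<le> (\<Sum>\<^sub>\<infinity>m. g (n - m) * cmod (\<psi> m))"
      using abs[of n] s1[of n] by (rule infsum_mono) (auto simp: norm_mult intro!: mult_right_mono G)
    finally have "(cmod (\<phi> n))\<^sup>2 \<le> (\<Sum>\<^sub>\<infinity>m. g (n - m) * cmod (\<psi> m))\<^sup>2" by (intro power_mono) auto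
    also have "\<dots> \<le> (\<Sum>\<^sub>\<infinity>m. g (n - m)) * (\<Sum>\<^sub>\<infinity>m. g (n - m) * (cmod (\<psi> m))\<^sup>2)"
      using gn[of n] s1[of n] s2[of n] g0
      by (intro weighted_Cauchy_Schwarz_infsum) (auto simp: summable_on_def)
    finally show ?thesis using infsumI[OF gn[of n]] by (simp add: T_def)
  qed
  have \<psi>s: "(\<lambda>m. (cmod (\<psi> m))\<^sup>2) summable_on UNIV" using \<psi> by (simp add: ell2_def)
  \<comment> \<open>Only finitely many \<open>n\<close> are summed at a time, so a finite sum is
    interchanged with an infinite one.\<close>
  have fin: "(\<Sum>n\<in>F. (cmod (\<phi> n))\<^sup>2) \<le> Q\<^sup>2 * (\<Sum>\<^sub>\<infinity>m. (cmod (\<psi> m))\<^sup>2)" if F: "finite F" for F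
  proof -
    have h: "((\<lambda>m. \<Sum>n\<in>F. g (n - m) * (cmod (\<psi> m))\<^sup>2) has_sum (\<Sum>n\<in>F. T n)) UNIV"
      using F s2 by (intro has_sum_finite_sum) (auto simp: T_def)
    have h': "((\<lambda>m. Q * (cmod (\<psi> m))\<^sup>2) has_sum Q * (\<Sum>\<^sub>\<infinity>m. (cmod (\<psi> m))\<^sup>2)) UNIV"
      using \<psi>s by (intro has_sum_cmult_right) auto
    have "(\<Sum>n\<in>F. T n) \<le> Q * (\<Sum>\<^sub>\<infinity>m. (cmod (\<psi> m))\<^sup>2)"
    proof (rule has_sum_mono[OF h h'])
      fix m
      have "(\<Sum>n\<in>F. g (n - m)) \<le> Q"
        using F g0 gm[of m] by (intro finite_sum_le_has_sum[OF gm]) auto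
      then show "(\<Sum>n\<in>F. g (n - m) * (cmod (\<psi> m))\<^sup>2) \<le> Q * (cmod (\<psi> m))\<^sup>2"
        by (simp add: sum_distrib_right[symmetric] mult_right_mono)
    qed
    then have "Q * (\<Sum>n\<in>F. T n) \<le> Q * (Q * (\<Sum>\<^sub>\<infinity>m. (cmod (\<psi> m))\<^sup>2))"
      using Q0 by (rule mult_left_mono)
    moreover have "(\<Sum>n\<in>F. (cmod (\<phi> n))\<^sup>2) \<le> Q * (\<Sum>n\<in>F. T n)"
      unfolding sum_distrib_left using pt by (rule sum_mono)
    ultimately show ?thesis by (simp add: power2_eq_square mult.assoc)
  qed
  have \<phi>s: "(\<lambda>n. (cmod (\<phi> n))\<^sup>2) summable_on UNIV"
    using fin by (intro nonneg_bdd_above_summable_on) (auto intro!: bdd_aboveI2)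
  then show "(\<lambda>n. \<Sum>\<^sub>\<infinity>m. G n m * \<psi> m) \<in> ell2" by (simp add: ell2_def \<phi>_def)
  have "(\<Sum>\<^sub>\<infinity>n. (cmod (\<phi> n))\<^sup>2) \<le> Q\<^sup>2 * (\<Sum>\<^sub>\<infinity>m. (cmod (\<psi> m))\<^sup>2)"
    using \<phi>s fin by (intro infsum_le_finite_sums) auto
  then have "ell2_norm \<phi> \<le> sqrt (Q\<^sup>2 * (\<Sum>\<^sub>\<infinity>m. (cmod (\<psi> m))\<^sup>2))"
    unfolding ell2_norm_def by (rule real_sqrt_le_mono)
  also have "\<dots> = Q * ell2_norm \<psi>" using Q0 by (simp add: ell2_norm_def real_sqrt_mult)
  finally show "ell2_norm (\<lambda>n. \<Sum>\<^sub>\<infinity>m. G n m * \<psi> m) \<le> infsum g UNIV * ell2_norm \<psi>"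
    by (simp add: \<phi>_def[abs_def] Q_def)
qed

text \<open>The resolvent is written down explicitly: \<open>u\<close> decays to the left and
  \<open>v\<close> to the right, so gluing them along the diagonal gives a Green function that
  decays like \<open>cmod \<mu> powi (- \<bar>n - m\<bar>)\<close> and is bounded by Schur's
  test.\<close>

lemma floquet_pair_not_spectrum:
  assumes pair: "floquet_pair V \<mu> u v" and \<mu>: "cmod \<mu> > 1"
  shows "\<mu> + inverse \<mu> \<notin> operator_spectrum (\<lambda>\<psi> n. \<psi> (n + 1) + \<psi> (n - 1) + V n * \<psi> n)"
proof -
  define E where "E = \<mu> + inverse \<mu>"
  define W where "W = \<mu> - inverse \<mu>"
  define K where "K = 4 / (1 - 1 / (cmod \<mu>)\<^sup>2)"
  let ?m = "cmod \<mu>"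
  have m2: "?m\<^sup>2 > 1" "\<mu> \<noteq> 0" using \<mu> by (auto simp: one_less_power)
  have K: "K > 0" using m2 by (simp add: K_def divide_less_eq)
  have "?m * (1 - 1 / ?m\<^sup>2) > 0" using m2 \<mu> by (simp add: divide_less_eq)
  then have W0: "W \<noteq> 0" using floquet_pair_wronskian_ge[OF \<mu>] by (auto simp: W_def)
  have equ: "u (n + 1) + u (n - 1) + V n * u n = E * u n"
    and eqv: "v (n + 1) + v (n - 1) + V n * v n = E * v n"
    and wr: "u (n + 1) * v n - u n * v (n + 1) = W"
    and bu: "cmod (u n) \<le> K * ?m powi n" and bv: "cmod (v n) \<le> K * ?m powi (- n)" for n
    using pair by (simp_all add: floquet_pair_def W_def K_def E_def)
  define G where "G n m = - (u (min n m) * v (max n m)) / W" for n m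
  define g where "g k = K\<^sup>2 / cmod W * ?m powi (- \<bar>k\<bar>)" for k :: int
  have gs: "g summable_on UNIV"
    unfolding g_def using summable_on_int_geometric[OF \<mu>] by (rule summable_on_cmult_right)
  have Gg: "cmod (G n m) \<le> g (n - m)" for n m
  proof -
    have "cmod (u (min n m)) * cmod (v (max n m)) \<le> (K * ?m powi (min n m)) * (K * ?m powi (- max n m))"
      using bu bv K by (intro mult_mono) auto
    also have "\<dots> = K\<^sup>2 * (?m powi (min n m) * ?m powi (- max n m))"
      by (simp add: power2_eq_square)
    also have "?m powi (min n m) * ?m powi (- max n m) = ?m powi (min n m + - max n m)"
      using m2 by (intro power_int_add[symmetric]) auto
    also have "min n m + - max n m = - \<bar>n - m\<bar>" by (simp add: min_def max_def)
    finally show ?thesis by (simp add: G_def g_def norm_mult norm_divide divide_right_mono)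
  qed
  have sym: "G n m = G m n" for n m by (simp add: G_def min.commute max.commute)
  have green: "G (n + 1) m + G (n - 1) m + (V n - E) * G n m = (if n = m then 1 else 0)" for n m
  proof -
    have u1: "u (n + 1) = (E - V n) * u n - u (n - 1)" and v1: "v (n + 1) = (E - V n) * v n - v (n - 1)"
      using equ[of n] eqv[of n] by (simp_all add: left_diff_distrib eq_diff_eq add.assoc add.commute add.left_commute)
    consider "n < m" | "n = m" | "n > m" by linarith
    then show ?thesis
    proof cases
      case 1
      then have Gs: "G (n + 1) m = - (u (n + 1) * v m) / W" "G (n - 1) m = - (u (n - 1) * v m) / W" "G n m = - (u n * v m) / W"
        by (simp_all add: G_def min_def max_def)
      show ?thesis using 1 W0 unfolding Gs u1 by (simp add: field_simps)
    next
      case 3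
      then have Gs: "G (n + 1) m = - (u m * v (n + 1)) / W" "G (n - 1) m = - (u m * v (n - 1)) / W" "G n m = - (u m * v n) / W"
      proof -
        have "min (n + 1) m = m" "max (n + 1) m = n + 1" "min (n - 1) m = m" "max (n - 1) m = n - 1"
          "min n m = m" "max n m = n"
          using 3 by linarith+
        then show "G (n + 1) m = - (u m * v (n + 1)) / W" "G (n - 1) m = - (u m * v (n - 1)) / W"
            "G n m = - (u m * v n) / W"
          by (simp_all only: G_def)
      qed
      show ?thesis using 3 W0 unfolding Gs v1 by (simp add: field_simps)
    next
      case 2
      \<comment> \<open>On the diagonal the two neighbours belong to different branches of
        \<open>G\<close>; the defect in the equation is the Wronskian, which the normalisation by
        \<open>W\<close> turns into \<open>1\<close>.\<close>
      have Gs: "G (n + 1) m = - (u n * v (n + 1)) / W" "G (n - 1) m = - (u (n - 1) * v n) / W" "G n m = - (u n * v n) / W"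
        using 2 by (simp_all add: G_def min_def max_def)
      have "G (n + 1) m + G (n - 1) m + (V n - E) * G n m
          = (((E - V n) * u n - u (n - 1)) * v n - u n * v (n + 1)) / W"
        unfolding Gs using W0 by (simp add: field_simps)
      also have "\<dots> = (u (n + 1) * v n - u n * v (n + 1)) / W" unfolding u1 ..
      also have "\<dots> = 1" using wr W0 by simp
      finally show ?thesis using 2 by simp
    qed
  qed
  define R where "R \<psi> n = (\<Sum>\<^sub>\<infinity>m. G n m * \<psi> m)" for \<psi> n
  have Rs: "((\<lambda>m. G n m * \<psi> m) has_sum R \<psi> n) UNIV" if "\<psi> \<in> ell2" for \<psi> n
    using abs_summable_summable[OF ell2_schur_test(1)[OF Gg gs that]] by (simp add: R_def)
  have bdd: "bounded_operator R"
    unfolding bounded_operator_def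
  proof (intro conjI ballI allI exI)
    fix \<psi> assume \<psi>: "\<psi> \<in> ell2"
    show "R \<psi> \<in> ell2" using ell2_schur_test(2)[OF Gg gs \<psi>] by (simp add: R_def[abs_def])
    show "ell2_norm (R \<psi>) \<le> infsum g UNIV * ell2_norm \<psi>"
      using ell2_schur_test(3)[OF Gg gs \<psi>] by (simp add: R_def[abs_def])
    show "R (\<lambda>n. a * \<psi> n) = (\<lambda>n. a * R \<psi> n)" for a
    proof
      fix n
      have "((\<lambda>m. a * (G n m * \<psi> m)) has_sum a * R \<psi> n) UNIV"
        by (intro has_sum_cmult_right Rs \<psi>)
      then show "R (\<lambda>n. a * \<psi> n) n = a * R \<psi> n"
        unfolding R_def[of "\<lambda>n. a * \<psi> n"] by (intro infsumI) (simp add: mult.left_commute)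
    qed
    fix \<phi> assume \<phi>: "\<phi> \<in> ell2"
    show "R (\<lambda>n. \<psi> n + \<phi> n) = (\<lambda>n. R \<psi> n + R \<phi> n)"
    proof
      fix n
      have "((\<lambda>m. G n m * \<psi> m + G n m * \<phi> m) has_sum R \<psi> n + R \<phi> n) UNIV"
        by (intro has_sum_add Rs \<psi> \<phi>)
      then show "R (\<lambda>n. \<psi> n + \<phi> n) n = R \<psi> n + R \<phi> n"
        unfolding R_def[of "\<lambda>n. \<psi> n + \<phi> n"] by (intro infsumI) (simp add: distrib_left)
    qed
  qed
  have delta: "((\<lambda>m. (if n = m then 1 else 0) * \<psi> m) has_sum \<psi> n) UNIV" for \<psi> :: "int \<Rightarrow> complex" and n
    by (rule has_sum_finite_neutralI[of "{n}"]) auto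
  have left: "R (\<lambda>n. (\<psi> (n + 1) + \<psi> (n - 1) + V n * \<psi> n) - E * \<psi> n) = \<psi>" if \<psi>: "\<psi> \<in> ell2" for \<psi>
  proof
    fix n
    \<comment> \<open>A simultaneous shift of both arguments preserves their difference, so the
      shifted kernel has the same majorant \<open>g\<close>.\<close>
    have sh: "(\<lambda>m. G n (m + i) * \<psi> m) summable_on UNIV" for i
    proof -
      define G' where "G' k m = G (k + i) (m + i)" for k m
      have "cmod (G' k m) \<le> g (k - m)" for k m using Gg[of "k + i" "m + i"] by (simp add: G'_def)
      from abs_summable_summable[OF ell2_schur_test(1)[OF this gs \<psi>, of "n - i"]]
      show ?thesis by (simp add: G'_def)
    qed
    define s1 where "s1 = (\<Sum>\<^sub>\<infinity>m. G n (m + - 1) * \<psi> m)"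
    define s2 where "s2 = (\<Sum>\<^sub>\<infinity>m. G n (m + 1) * \<psi> m)"
    have h1: "((\<lambda>m. G n (m + - 1) * \<psi> m) has_sum s1) UNIV" and h2: "((\<lambda>m. G n (m + 1) * \<psi> m) has_sum s2) UNIV"
      using sh[of "- 1"] sh[of 1] by (simp_all add: s1_def s2_def)
    have a1: "((\<lambda>m. G n m * \<psi> (m + 1)) has_sum s1) UNIV"
      using h1 has_sum_int_shift[of "\<lambda>m. G n (m + - 1) * \<psi> m" 1 s1] by simp
    have a2: "((\<lambda>m. G n m * \<psi> (m - 1)) has_sum s2) UNIV"
      using h2 has_sum_int_shift[of "\<lambda>m. G n (m + 1) * \<psi> m" "- 1" s2] by simp
    \<comment> \<open>Summation by parts: symmetry of \<open>G\<close> gives the Green equation in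
      the second argument. The sum containing \<open>V\<close> is read off from that equation, and
      its convergence with it, rather than from a bound on \<open>V\<close>.\<close>
    have "((\<lambda>m. (if n = m then 1 else 0) * \<psi> m + (- 1) * (G n (m + - 1) * \<psi> m) + (- 1) * (G n (m + 1) * \<psi> m))
        has_sum \<psi> n + (- 1) * s1 + (- 1) * s2) UNIV"
      by (intro has_sum_add has_sum_cmult_right delta h1 h2)
    moreover have "(if n = m then 1 else 0) * \<psi> m + (- 1) * (G n (m + - 1) * \<psi> m) + (- 1) * (G n (m + 1) * \<psi> m)
        = G n m * ((V m - E) * \<psi> m)" for m
    proof -
      have *: "(if n = m then 1 else 0) = G n (m + 1) + G n (m - 1) + (V m - E) * G n m"
        using green[of m n] by (simp add: sym[of n] eq_commute)
      show ?thesis unfolding * by (simp add: algebra_simps)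
    qed
    ultimately have a3: "((\<lambda>m. G n m * ((V m - E) * \<psi> m)) has_sum \<psi> n + (- 1) * s1 + (- 1) * s2) UNIV" by simp
    have "((\<lambda>m. G n m * \<psi> (m + 1) + G n m * \<psi> (m - 1) + G n m * ((V m - E) * \<psi> m)) has_sum
        s1 + s2 + (\<psi> n + (- 1) * s1 + (- 1) * s2)) UNIV"
      by (intro has_sum_add a1 a2 a3)
    then have "((\<lambda>m. G n m * ((\<psi> (m + 1) + \<psi> (m - 1) + V m * \<psi> m) - E * \<psi> m)) has_sum \<psi> n) UNIV"
      by (simp add: algebra_simps)
    then show "R (\<lambda>n. (\<psi> (n + 1) + \<psi> (n - 1) + V n * \<psi> n) - E * \<psi> n) n = \<psi> n"
      unfolding R_def by (rule infsumI)
  qed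
  have right: "(\<lambda>n. (R \<psi> (n + 1) + R \<psi> (n - 1) + V n * R \<psi> n) - E * R \<psi> n) = \<psi>" if \<psi>: "\<psi> \<in> ell2" for \<psi>
  proof
    fix n
    have "((\<lambda>m. G (n + 1) m * \<psi> m + G (n - 1) m * \<psi> m + (V n - E) * (G n m * \<psi> m)) has_sum
        R \<psi> (n + 1) + R \<psi> (n - 1) + (V n - E) * R \<psi> n) UNIV"
      by (intro has_sum_add has_sum_cmult_right Rs \<psi>)
    moreover have "G (n + 1) m * \<psi> m + G (n - 1) m * \<psi> m + (V n - E) * (G n m * \<psi> m)
        = (if n = m then 1 else 0) * \<psi> m" for m
      unfolding green[symmetric] by (simp add: algebra_simps)
    ultimately have "((\<lambda>m. (if n = m then 1 else 0) * \<psi> m) has_sum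
        R \<psi> (n + 1) + R \<psi> (n - 1) + (V n - E) * R \<psi> n) UNIV" by simp
    from has_sum_unique[OF this delta]
    show "(R \<psi> (n + 1) + R \<psi> (n - 1) + V n * R \<psi> n) - E * R \<psi> n = \<psi> n" by (simp add: algebra_simps)
  qed
  show ?thesis
    unfolding operator_spectrum_def E_def[symmetric] using bdd left right by blast
qed


section \<open>Quasiperiodic potentials with spectrum in the cone\<close>

text \<open>One sequence of finite index sets, chosen for the moduli of the coefficients,
  approximates the series at every \<open>x\<close>, so the sum is a pointwise limit of a sequence
  of measurable functions.\<close>

lemma borel_measurable_cis_series:
  fixes c :: "'k \<Rightarrow> complex" and \<theta> :: "'k \<Rightarrow> 'a \<Rightarrow> real"
  assumes c: "c abs_summable_on \<Gamma>" and \<theta>: "\<And>k. k \<in> \<Gamma> \<Longrightarrow> \<theta> k \<in> borel_measurable M"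
  shows "(\<lambda>x. \<Sum>\<^sub>\<infinity>k\<in>\<Gamma>. c k * cis (\<theta> k x)) \<in> borel_measurable M"
proof -
  have "\<exists>F. finite F \<and> F \<subseteq> \<Gamma> \<and> dist (\<Sum>k\<in>F. norm (c k)) (\<Sum>\<^sub>\<infinity>k\<in>\<Gamma>. norm (c k)) \<le> 1 / real (Suc n)" for n
    using infsum_finite_approximation[OF c, of "1 / real (Suc n)"] by auto
  then obtain F where F: "\<And>n. finite (F n)" "\<And>n. F n \<subseteq> \<Gamma>"
    "\<And>n. dist (\<Sum>k\<in>F n. norm (c k)) (\<Sum>\<^sub>\<infinity>k\<in>\<Gamma>. norm (c k)) \<le> 1 / real (Suc n)" by metis
  show ?thesis
  proof (rule borel_measurable_LIMSEQ_metric)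
    have "cis \<in> borel_measurable borel"
      unfolding cis_conv_exp[abs_def] by (intro borel_measurable_continuous_onI continuous_intros)
    then show "(\<lambda>x. \<Sum>k\<in>F n. c k * cis (\<theta> k x)) \<in> borel_measurable M" for n
      using F(2)[of n] by (intro borel_measurable_sum borel_measurable_times borel_measurable_const
          measurable_compose[OF \<theta>]) auto
    show "(\<lambda>n. \<Sum>k\<in>F n. c k * cis (\<theta> k x)) \<longlonglongrightarrow> (\<Sum>\<^sub>\<infinity>k\<in>\<Gamma>. c k * cis (\<theta> k x))" for x
    proof (rule metric_tendsto_imp_tendsto)
      show "(\<lambda>n. 1 / real (Suc n)) \<longlonglongrightarrow> 0" by real_asymp
      have "dist (\<Sum>k\<in>F n. c k * cis (\<theta> k x)) (\<Sum>\<^sub>\<infinity>k\<in>\<Gamma>. c k * cis (\<theta> k x)) \<le> 1 / real (Suc n)" for n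
      proof -
        have abs: "(\<lambda>k. c k * cis (\<theta> k x)) abs_summable_on \<Gamma>" using c by (simp add: norm_mult)
        have abs': "(\<lambda>k. c k * cis (\<theta> k x)) abs_summable_on \<Gamma> - F n"
          using abs by (rule summable_on_subset_banach) auto
        have "(\<Sum>\<^sub>\<infinity>k\<in>\<Gamma>. c k * cis (\<theta> k x)) - (\<Sum>k\<in>F n. c k * cis (\<theta> k x)) = (\<Sum>\<^sub>\<infinity>k\<in>\<Gamma> - F n. c k * cis (\<theta> k x))"
          using F(1,2)[of n] abs_summable_summable[OF abs] by (subst infsum_Diff) auto
        also have "norm \<dots> \<le> (\<Sum>\<^sub>\<infinity>k\<in>\<Gamma> - F n. norm (c k * cis (\<theta> k x)))" using abs' by (rule norm_infsum_bound)
        also have "\<dots> = (\<Sum>\<^sub>\<infinity>k\<in>\<Gamma>. norm (c k)) - (\<Sum>k\<in>F n. norm (c k))"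
          using F(1,2)[of n] c by (simp add: norm_mult, subst infsum_Diff) auto
        also have "\<dots> \<le> 1 / real (Suc n)" using F(3)[of n] by (simp add: dist_real_def abs_le_iff)
        finally show ?thesis by (simp add: dist_norm norm_minus_commute)
      qed
      then show "\<forall>\<^sub>F n in sequentially. dist (\<Sum>k\<in>F n. c k * cis (\<theta> k x)) (\<Sum>\<^sub>\<infinity>k\<in>\<Gamma>. c k * cis (\<theta> k x))
          \<le> dist (1 / real (Suc n)) 0"
        by (intro always_eventually allI) (simp add: dist_real_def)
    qed
  qed
qed

lemma pairing_eq_sum:
  fixes x :: "nat \<Rightarrow> 'a::real_normed_field"
  assumes "k \<in> lattice_fin d \<eta>" "\<eta> > 0"
  shows "pairing d k x = (\<Sum>j\<in>lattice_support d k. of_int (k j) * x j)"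
  unfolding pairing_def by (rule infsum_coords[OF assms]) simp

lemma analytic_series_on_torus:
  assumes "analytic_series d \<eta> h c v" "\<eta> > 0" "h > 0"
    and "\<Gamma> \<subseteq> lattice_fin d \<eta>" "\<And>k. k \<in> lattice_fin d \<eta> - \<Gamma> \<Longrightarrow> c k = 0"
  shows "on_torus v x = (\<Sum>\<^sub>\<infinity>k\<in>\<Gamma>. c k * cis (pairing d k x))"
proof -
  have "(\<lambda>j. complex_of_real (x j)) \<in> strip d \<eta> h"
    using assms(3) bracket_ge_1 by (auto simp: strip_def intro!: mult_pos_pos) (metis not_one_le_zero)
  then have "on_torus v x = (\<Sum>\<^sub>\<infinity>k\<in>lattice_fin d \<eta>. c k * exp (\<i> * pairing d k (\<lambda>j. complex_of_real (x j))))"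
    using assms(1) by (simp add: analytic_series_def on_torus_def)
  also have "\<dots> = (\<Sum>\<^sub>\<infinity>k\<in>\<Gamma>. c k * cis (pairing d k x))"
  proof (rule infsum_cong_neutral)
    fix k assume "k \<in> lattice_fin d \<eta> \<inter> \<Gamma>"
    then have k: "k \<in> lattice_fin d \<eta>" by simp
    have "pairing d k (\<lambda>j. complex_of_real (x j)) = complex_of_real (pairing d k x)"
      by (simp add: pairing_eq_sum[OF k assms(2)])
    then show "c k * exp (\<i> * pairing d k (\<lambda>j. complex_of_real (x j))) = c k * cis (pairing d k x)"
      by (simp add: cis_conv_exp)
  qed (use assms(4,5) in auto)
  finally show ?thesis .
qed

theorem theorem1p4:
  fixes d :: enat and \<eta> \<tau> h r M :: real and w \<alpha> :: "nat \<Rightarrow> real"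
  assumes "d \<ge> 1" and "\<eta> > 0" and "\<tau> > 1"
    and "\<forall>j\<in>coords d. w j > 0" and "(w has_sum 1) (coords d)"
    and "h > 0" and "0 < r" and "r \<le> 1"
    and "\<alpha> \<in> DC d \<eta> \<tau>"
  shows "\<exists>lam0>0. \<forall>v c.
    analytic_series d \<eta> h c v \<and> (\<forall>k\<in>lattice_fin d \<eta> - spectral_cone d \<eta> w r. c k = 0) \<and>
    series_norm d \<eta> h c = M \<longrightarrow>
    (\<forall>lam::real. \<bar>lam\<bar> < lam0 \<longrightarrow>
      (let V = (\<lambda>x. of_real lam * on_torus v x) in
        (\<forall>E. has_lyapunov_exponent d \<alpha> V E (ln (cmod (E / 2 + sqrt_branch E / 2)))) \<and>
        (\<forall>x. \<forall>E\<in>operator_spectrum (schrodinger_operator \<alpha> V x).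
           has_lyapunov_exponent d \<alpha> V E 0)))"
proof -
  define \<Gamma> where "\<Gamma> = spectral_cone d \<eta> w r"
  have \<Gamma>: "\<Gamma> \<subseteq> lattice_fin d \<eta>" by (auto simp: \<Gamma>_def spectral_cone_def lattice_star_def)
  obtain A B \<sigma> where "nonresonant_frequencies \<Gamma> (\<lambda>k. pairing d k \<alpha>) (eta_norm d \<eta>) A B \<sigma>"
    unfolding \<Gamma>_def using cone_nonresonant[OF assms(9,2), of r w] assms(3,7) by auto
  then interpret nonresonant_frequencies \<Gamma> "\<lambda>k. pairing d k \<alpha>" "eta_norm d \<eta>" A B \<sigma> .
  obtain C where C: "C > 0" "\<And>c V \<mu>. (\<lambda>k. cmod (c k) * exp (h * eta_norm d \<eta> k)) summable_on \<Gamma> \<Longrightarrow>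
     C * (\<Sum>\<^sub>\<infinity>k\<in>\<Gamma>. cmod (c k) * exp (h * eta_norm d \<eta> k)) \<le> 1 / 2 \<Longrightarrow>
     (\<And>n. V n = (\<Sum>\<^sub>\<infinity>k\<in>\<Gamma>. c k * cis (of_int n * pairing d k \<alpha>))) \<Longrightarrow> cmod \<mu> > 1 \<Longrightarrow>
     \<exists>u v. floquet_pair V \<mu> u v"
    using floquet_pair_exists[OF assms(6)] by blast
  \<comment> \<open>Solves \<open>C * lam0 * (\<bar>M\<bar> + 1) = 1 / 2\<close>, the smallness
    condition for the Floquet series; adding \<open>1\<close> keeps the denominator positive when
    \<open>M = 0\<close>.\<close>
  define lam0 where "lam0 = 1 / (2 * C * (\<bar>M\<bar> + 1))"
  have lam0: "lam0 > 0" using C(1) by (simp add: lam0_def)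
  have main: "let V = (\<lambda>x. of_real lam * on_torus v x) in
        (\<forall>E. has_lyapunov_exponent d \<alpha> V E (ln (cmod (E / 2 + sqrt_branch E / 2)))) \<and>
        (\<forall>x. \<forall>E\<in>operator_spectrum (schrodinger_operator \<alpha> V x). has_lyapunov_exponent d \<alpha> V E 0)"
    if v: "analytic_series d \<eta> h c v" and c0: "\<forall>k\<in>lattice_fin d \<eta> - \<Gamma>. c k = 0"
      and M: "series_norm d \<eta> h c = M" and lam: "\<bar>lam\<bar> < lam0" for v c lam
  proof -
    define V where "V x = of_real lam * on_torus v x" for x
    define P where "P k = cmod (c k) * exp (h * eta_norm d \<eta> k)" for k
    have P: "P summable_on \<Gamma>" "infsum P \<Gamma> = M"
    proof -
      have fin: "P summable_on lattice_fin d \<eta>" "infsum P (lattice_fin d \<eta>) = M"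
        using v M by (simp_all add: P_def[abs_def] analytic_series_def series_norm_def)
      show "P summable_on \<Gamma>" using fin(1) \<Gamma> by (rule summable_on_subset_banach)
      have "infsum P \<Gamma> = infsum P (lattice_fin d \<eta>)"
        using c0 \<Gamma> by (intro infsum_cong_neutral) (auto simp: P_def)
      then show "infsum P \<Gamma> = M" using fin(2) by simp
    qed
    have series: "V x = (\<Sum>\<^sub>\<infinity>k\<in>\<Gamma>. of_real lam * c k * cis (pairing d k x))" for x
    proof -
      have "on_torus v x = (\<Sum>\<^sub>\<infinity>k\<in>\<Gamma>. c k * cis (pairing d k x))"
        by (rule analytic_series_on_torus[OF v assms(2,6) \<Gamma>]) (use c0 in auto)
      then show ?thesis by (simp add: V_def mult.assoc infsum_cmult_right')
    qed
    have shift: "pairing d k (\<lambda>j. x j + t * \<alpha> j) = pairing d k x + t * pairing d k \<alpha>"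
      if "k \<in> \<Gamma>" for k x and t :: real
    proof -
      have "k \<in> lattice_fin d \<eta>" using that \<Gamma> by auto
      show ?thesis
        unfolding pairing_eq_sum[OF \<open>k \<in> lattice_fin d \<eta>\<close> assms(2)]
        by (simp add: sum.distrib distrib_left sum_distrib_left mult_ac)
    qed
    have pair: "\<exists>u v. floquet_pair (\<lambda>n. V (\<lambda>j. x j + of_int n * \<alpha> j)) \<mu> u v" if "cmod \<mu> > 1" for x \<mu>
    proof (rule C(2)[OF _ _ _ that])
      \<comment> \<open>The starting point \<open>x\<close> only multiplies the coefficients by
        phases, so their moduli, and with them the threshold, are the same for all
        \<open>x\<close>.\<close>
      let ?c = "\<lambda>k. of_real lam * c k * cis (pairing d k x)"
      have eq: "(\<lambda>k. cmod (?c k) * exp (h * eta_norm d \<eta> k)) = (\<lambda>k. \<bar>lam\<bar> * P k)"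
        by (simp add: P_def norm_mult fun_eq_iff)
      show "(\<lambda>k. cmod (?c k) * exp (h * eta_norm d \<eta> k)) summable_on \<Gamma>"
        unfolding eq using P(1) by (rule summable_on_cmult_right)
      have "C * (\<Sum>\<^sub>\<infinity>k\<in>\<Gamma>. cmod (?c k) * exp (h * eta_norm d \<eta> k)) = C * (\<bar>lam\<bar> * M)"
        unfolding eq using P by (simp add: infsum_cmult_right)
      also have "\<dots> \<le> C * (lam0 * (\<bar>M\<bar> + 1))"
        using C(1) lam lam0 by (intro mult_left_mono order_trans[OF mult_left_mono[of M "\<bar>M\<bar> + 1" "\<bar>lam\<bar>"]]
            mult_right_mono) auto
      also have "\<dots> = 1 / 2"
      proof -
        have "\<bar>M\<bar> + 1 \<noteq> 0" by linarith
        then show ?thesis using C(1) by (simp add: lam0_def)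
      qed
      finally show "C * (\<Sum>\<^sub>\<infinity>k\<in>\<Gamma>. cmod (?c k) * exp (h * eta_norm d \<eta> k)) \<le> 1 / 2" .
      fix n :: int
      show "V (\<lambda>j. x j + of_int n * \<alpha> j) = (\<Sum>\<^sub>\<infinity>k\<in>\<Gamma>. ?c k * cis (of_int n * pairing d k \<alpha>))"
        unfolding series by (intro infsum_cong) (simp add: shift cis_mult mult.assoc)
    qed
    have meas: "(\<lambda>x. V (\<lambda>j. x j + of_nat n * \<alpha> j)) \<in> borel_measurable (torus_haar d)" for n
      unfolding series
    proof (rule borel_measurable_cis_series)
      have "(\<lambda>k. \<bar>lam\<bar> * P k) summable_on \<Gamma>" using P(1) by (rule summable_on_cmult_right)
      then show "(\<lambda>k. of_real lam * c k) abs_summable_on \<Gamma>"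
      proof (rule summable_on_comparison_test)
        fix k
        have "1 \<le> exp (h * eta_norm d \<eta> k)" using assms(6) eta_norm_nonneg by simp
        then have "cmod (c k) * 1 \<le> P k" unfolding P_def by (intro mult_left_mono) auto
        then show "norm (of_real lam * c k) \<le> \<bar>lam\<bar> * P k" by (simp add: norm_mult mult_left_mono)
      qed auto
      fix k assume "k \<in> \<Gamma>"
      then have k: "k \<in> lattice_fin d \<eta>" using \<Gamma> by auto
      show "(\<lambda>x. pairing d k (\<lambda>j. x j + of_nat n * \<alpha> j)) \<in> borel_measurable (torus_haar d)"
        unfolding pairing_eq_sum[OF k assms(2)]
        by (intro borel_measurable_sum borel_measurable_times borel_measurable_add borel_measurable_const
            measurable_torus_coordinate) (auto simp: lattice_support_def)
    qed
    have lyap: "has_lyapunov_exponent d \<alpha> V E (ln (cmod (E / 2 + sqrt_branch E / 2)))" for E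
      using meas pair by (rule lyapunov_exponent_of_floquet_pairs)
    \<comment> \<open>A spectral energy must have \<open>cmod \<mu> = 1\<close>, as otherwise the
      resolvent exists; the exponent is then \<open>ln 1\<close>.\<close>
    have "has_lyapunov_exponent d \<alpha> V E 0" if E: "E \<in> operator_spectrum (schrodinger_operator \<alpha> V x)" for x E
    proof -
      define \<mu> where "\<mu> = E / 2 + sqrt_branch E / 2"
      have \<mu>: "cmod \<mu> \<ge> 1" "\<mu> + inverse \<mu> = E" using joukowski_branch[of E] by (auto simp: \<mu>_def)
      have "\<not> cmod \<mu> > 1"
      proof
        assume m: "cmod \<mu> > 1"
        obtain u v where "floquet_pair (\<lambda>n. V (\<lambda>j. x j + of_int n * \<alpha> j)) \<mu> u v" using pair[OF m] by blast
        from floquet_pair_not_spectrum[OF this m] E show False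
          by (simp add: \<mu>(2) schrodinger_operator_def[abs_def])
      qed
      then have "cmod \<mu> = 1" using \<mu>(1) by simp
      then show ?thesis using lyap[of E] by (simp add: \<mu>_def[symmetric])
    qed
    with lyap show ?thesis unfolding Let_def V_def[abs_def, symmetric] by blast
  qed
  show ?thesis
    by (rule exI[of _ lam0]) (use lam0 main in \<open>auto simp: \<Gamma>_def\<close>)
qed

end
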